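(* Let $\{w^k\}=\{(x^k,y^k,V_k)\}$ be an infinite sequence generated by Algorithm 2 (with scaling matrices equal to the identity) and suppose that Assumptions B and C hold. Let $\tilde c$ satisfy $\frac12<\tilde c<\frac{1-c}{1+c\alpha}<1$ and put $\tilde\varepsilon_k=\gamma_1\mu_k^{1+\tilde c\alpha}$. Then: 1. the full step-size $s^k_{1/2}=1$ is eventually adopted in Step 2-1; 2. $w^{k+1/2}\in\mathcal{N}_{\mu_k}^{\tilde\varepsilon_k}$, i.e., $R_{\mu_k}(w^{k+1/2})\le\tilde\varepsilon_k$, $F(x^{k+1/2})\in S^m_{++}$, and $V_{k+1/2}\in S^m_{++}$, for all $k$ sufficiently large; and 3. $\|w^{k+1/2}-w^\ast\|=O\left(\|w^k-w^\ast\|^{1+c\alpha}\right)$.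
   Context: Notation. $S^m$, $S^m_+$, $S^m_{++}$: real symmetric, positive semidefinite, positive definite $m\times m$ matrices. $X\circ Y=(XY+YX)/2$, $X\bullet Y=\mathrm{Tr}(XY)$, $\mathcal{L}_X(Z)=X\circ Z$ on $S^m$; $\mathrm{svec}(X)=(X_{11},\sqrt2X_{21},\ldots,\sqrt2X_{m1},X_{22},\sqrt2X_{32},\ldots,X_{mm})^\top$, and $X$ is identified with $\mathrm{svec}(X)$. $(\zeta)_+=\max(\zeta,0)$; $(F_i\bullet V)_{i=1}^n=(F_1\bullet V,\ldots,F_n\bullet V)^\top$. $\mathcal{M}_+(T)$ is the set of nonnegative finite regular Borel measures on $T$; $\mathrm{supp}(y)=\{\tau\in T:y(\{\tau\})\neq0\}$. Problem (SISDP). Minimize $f(x)$ over $x\in\mathbb{R}^n$ subject to $g(x,\tau)\le0$ for all $\tau\in T$ and $F(x)\in S^m_+$, where $f$ is continuously differentiable, $g:\mathbb{R}^n\times T\to\mathbb{R}$ is continuous with $g(\cdot,\tau)$ convex and continuously differentiable, $F(x)=F_0+\sum_{i=1}^nx_iF_i$ with $F_i\in S^m$, and $T\subset\mathbb{R}^q$ is a bounded closed set formed by finitely many sufficiently smooth inequality constraints. The solution set is nonempty. A KKT point is $(x,y,V)$ with $\nabla f(x)+\int_T\nabla_xg(x,\tau)\,dy(\tau)-(F_i\bullet V)_{i=1}^n=0$; $F(x)\circ V=O$, $F(x),V\in S^m_+$; $\int_Tg(x,\tau)\,dy(\tau)=0$, $g(x,\tau)\le0$ $(\tau\in T)$, $y\in\mathcal{M}_+(T)$.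 For $\mu\ge0$, $R_\mu(x,y,V)=\sqrt{\theta(x)^2+\|\phi_1\|^2+\phi_2^2+\|\phi_3\|^2}$ with $\theta(x)=\max_{\tau\in T}(g(x,\tau))_+$, $\phi_1=\nabla f(x)+\int_T\nabla_xg(x,\tau)\,dy(\tau)-(F_i\bullet V)_{i=1}^n$, $\phi_2=\int_Tg(x,\tau)\,dy(\tau)$, $\phi_3=\mathrm{svec}(F(x)\circ V-\mu I)$; $\mathcal{N}_\mu^\varepsilon=\{w=(x,y,V)\in\mathbb{R}^n\times\mathcal{M}_+(T)\times S^m_{++}:R_\mu(w)\le\varepsilon,\ F(x)\in S^m_{++}\}$. Local reduction. Fix $\sigma>0$. Let $S(x)$ be the set of all local maximizers of $\max_{\tau\in T}g(x,\tau)$ and $S_\sigma(x)=\{\tau\in S(x):g(x,\tau)>\max_{\tau'\in T}g(x,\tau')-\sigma\}$. A point $\bar x$ is nondegenerate if $|S_\sigma(\bar x)|<\infty$ and the linear independence constraint qualification, the second-order sufficient conditions and strict complementarity for $\max_{\tau\in T}g(\bar x,\tau)$ hold at every $\tau\in S_\sigma(\bar x)$. Then there are an open neighborhood $U(\bar x)$, $p(\bar x)=|S_\sigma(\bar x)|$, and twice continuously differentiable $\tau^i_{\bar x}:U(\bar x)\to T$ ($1\le i\le p(\bar x)$) such that for $x\in U(\bar x)$ one has $S_\sigma(x)=\{\tau^i_{\bar x}(x)\}_{i}$ and these are strict local maximizers of $g(x,\cdot)$ on $T$. Put $\hat g_i(x)=g(x,\tau^i_{\bar x}(x))$, $\hat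 g=(\hat g_i)_i$, $L(x,y)=f(x)+\sum_iy_i\hat g_i(x)-F(x)\bullet V$ (its Hessian $\nabla^2_{xx}L$ in $x$ does not depend on $V$). A discrete measure supported on $\{\tau^i_{\bar x}(x)\}_i$ is identified with the vector of its masses $y_i=y(\{\tau^i_{\bar x}(x)\})$; in particular the vector $y^{k+1/2}$ below is regarded as the measure with masses $y^{k+1/2}_i$ at $\tau^i_{x^k}(x^{k+1/2})$. Algorithm 2 (with all scaling matrices equal to the identity). Parameters: $0<\alpha<1$, $0<\beta<1$, $\gamma_1,\gamma_2>0$, $\delta\in(0,1)$, $\mu_0>0$, $0<c\le\frac1{\alpha+2}$; $\varepsilon_0=\gamma_1\mu_0^{1+\alpha}$; $w^0=(x^0,y^0,V_0)$ with $y^0\in\mathcal{M}_+(T)$, $F(x^0),V_0\in S^m_{++}$. For $k=0,1,\ldots$ (stop if $w^k$ is a KKT point; here the sequence is infinite): Step 2-1. With $\hat g$ defined at $\bar x=x^k$, find $\Delta_{1/2}w^k=(\Delta_{1/2}x^k,\Delta_{1/2}y^k,\Delta_{1/2}V_k)$ as a solution $(\Delta x,\Delta y,\Delta V)$, at $(x,y,V)=w^k$ and $\mu=\mu_k$, of (a) $\nabla f(x)+\nabla^2_{xx}L(x,y)\Delta x+\nabla\hat g(x)(y+\Delta y)-(F_i\bullet(V+\Delta V))_{i=1}^n=0$, (b) $F(x)\circ(V+\Delta V)+\frac12\left(\mathcal{L}_V+\mathcal{L}_{F(x)}\mathcal{L}_V\mathcal{L}_{F(x)}^{-1}\right)\sum_{i=1}^n\Delta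 x_iF_i=\mu I$, (c) $0\le y+\Delta y\perp\hat g(x)+\nabla\hat g(x)^\top\Delta x\le0$. Set $w^{k+1/2}=(x^{k+1/2},y^{k+1/2},V_{k+1/2})=w^k+s^k_{1/2}\Delta_{1/2}w^k$. Let $J_a^k=\{i:\hat g_i(x^k)+\nabla\hat g_i(x^k)^\top\Delta_{1/2}x^k=0\}$. Step 2-2. Solve at $(x,y,V)=w^{k+1/2}$, $\mu=\mu_k$, the linear equations consisting of (a), (b) and $\hat g_i(x)+\nabla\hat g_i(x)^\top\Delta x=0$ $(i\in J_a^k)$, $y_i+\Delta y_i=0$ $(i\notin J_a^k)$. If solvable, call a solution $\Delta_1w^k=(\Delta_1x^k,\Delta_1y^k,\Delta_1V_k)$ and compute $s^k_1$; if not solvable or not well-defined (the functions $\hat g_i$, $i\in J_a^k$, defined at $x^k$ not being valid at $x^{k+1/2}$), go to Step 2-4. Step 2-3. If $w^k_+:=w^{k+1/2}+s^k_1\Delta_1w^k\in\mathcal{N}_{\mu_k}^{\varepsilon_k}$, set $w^{k+1}=w^k_+$ and go to Step 3; otherwise go to Step 2-4. Step 2-4. Find some $w^{k+1}\in\mathcal{N}_{\mu_k}^{\varepsilon_k}$ (by an auxiliary interior-point SQP method). Step 3. $\mu_{k+1}=\min(\beta\mu_k,\gamma_2\mu_k^{1+c\alpha})$, $\varepsilon_{k+1}=\gamma_1\mu_{k+1}^{1+\alpha}$. Step sizes, $j\in\{\frac12,1\}$: $s^k_j=\min(t^k_j,u^k_j)$, where with $\lambda=\lambda_{\min}\left(F(x^{k+j-1/2})^{-1}\sum_i(\Delta_jx^k)_iF_i\right)$,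 $t^k_j=-\delta/\lambda$ if $\lambda\le-1$ and $t^k_j=1$ otherwise; $u^k_j$ is defined likewise with $\lambda=\lambda_{\min}(V_{k+j-1/2}^{-1}\Delta_jV_k)$. Assumption B. (1) $\lim_{k\to\infty}w^k=w^\ast=(x^\ast,y^\ast,V_\ast)$, where $w^\ast$ is a KKT point of the SISDP. (2) $x^\ast$ is nondegenerate. (3) For sufficiently large $k$, $\{\tau^i_{x^k}(\cdot)\}_{i=1}^{p(x^k)}=\{\tau^i_{x^\ast}(\cdot)\}_{i=1}^{p(x^\ast)}$ and $\mathrm{supp}(y^k)\subseteq\{\tau^1_{x^\ast}(x^k),\ldots,\tau^{p(x^\ast)}_{x^\ast}(x^k)\}$. Accordingly $y^k$ and $y^\ast$ are identified with vectors in $\mathbb{R}^{p(x^\ast)}$ with entries $y^k_i=y^k(\{\tau^i_{x^\ast}(x^k)\})$, $y^\ast_i=y^\ast(\{\tau^i_{x^\ast}(x^\ast)\})$, and norms such as $\|w^k-w^\ast\|$ are Euclidean norms under this identification. Assumption C. Let $I_a(x^\ast)=\{i:\hat g_i(x^\ast)=0\}$. (1) $f$ and $g(\cdot,\tau)$ ($\tau\in T$) are three times continuously differentiable. (2) $J_a^k=I_a(x^\ast)$ for all sufficiently large $k$. (3) $F(x^\ast)+V_\ast\in S^m_{++}$ and $-\hat g_i(x^\ast)+y^\ast_i>0$ $(i=1,\ldots,p(x^\ast))$. (4) The Jacobian at $(x^\ast,(y^\ast_i)_{i\in I_a(x^\ast)},\mathrm{svec}(V_\ast))$ of the map $\Phi_0(x,\tilde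 y,\mathrm{svec}(V))=\left(\nabla f(x)+\sum_{i\in I_a(x^\ast)}y_i\nabla\hat g_i(x)-(F_i\bullet V)_{i=1}^n,\ (\hat g_i(x))_{i\in I_a(x^\ast)},\ \mathrm{svec}(F(x)\circ V)\right)$, $\tilde y=(y_i)_{i\in I_a(x^\ast)}$, is nonsingular.
   Formalization: g is assumed three times continuously differentiable jointly in (x,τ) on a neighborhood of ℝⁿ×T, not only in x for fixed τ (and the constraints defining T are C³); with smoothness in x alone, ĝ_i may be merely C² and part 2 can fail. *)

theory Defs
  imports "HOL-Analysis.Analysis" "HOL-Library.Landau_Symbols"
begin

section \<open>Smoothness and derivatives\<close>

text \<open>\<open>Ck_on k f S\<close>: \<open>f\<close> is \<open>k\<close> times continuously differentiable on the open set \<open>S\<close>.\<close>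

primrec Ck_on :: "nat \<Rightarrow> ('a::euclidean_space \<Rightarrow> 'b::real_normed_vector) \<Rightarrow> 'a set \<Rightarrow> bool" where
  "Ck_on 0 f S \<longleftrightarrow> continuous_on S f"
| "Ck_on (Suc k) f S \<longleftrightarrow> (\<forall>x\<in>S. f differentiable (at x)) \<and>
     (\<forall>b\<in>Basis. Ck_on k (\<lambda>x. frechet_derivative f (at x) b) S)"

definition grad :: "(real^'n \<Rightarrow> real) \<Rightarrow> real^'n \<Rightarrow> real^'n" where
  "grad f x = (\<chi> i. frechet_derivative f (at x) (axis i 1))"

definition hess :: "(real^'n \<Rightarrow> real) \<Rightarrow> real^'n \<Rightarrow> real^'n^'n" where
  "hess f x = jacobian (grad f) (at x)"


section \<open>Symmetric matrices\<close>

definition sym_mat :: "(real^'m^'m) set" where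
  "sym_mat = {X. transpose X = X}"

definition psd :: "(real^'m^'m) set" where
  "psd = {X \<in> sym_mat. \<forall>v. 0 \<le> v \<bullet> (X *v v)}"

definition pd :: "(real^'m^'m) set" where
  "pd = {X \<in> sym_mat. \<forall>v. v \<noteq> 0 \<longrightarrow> 0 < v \<bullet> (X *v v)}"

definition jprod :: "real^'m^'m \<Rightarrow> real^'m^'m \<Rightarrow> real^'m^'m" where
  "jprod X Y = (1/2) *\<^sub>R (X ** Y + Y ** X)"

definition jprod_inv :: "real^'m^'m \<Rightarrow> real^'m^'m \<Rightarrow> real^'m^'m" where
  "jprod_inv X = inv_into sym_mat (jprod X)"

definition tr_prod :: "real^'m^'m \<Rightarrow> real^'m^'m \<Rightarrow> real" where
  "tr_prod X Y = trace (X ** Y)"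

text \<open>The vector \<open>svec X\<close> is a family of reals over the positions of the lower triangle; the
  linear order on the index type fixes what "lower" means.\<close>

definition svec_idx :: "('m::{finite,linorder} \<times> 'm) set" where
  "svec_idx = {(a, b). b \<le> a}"

definition svec :: "real^'m::{finite,linorder}^'m::{finite,linorder} \<Rightarrow> 'm \<times> 'm \<Rightarrow> real" where
  "svec X = (\<lambda>(a, b). if a = b then X$a$a else sqrt 2 * X$a$b)"

text \<open>The symmetric matrix whose \<open>svec\<close> is the given family.\<close>

definition smat :: "('m \<times> 'm \<Rightarrow> real) \<Rightarrow> real^'m::{finite,linorder}^'m::{finite,linorder}" where
  "smat s = (\<chi> a b. if a = b then s (a, a) else s (max a b, min a b) / sqrt 2)"

definition svec_norm :: "real^'m::{finite,linorder}^'m::{finite,linorder} \<Rightarrow> real" where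
  "svec_norm X = L2_set (svec X) svec_idx"

text \<open>Only used for matrices \<open>A\<inverse> B\<close> with \<open>A\<close> positive definite and \<open>B\<close> symmetric; their
  eigenvalues are all real.\<close>

definition lambda_min :: "real^'m^'m \<Rightarrow> real" where
  "lambda_min A = Min {l. \<exists>v. v \<noteq> 0 \<and> A *v v = l *\<^sub>R v}"


section \<open>The problem\<close>

text \<open>The index set is \<open>{t. \<forall>j<ncons. hcon j t \<le> 0}\<close>.\<close>

record ('n::finite, 'm::finite, 'q::finite) sisdp =
  obj :: "real^'n \<Rightarrow> real"
  con :: "real^'n \<Rightarrow> real^'q \<Rightarrow> real"
  Fconst :: "real^'m^'m"
  Fcoef :: "'n \<Rightarrow> real^'m^'m"
  ncons :: nat
  hcon :: "nat \<Rightarrow> real^'q \<Rightarrow> real"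

definition Tset :: "('n::finite, 'm::finite, 'q::finite) sisdp \<Rightarrow> (real^'q) set" where
  "Tset P = {t. \<forall>j<ncons P. hcon P j t \<le> 0}"

definition Flin :: "('n::finite, 'm::finite, 'q::finite) sisdp \<Rightarrow> real^'n \<Rightarrow> real^'m^'m" where
  "Flin P dx = (\<Sum>i\<in>UNIV. dx$i *\<^sub>R Fcoef P i)"

definition Fmat :: "('n::finite, 'm::finite, 'q::finite) sisdp \<Rightarrow> real^'n \<Rightarrow> real^'m^'m" where
  "Fmat P x = Fconst P + Flin P x"

definition Fadj :: "('n::finite, 'm::finite, 'q::finite) sisdp \<Rightarrow> real^'m^'m \<Rightarrow> real^'n" where
  "Fadj P V = (\<chi> i. tr_prod (Fcoef P i) V)"

definition feasible :: "('n::finite, 'm::finite, 'q::finite) sisdp \<Rightarrow> real^'n \<Rightarrow> bool" where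
  "feasible P x \<longleftrightarrow> (\<forall>t\<in>Tset P. con P x t \<le> 0) \<and> Fmat P x \<in> psd"

definition solution :: "('n::finite, 'm::finite, 'q::finite) sisdp \<Rightarrow> real^'n \<Rightarrow> bool" where
  "solution P x \<longleftrightarrow> feasible P x \<and> (\<forall>x'. feasible P x' \<longrightarrow> obj P x \<le> obj P x')"

text \<open>"Sufficiently smooth" is read as \<open>C\<^sup>3\<close>, for the functions \<open>hcon j\<close> and for \<open>con\<close> as a function
  of both arguments (on a neighbourhood of the index set): this is what the implicit function
  theorem needs in order to produce \<open>C\<^sup>2\<close> local maximizers.\<close>

definition sisdp_problem :: "('n::finite, 'm::finite, 'q::finite) sisdp \<Rightarrow> bool" where
  "sisdp_problem P \<longleftrightarrow>
     Ck_on 1 (obj P) UNIV \<and>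
     continuous_on (UNIV \<times> Tset P) (\<lambda>(x, t). con P x t) \<and>
     (\<forall>t\<in>Tset P. convex_on UNIV (\<lambda>x. con P x t) \<and> Ck_on 1 (\<lambda>x. con P x t) UNIV) \<and>
     (\<exists>W. open W \<and> Tset P \<subseteq> W \<and> Ck_on 3 (\<lambda>(x, t). con P x t) (UNIV \<times> W)) \<and>
     Fconst P \<in> sym_mat \<and> (\<forall>i. Fcoef P i \<in> sym_mat) \<and>
     (\<forall>j<ncons P. Ck_on 3 (hcon P j) UNIV) \<and>
     bounded (Tset P) \<and> closed (Tset P) \<and> Tset P \<noteq> {} \<and>
     (\<exists>x. solution P x)"


section \<open>Measures and KKT points\<close>

definition Mplus :: "(real^'q::finite) set \<Rightarrow> (real^'q) measure set" where
  "Mplus T = {y. space y = T \<and> sets y = sets (restrict_space borel T) \<and> finite_measure y \<and>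
     (\<forall>A\<in>sets y. emeasure y A = (SUP K\<in>{K. compact K \<and> K \<subseteq> A}. emeasure y K)) \<and>
     (\<forall>A\<in>sets y. emeasure y A = (INF G\<in>{G. openin (top_of_set T) G \<and> A \<subseteq> G}. emeasure y G))}"

definition msupp :: "(real^'q::finite) measure \<Rightarrow> (real^'q) set" where
  "msupp y = {t \<in> space y. measure y {t} \<noteq> 0}"

definition discrete_measure :: "(real^'q::finite) measure \<Rightarrow> bool" where
  "discrete_measure y \<longleftrightarrow> emeasure y (space y - msupp y) = 0"

type_synonym ('n, 'm, 'q) point = "(real^'n) \<times> (real^'q) measure \<times> (real^'m^'m)"

text \<open>Suprema over the index set, here and below, are maxima: it is compact and \<open>con P x\<close> is
  continuous on it.\<close>

definition theta :: "('n::finite, 'm::finite, 'q::finite) sisdp \<Rightarrow> real^'n \<Rightarrow> real" where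
  "theta P x = (SUP t\<in>Tset P. max (con P x t) 0)"

definition phi1 :: "('n::finite, 'm::finite, 'q::finite) sisdp \<Rightarrow> ('n, 'm, 'q) point \<Rightarrow> real^'n" where
  "phi1 P = (\<lambda>(x, y, V). grad (obj P) x + (\<integral>t. grad (\<lambda>x'. con P x' t) x \<partial>y) - Fadj P V)"

definition phi2 :: "('n::finite, 'm::finite, 'q::finite) sisdp \<Rightarrow> ('n, 'm, 'q) point \<Rightarrow> real" where
  "phi2 P = (\<lambda>(x, y, V). \<integral>t. con P x t \<partial>y)"

definition kkt_point :: "('n::finite, 'm::finite, 'q::finite) sisdp \<Rightarrow> ('n, 'm, 'q) point \<Rightarrow> bool" where
  "kkt_point P = (\<lambda>(x, y, V).
     phi1 P (x, y, V) = 0 \<and>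
     jprod (Fmat P x) V = 0 \<and> Fmat P x \<in> psd \<and> V \<in> psd \<and>
     phi2 P (x, y, V) = 0 \<and> (\<forall>t\<in>Tset P. con P x t \<le> 0) \<and> y \<in> Mplus (Tset P))"

definition residual ::
  "('n::finite, 'm::{finite,linorder}, 'q::finite) sisdp \<Rightarrow> real \<Rightarrow> ('n, 'm, 'q) point \<Rightarrow> real" where
  "residual P mu = (\<lambda>(x, y, V).
     sqrt ((theta P x)\<^sup>2 + (norm (phi1 P (x, y, V)))\<^sup>2 + (phi2 P (x, y, V))\<^sup>2
       + (svec_norm (jprod (Fmat P x) V - mu *\<^sub>R mat 1))\<^sup>2))"

definition nbhd ::
  "('n::finite, 'm::{finite,linorder}, 'q::finite) sisdp \<Rightarrow> real \<Rightarrow> real \<Rightarrow> ('n, 'm, 'q) point set" where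
  "nbhd P mu e = {(x, y, V). y \<in> Mplus (Tset P) \<and> V \<in> pd \<and>
     residual P mu (x, y, V) \<le> e \<and> Fmat P x \<in> pd}"


section \<open>Local reduction\<close>

definition local_max :: "('n::finite, 'm::finite, 'q::finite) sisdp \<Rightarrow> real^'n \<Rightarrow> (real^'q) set" where
  "local_max P x = {t \<in> Tset P. \<exists>e>0. \<forall>t'\<in>Tset P. dist t' t < e \<longrightarrow> con P x t' \<le> con P x t}"

definition strict_local_max :: "('n::finite, 'm::finite, 'q::finite) sisdp \<Rightarrow> real^'n \<Rightarrow> (real^'q) set" where
  "strict_local_max P x = {t \<in> Tset P. \<exists>e>0. \<forall>t'\<in>Tset P.
     dist t' t < e \<longrightarrow> t' \<noteq> t \<longrightarrow> con P x t' < con P x t}"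

definition Ssig :: "('n::finite, 'm::finite, 'q::finite) sisdp \<Rightarrow> real \<Rightarrow> real^'n \<Rightarrow> (real^'q) set" where
  "Ssig P \<sigma> x = {t \<in> local_max P x. con P x t > (SUP t'\<in>Tset P. con P x t') - \<sigma>}"

definition active_h :: "('n::finite, 'm::finite, 'q::finite) sisdp \<Rightarrow> real^'q \<Rightarrow> nat set" where
  "active_h P t = {j. j < ncons P \<and> hcon P j t = 0}"

definition licq :: "('n::finite, 'm::finite, 'q::finite) sisdp \<Rightarrow> real^'q \<Rightarrow> bool" where
  "licq P t \<longleftrightarrow> (\<forall>a. (\<Sum>j\<in>active_h P t. a j *\<^sub>R grad (hcon P j) t) = 0 \<longrightarrow> (\<forall>j\<in>active_h P t. a j = 0))"

text \<open>Lagrange multipliers of the active constraints for maximizing \<open>con P x\<close> over the index set.\<close>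

definition multiplier ::
  "('n::finite, 'm::finite, 'q::finite) sisdp \<Rightarrow> real^'n \<Rightarrow> real^'q \<Rightarrow> (nat \<Rightarrow> real) \<Rightarrow> bool" where
  "multiplier P x t l \<longleftrightarrow> (\<forall>j\<in>active_h P t. 0 \<le> l j) \<and>
     grad (con P x) t = (\<Sum>j\<in>active_h P t. l j *\<^sub>R grad (hcon P j) t)"

definition critical_cone ::
  "('n::finite, 'm::finite, 'q::finite) sisdp \<Rightarrow> real^'n \<Rightarrow> real^'q \<Rightarrow> (real^'q) set" where
  "critical_cone P x t = {d. 0 \<le> grad (con P x) t \<bullet> d \<and> (\<forall>j\<in>active_h P t. grad (hcon P j) t \<bullet> d \<le> 0)}"

definition sosc ::
  "('n::finite, 'm::finite, 'q::finite) sisdp \<Rightarrow> real^'n \<Rightarrow> real^'q \<Rightarrow> (nat \<Rightarrow> real) \<Rightarrow> bool" where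
  "sosc P x t l \<longleftrightarrow> (\<forall>d\<in>critical_cone P x t. d \<noteq> 0 \<longrightarrow>
     d \<bullet> ((hess (con P x) t - (\<Sum>j\<in>active_h P t. l j *\<^sub>R hess (hcon P j) t)) *v d) < 0)"

definition strict_compl ::
  "('n::finite, 'm::finite, 'q::finite) sisdp \<Rightarrow> real^'q \<Rightarrow> (nat \<Rightarrow> real) \<Rightarrow> bool" where
  "strict_compl P t l \<longleftrightarrow> (\<forall>j\<in>active_h P t. 0 < l j)"

definition nondegenerate ::
  "('n::finite, 'm::finite, 'q::finite) sisdp \<Rightarrow> real \<Rightarrow> real^'n \<Rightarrow> bool" where
  "nondegenerate P \<sigma> x \<longleftrightarrow> finite (Ssig P \<sigma> x) \<and>
     (\<forall>t\<in>Ssig P \<sigma> x. licq P t \<and>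
       (\<exists>l. multiplier P x t l \<and> sosc P x t l \<and> strict_compl P t l))"

text \<open>\<open>thresh\<close> is \<open>\<sigma>\<close>; for each base point \<open>xb\<close>, \<open>rdom xb\<close> is the neighbourhood \<open>U(xb)\<close> and
  \<open>branch xb i\<close>, for \<open>i < np xb\<close>, are the functions \<open>\<tau>\<^sup>i\<close> attached to \<open>xb\<close>, meaningful on \<open>rdom xb\<close> only.\<close>

record ('n::finite, 'q::finite) reduction =
  thresh :: real
  rdom :: "real^'n \<Rightarrow> (real^'n) set"
  branch :: "real^'n \<Rightarrow> nat \<Rightarrow> real^'n \<Rightarrow> real^'q"

definition np ::
  "('n::finite, 'm::finite, 'q::finite) sisdp \<Rightarrow> ('n, 'q) reduction \<Rightarrow> real^'n \<Rightarrow> nat" where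
  "np P R xb = card (Ssig P (thresh R) xb)"

definition local_reduction ::
  "('n::finite, 'm::finite, 'q::finite) sisdp \<Rightarrow> ('n, 'q) reduction \<Rightarrow> real^'n \<Rightarrow> bool" where
  "local_reduction P R xb \<longleftrightarrow> open (rdom R xb) \<and> xb \<in> rdom R xb \<and>
     (\<forall>i<np P R xb. Ck_on 2 (branch R xb i) (rdom R xb)) \<and>
     (\<forall>x\<in>rdom R xb. Ssig P (thresh R) x = (\<lambda>i. branch R xb i x) ` {..<np P R xb} \<and>
        (\<forall>i<np P R xb. branch R xb i x \<in> strict_local_max P x))"

text \<open>The branches with indices in \<open>I\<close> as functions with domain \<open>rdom R xb\<close>.\<close>

definition branches :: "('n::finite, 'q::finite) reduction \<Rightarrow> real^'n \<Rightarrow> nat set \<Rightarrow> (real^'n \<Rightarrow> real^'q) set" where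
  "branches R xb I = (\<lambda>i. restrict (branch R xb i) (rdom R xb)) ` I"

definition ghat ::
  "('n::finite, 'm::finite, 'q::finite) sisdp \<Rightarrow> ('n, 'q) reduction \<Rightarrow> real^'n \<Rightarrow> nat \<Rightarrow> real^'n \<Rightarrow> real" where
  "ghat P R xb i x = con P x (branch R xb i x)"

definition lagr ::
  "('n::finite, 'm::finite, 'q::finite) sisdp \<Rightarrow> ('n, 'q) reduction \<Rightarrow> real^'n \<Rightarrow>
    (nat \<Rightarrow> real) \<Rightarrow> real^'m^'m \<Rightarrow> real^'n \<Rightarrow> real" where
  "lagr P R xb y V x = obj P x + (\<Sum>i<np P R xb. y i * ghat P R xb i x) - tr_prod (Fmat P x) V"

text \<open>In a \<open>vpoint\<close> the measure is replaced by the vector of its masses, of which only the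
  entries with index below \<open>np P R xb\<close> are relevant.\<close>

type_synonym ('n, 'm) vpoint = "(real^'n) \<times> (nat \<Rightarrow> real) \<times> (real^'m^'m)"

definition to_masses ::
  "('n::finite, 'q::finite) reduction \<Rightarrow> real^'n \<Rightarrow> ('n, 'm::finite, 'q) point \<Rightarrow> ('n, 'm) vpoint" where
  "to_masses R xb = (\<lambda>(x, y, V). (x, \<lambda>i. measure y {branch R xb i x}, V))"

definition from_masses ::
  "('n::finite, 'm::finite, 'q::finite) sisdp \<Rightarrow> ('n, 'q) reduction \<Rightarrow> real^'n \<Rightarrow>
    ('n, 'm) vpoint \<Rightarrow> ('n, 'm, 'q) point" where
  "from_masses P R xb = (\<lambda>(x, y, V).
     (x, measure_of (Tset P) (sets (restrict_space borel (Tset P)))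
          (\<lambda>A. \<Sum>i<np P R xb. ennreal (y i) * indicator A (branch R xb i x)), V))"

text \<open>Since \<^const>\<open>ennreal\<close> truncates negative reals, membership of a \<open>vpoint\<close> in the neighbourhood
  has to ask for nonnegative masses explicitly.\<close>

definition masses_in_nbhd ::
  "('n::finite, 'm::{finite,linorder}, 'q::finite) sisdp \<Rightarrow> ('n, 'q) reduction \<Rightarrow> real^'n \<Rightarrow>
    real \<Rightarrow> real \<Rightarrow> ('n, 'm) vpoint \<Rightarrow> bool" where
  "masses_in_nbhd P R xb mu e = (\<lambda>(x, y, V). x \<in> rdom R xb \<and> (\<forall>i<np P R xb. 0 \<le> y i) \<and>
     from_masses P R xb (x, y, V) \<in> nbhd P mu e)"


section \<open>The algorithm\<close>

record alg_params =
  alpha :: real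
  beta :: real
  gamma1 :: real
  gamma2 :: real
  delta :: real
  mu_init :: real
  cexp :: real

definition valid_params :: "alg_params \<Rightarrow> bool" where
  "valid_params A \<longleftrightarrow> 0 < alpha A \<and> alpha A < 1 \<and> 0 < beta A \<and> beta A < 1 \<and>
     0 < gamma1 A \<and> 0 < gamma2 A \<and> 0 < delta A \<and> delta A < 1 \<and> 0 < mu_init A \<and>
     0 < cexp A \<and> cexp A \<le> 1 / (alpha A + 2)"

primrec mu_seq :: "alg_params \<Rightarrow> nat \<Rightarrow> real" where
  "mu_seq A 0 = mu_init A"
| "mu_seq A (Suc k) = min (beta A * mu_seq A k) (gamma2 A * mu_seq A k powr (1 + cexp A * alpha A))"

definition eps_seq :: "alg_params \<Rightarrow> nat \<Rightarrow> real" where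
  "eps_seq A k = gamma1 A * mu_seq A k powr (1 + alpha A)"

definition eq_a ::
  "('n::finite, 'm::finite, 'q::finite) sisdp \<Rightarrow> ('n, 'q) reduction \<Rightarrow> real^'n \<Rightarrow>
    ('n, 'm) vpoint \<Rightarrow> ('n, 'm) vpoint \<Rightarrow> bool" where
  "eq_a P R xb = (\<lambda>(x, y, V) (dx, dy, dV).
     grad (obj P) x + hess (lagr P R xb y V) x *v dx
       + (\<Sum>i<np P R xb. (y i + dy i) *\<^sub>R grad (ghat P R xb i) x) - Fadj P (V + dV) = 0)"

definition eq_b ::
  "('n::finite, 'm::finite, 'q::finite) sisdp \<Rightarrow> real \<Rightarrow> ('n, 'm) vpoint \<Rightarrow> ('n, 'm) vpoint \<Rightarrow> bool" where
  "eq_b P mu = (\<lambda>(x, y, V) (dx, dy, dV). dV \<in> sym_mat \<and>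
     jprod (Fmat P x) (V + dV)
       + (1/2) *\<^sub>R (jprod V (Flin P dx)
           + jprod (Fmat P x) (jprod V (jprod_inv (Fmat P x) (Flin P dx)))) = mu *\<^sub>R mat 1)"

definition glin ::
  "('n::finite, 'm::finite, 'q::finite) sisdp \<Rightarrow> ('n, 'q) reduction \<Rightarrow> real^'n \<Rightarrow>
    real^'n \<Rightarrow> real^'n \<Rightarrow> nat \<Rightarrow> real" where
  "glin P R xb x dx i = ghat P R xb i x + grad (ghat P R xb i) x \<bullet> dx"

definition eq_c ::
  "('n::finite, 'm::finite, 'q::finite) sisdp \<Rightarrow> ('n, 'q) reduction \<Rightarrow> real^'n \<Rightarrow>
    ('n, 'm) vpoint \<Rightarrow> ('n, 'm) vpoint \<Rightarrow> bool" where
  "eq_c P R xb = (\<lambda>(x, y, V) (dx, dy, dV).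
     (\<forall>i<np P R xb. 0 \<le> y i + dy i \<and> glin P R xb x dx i \<le> 0) \<and>
     (\<Sum>i<np P R xb. (y i + dy i) * glin P R xb x dx i) = 0)"

definition eq_active ::
  "('n::finite, 'm::finite, 'q::finite) sisdp \<Rightarrow> ('n, 'q) reduction \<Rightarrow> real^'n \<Rightarrow> nat set \<Rightarrow>
    ('n, 'm) vpoint \<Rightarrow> ('n, 'm) vpoint \<Rightarrow> bool" where
  "eq_active P R xb J = (\<lambda>(x, y, V) (dx, dy, dV). \<forall>i<np P R xb.
     if i \<in> J then glin P R xb x dx i = 0 else y i + dy i = 0)"

definition max_step :: "real \<Rightarrow> real^'m^'m \<Rightarrow> real^'m^'m \<Rightarrow> real" where
  "max_step del X D = (let l = lambda_min (matrix_inv X ** D) in if l \<le> -1 then - del / l else 1)"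

definition step_size ::
  "('n::finite, 'm::finite, 'q::finite) sisdp \<Rightarrow> real \<Rightarrow> ('n, 'm) vpoint \<Rightarrow> ('n, 'm) vpoint \<Rightarrow> real" where
  "step_size P del = (\<lambda>(x, y, V) (dx, dy, dV).
     min (max_step del (Fmat P x) (Flin P dx)) (max_step del V dV))"

definition move :: "('n::finite, 'm::finite) vpoint \<Rightarrow> real \<Rightarrow> ('n, 'm) vpoint \<Rightarrow> ('n, 'm) vpoint" where
  "move = (\<lambda>(x, y, V) s (dx, dy, dV). (x + s *\<^sub>R dx, \<lambda>i. y i + s * dy i, V + s *\<^sub>R dV))"

text \<open>Below, \<open>w k\<close> is the \<open>k\<close>-th iterate and \<open>d k\<close> the direction computed in Step 2-1 of
  iteration \<open>k\<close>, whose base point is the \<open>x\<close>-component of \<open>w k\<close>.\<close>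

definition half_size ::
  "('n::finite, 'm::finite, 'q::finite) sisdp \<Rightarrow> ('n, 'q) reduction \<Rightarrow> alg_params \<Rightarrow>
    (nat \<Rightarrow> ('n, 'm, 'q) point) \<Rightarrow> (nat \<Rightarrow> ('n, 'm) vpoint) \<Rightarrow> nat \<Rightarrow> real" where
  "half_size P R A w d k = step_size P (delta A) (to_masses R (fst (w k)) (w k)) (d k)"

definition half_point ::
  "('n::finite, 'm::finite, 'q::finite) sisdp \<Rightarrow> ('n, 'q) reduction \<Rightarrow> alg_params \<Rightarrow>
    (nat \<Rightarrow> ('n, 'm, 'q) point) \<Rightarrow> (nat \<Rightarrow> ('n, 'm) vpoint) \<Rightarrow> nat \<Rightarrow> ('n, 'm) vpoint" where
  "half_point P R A w d k =
     move (to_masses R (fst (w k)) (w k)) (half_size P R A w d k) (d k)"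

definition Jact ::
  "('n::finite, 'm::finite, 'q::finite) sisdp \<Rightarrow> ('n, 'q) reduction \<Rightarrow>
    (nat \<Rightarrow> ('n, 'm, 'q) point) \<Rightarrow> (nat \<Rightarrow> ('n, 'm) vpoint) \<Rightarrow> nat \<Rightarrow> nat set" where
  "Jact P R w d k = {i. i < np P R (fst (w k)) \<and>
     glin P R (fst (w k)) (fst (w k)) (fst (d k)) i = 0}"

definition step_2_1 ::
  "('n::finite, 'm::finite, 'q::finite) sisdp \<Rightarrow> ('n, 'q) reduction \<Rightarrow> alg_params \<Rightarrow>
    (nat \<Rightarrow> ('n, 'm, 'q) point) \<Rightarrow> (nat \<Rightarrow> ('n, 'm) vpoint) \<Rightarrow> nat \<Rightarrow> bool" where
  "step_2_1 P R A w d k \<longleftrightarrow> (let xb = fst (w k); v = to_masses R xb (w k) in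
     nondegenerate P (thresh R) xb \<and>
     eq_a P R xb v (d k) \<and> eq_b P (mu_seq A k) v (d k) \<and> eq_c P R xb v (d k))"

definition corrector ::
  "('n::finite, 'm::finite, 'q::finite) sisdp \<Rightarrow> ('n, 'q) reduction \<Rightarrow> alg_params \<Rightarrow>
    (nat \<Rightarrow> ('n, 'm, 'q) point) \<Rightarrow> (nat \<Rightarrow> ('n, 'm) vpoint) \<Rightarrow> nat \<Rightarrow> ('n, 'm) vpoint \<Rightarrow> bool" where
  "corrector P R A w d k e \<longleftrightarrow> (let xb = fst (w k); v = half_point P R A w d k in
     eq_a P R xb v e \<and> eq_b P (mu_seq A k) v e \<and> eq_active P R xb (Jact P R w d k) v e)"

definition full_point ::
  "('n::finite, 'm::finite, 'q::finite) sisdp \<Rightarrow> ('n, 'q) reduction \<Rightarrow> alg_params \<Rightarrow>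
    (nat \<Rightarrow> ('n, 'm, 'q) point) \<Rightarrow> (nat \<Rightarrow> ('n, 'm) vpoint) \<Rightarrow> nat \<Rightarrow> ('n, 'm) vpoint \<Rightarrow> ('n, 'm) vpoint" where
  "full_point P R A w d k e = (let v = half_point P R A w d k in move v (step_size P (delta A) v e) e)"

definition steps_2_2_to_2_4 ::
  "('n::finite, 'm::{finite,linorder}, 'q::finite) sisdp \<Rightarrow> ('n, 'q) reduction \<Rightarrow> alg_params \<Rightarrow>
    (nat \<Rightarrow> ('n, 'm, 'q) point) \<Rightarrow> (nat \<Rightarrow> ('n, 'm) vpoint) \<Rightarrow> nat \<Rightarrow> bool" where
  "steps_2_2_to_2_4 P R A w d k \<longleftrightarrow>
     (if fst (half_point P R A w d k) \<in> rdom R (fst (w k)) \<and> (\<exists>e. corrector P R A w d k e)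
      then \<exists>e. corrector P R A w d k e \<and>
        (if masses_in_nbhd P R (fst (w k)) (mu_seq A k) (eps_seq A k) (full_point P R A w d k e)
         then w (Suc k) = from_masses P R (fst (w k)) (full_point P R A w d k e)
         else w (Suc k) \<in> nbhd P (mu_seq A k) (eps_seq A k))
      else w (Suc k) \<in> nbhd P (mu_seq A k) (eps_seq A k))"

definition algorithm2 ::
  "('n::finite, 'm::{finite,linorder}, 'q::finite) sisdp \<Rightarrow> ('n, 'q) reduction \<Rightarrow> alg_params \<Rightarrow>
    (nat \<Rightarrow> ('n, 'm, 'q) point) \<Rightarrow> (nat \<Rightarrow> ('n, 'm) vpoint) \<Rightarrow> bool" where
  "algorithm2 P R A w d \<longleftrightarrow>
     (case w 0 of (x, y, V) \<Rightarrow> y \<in> Mplus (Tset P) \<and> Fmat P x \<in> pd \<and> V \<in> pd) \<and>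
     (\<forall>k. \<not> kkt_point P (w k) \<and> step_2_1 P R A w d k \<and> steps_2_2_to_2_4 P R A w d k)"


section \<open>Assumptions at the limit point\<close>

definition wdist ::
  "('n::finite, 'm::{finite,linorder}, 'q::finite) sisdp \<Rightarrow> ('n, 'q) reduction \<Rightarrow>
    ('n, 'm, 'q) point \<Rightarrow> ('n, 'm, 'q) point \<Rightarrow> real" where
  "wdist P R ws w = (case to_masses R (fst ws) ws of (xs, ys, Vs) \<Rightarrow>
     case to_masses R (fst ws) w of (x, y, V) \<Rightarrow>
       sqrt ((norm (x - xs))\<^sup>2 + (\<Sum>i<np P R xs. (y i - ys i)\<^sup>2) + (svec_norm (V - Vs))\<^sup>2))"

text \<open>In (3), equality of functions includes equality of their domains. As \<^const>\<open>msupp\<close>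
  only collects the atoms of a measure, the possibility of identifying the measure with
  its vector of masses is stated separately.\<close>

definition assumption_B ::
  "('n::finite, 'm::{finite,linorder}, 'q::finite) sisdp \<Rightarrow> ('n, 'q) reduction \<Rightarrow>
    (nat \<Rightarrow> ('n, 'm, 'q) point) \<Rightarrow> ('n, 'm, 'q) point \<Rightarrow> bool" where
  "assumption_B P R w ws \<longleftrightarrow> (let xs = fst ws in
     (\<lambda>k. wdist P R ws (w k)) \<longlonglongrightarrow> 0 \<and> kkt_point P ws \<and>
     nondegenerate P (thresh R) xs \<and>
     (\<forall>\<^sub>F k in sequentially. case w k of (x, y, V) \<Rightarrow>
        rdom R x = rdom R xs \<and>
        branches R x {..<np P R x} = branches R xs {..<np P R xs} \<and>
        msupp y \<subseteq> (\<lambda>i. branch R xs i x) ` {..<np P R xs} \<and> discrete_measure y))"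

definition Iact ::
  "('n::finite, 'm::finite, 'q::finite) sisdp \<Rightarrow> ('n, 'q) reduction \<Rightarrow> real^'n \<Rightarrow> nat set" where
  "Iact P R xs = {i. i < np P R xs \<and> ghat P R xs i xs = 0}"

text \<open>Coordinates of the vectors \<open>(x, y, svec V)\<close> with \<open>y\<close> indexed by \<open>I\<close>.\<close>

datatype ('n, 'm) coord = CX 'n | CY nat | CV "'m \<times> 'm"

definition coords :: "nat set \<Rightarrow> ('n::finite, 'm::{finite,linorder}) coord set" where
  "coords I = range CX \<union> CY ` I \<union> CV ` svec_idx"

definition encode ::
  "('n::finite, 'm::{finite,linorder}) vpoint \<Rightarrow> ('n, 'm) coord \<Rightarrow> real" where
  "encode = (\<lambda>(x, y, V) r. case r of CX j \<Rightarrow> x$j | CY i \<Rightarrow> y i | CV ab \<Rightarrow> svec V ab)"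

definition decode ::
  "(('n::finite, 'm::{finite,linorder}) coord \<Rightarrow> real) \<Rightarrow> ('n, 'm) vpoint" where
  "decode z = (\<chi> j. z (CX j), \<lambda>i. z (CY i), smat (\<lambda>ab. z (CV ab)))"

definition Phi0 ::
  "('n::finite, 'm::{finite,linorder}, 'q::finite) sisdp \<Rightarrow> ('n, 'q) reduction \<Rightarrow> real^'n \<Rightarrow>
    (('n, 'm) coord \<Rightarrow> real) \<Rightarrow> ('n, 'm) coord \<Rightarrow> real" where
  "Phi0 P R xs z = (case decode z of (x, y, V) \<Rightarrow> (\<lambda>r. case r of
       CX j \<Rightarrow> (grad (obj P) x + (\<Sum>i\<in>Iact P R xs. y i *\<^sub>R grad (ghat P R xs i) x) - Fadj P V) $ j
     | CY i \<Rightarrow> ghat P R xs i x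
     | CV ab \<Rightarrow> svec (jprod (Fmat P x) V) ab))"

definition jacobian_entry ::
  "(('c \<Rightarrow> real) \<Rightarrow> 'c \<Rightarrow> real) \<Rightarrow> ('c \<Rightarrow> real) \<Rightarrow> 'c \<Rightarrow> 'c \<Rightarrow> real" where
  "jacobian_entry Phi z r s = deriv (\<lambda>t. Phi (z(s := t)) r) (z s)"

definition nonsingular_on :: "'c set \<Rightarrow> ('c \<Rightarrow> 'c \<Rightarrow> real) \<Rightarrow> bool" where
  "nonsingular_on I M \<longleftrightarrow> (\<forall>v. (\<forall>r\<in>I. (\<Sum>s\<in>I. M r s * v s) = 0) \<longrightarrow> (\<forall>s\<in>I. v s = 0))"

text \<open>In (2), the index sets refer to the enumerations of the branches at \<open>w k\<close> and at \<open>ws\<close>;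
  they are compared through the branches they select, as these enumerations may differ
  by a permutation.\<close>

definition assumption_C ::
  "('n::finite, 'm::{finite,linorder}, 'q::finite) sisdp \<Rightarrow> ('n, 'q) reduction \<Rightarrow>
    (nat \<Rightarrow> ('n, 'm, 'q) point) \<Rightarrow> (nat \<Rightarrow> ('n, 'm) vpoint) \<Rightarrow> ('n, 'm, 'q) point \<Rightarrow> bool" where
  "assumption_C P R w d ws \<longleftrightarrow> (case to_masses R (fst ws) ws of (xs, ys, Vs) \<Rightarrow>
     Ck_on 3 (obj P) UNIV \<and> (\<forall>t\<in>Tset P. Ck_on 3 (\<lambda>x. con P x t) UNIV) \<and>
     (\<forall>\<^sub>F k in sequentially.
        branches R (fst (w k)) (Jact P R w d k) = branches R xs (Iact P R xs)) \<and>
     Fmat P xs + Vs \<in> pd \<and> (\<forall>i<np P R xs. - ghat P R xs i xs + ys i > 0) \<and>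
     nonsingular_on (coords (Iact P R xs))
       (jacobian_entry (Phi0 P R xs) (encode (xs, ys, Vs))))"

end

theory Submission
  imports Defs
begin

text \<open>Near the limit the semi-infinite constraint may be replaced by the finitely many constraints
\<open>gh i x = con P x (\<tau> i x) \<le> 0\<close>, and Step 2-1 becomes an inexact Newton step for the smooth system
whose Jacobian is nonsingular by assumption. Let \<open>F\<close> and \<open>V\<close> be the matrices at the iterate, let
\<open>mu'\<close> be the barrier parameter for which the iterate was accepted and \<open>mu\<close> the current one, which
eventually is a constant times \<open>mu'\<close> to the power \<open>1 + c \<alpha>\<close>.

\<^item> The error of the iterate is exactly of order \<open>mu'\<close>. It is at most of that order because the
residual is and the Jacobian is nonsingular (\<open>error_le_mu\<close>), and at least of that order because
\<open>F \<circ> V\<close> is almost \<open>mu' I\<close> whereas the product vanishes at the limit (\<open>mu_le_error\<close>).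

\<^item> The scaled operator in the complementarity equation differs from the derivative of the product by
a term of size \<open>mu'\<^sup>\<alpha>\<close> times the step: the difference is a bracket with the commutator of \<open>F\<close> and
\<open>V\<close>, which is no larger than the centrality residual \<open>O(mu'\<^sup>1\<^sup>+\<^sup>\<alpha>)\<close>, composed with the inverse of
\<open>Z \<mapsto> F \<circ> Z\<close>, which is \<open>O(1 / mu')\<close> (\<open>norm_commutator_le\<close>, \<open>scaled_op_error\<close>).

\<^item> Consequently the full step reaches a point whose error is of order \<open>mu\<close> (\<open>new_error_le\<close>); with the
first item this is the superlinear estimate. All components of the residual at the new point are
quadratic in the step or consist of the scaling error, so they are \<open>O(mu'\<^sup>1\<^sup>+\<^sup>\<alpha>)\<close>, which is small
compared with the radius of the neighbourhood by the upper bound on \<open>ct\<close> (\<open>half_point_in_nbhd\<close>).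

\<^item> In particular \<open>F \<circ> V\<close> at the new point is \<open>mu I\<close> up to an error small compared with \<open>mu\<close>, while
\<open>F + V\<close> is near its limit, which is positive definite by strict complementarity. Both matrices are
therefore positive definite (\<open>pd_if_jprod_and_sum_pd\<close>), so the full step is admissible and the step
size rule selects it (\<open>max_step_eq_one\<close>).

Two points connect this to the semi-infinite problem. The gradient of \<open>gh i\<close> equals the gradient of
the constraint with the index frozen at \<open>\<tau> i x\<close>, because the branch point is maximal among nearby
indices for all nearby parameters (\<open>eventually_tau_maximal\<close>, \<open>grad_ghat\<close>). And the enumeration of the
branches at an iterate is a permutation of the one at the limit, so that all data can be moved to
the latter (\<open>renumbering_exists\<close>).\<close>

section \<open>Quadratic remainders\<close>

text \<open>What a \<open>C\<^sup>2\<close> function satisfies near a point, with constants that are uniform in both arguments.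
In this form the property passes to compositions by a short estimate, and it is all the
smoothness that the analysis of a Newton step needs.\<close>

definition quad_rem_at ::
  "('a::euclidean_space \<Rightarrow> 'b::real_normed_vector) \<Rightarrow> ('a \<Rightarrow> 'a \<Rightarrow> 'b) \<Rightarrow> 'a \<Rightarrow> bool" where
  "quad_rem_at F F' a \<longleftrightarrow> (\<exists>C>0. \<exists>r>0. \<forall>x\<in>ball a r. linear (F' x) \<and>
     (\<forall>h. norm (F' x h) \<le> C * norm h) \<and>
     (\<forall>y\<in>ball a r. norm (F y - F x - F' x (y - x)) \<le> C * (norm (y - x))\<^sup>2))"

lemma quad_rem_atI:
  assumes "0 < r"
    and "\<And>x. x \<in> ball a r \<Longrightarrow> linear (F' x)"
    and "\<And>x h. x \<in> ball a r \<Longrightarrow> norm (F' x h) \<le> C * norm h"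
    and "\<And>x y. x \<in> ball a r \<Longrightarrow> y \<in> ball a r \<Longrightarrow>
           norm (F y - F x - F' x (y - x)) \<le> D * (norm (y - x))\<^sup>2"
  shows "quad_rem_at F F' a"
proof -
  define K where "K = max 1 (max C D)"
  have K: "K > 0" "C \<le> K" "D \<le> K" by (auto simp: K_def)
  have "norm (F' x h) \<le> K * norm h" if "x \<in> ball a r" for x h
    by (rule order_trans[OF assms(3)[OF that] mult_right_mono[OF K(2)]]) simp
  moreover have "norm (F y - F x - F' x (y - x)) \<le> K * (norm (y - x))\<^sup>2"
    if "x \<in> ball a r" "y \<in> ball a r" for x y
    by (rule order_trans[OF assms(4)[OF that] mult_right_mono[OF K(3)]]) simp
  ultimately show ?thesis
    unfolding quad_rem_at_def using K(1) assms(1,2) by blast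
qed

lemma quad_rem_atE:
  assumes "quad_rem_at F F' a"
  obtains C r where "0 < C" "0 < r"
    "\<And>x. x \<in> ball a r \<Longrightarrow> linear (F' x)"
    "\<And>x h. x \<in> ball a r \<Longrightarrow> norm (F' x h) \<le> C * norm h"
    "\<And>x y. x \<in> ball a r \<Longrightarrow> y \<in> ball a r \<Longrightarrow>
           norm (F y - F x - F' x (y - x)) \<le> C * (norm (y - x))\<^sup>2"
  using assms unfolding quad_rem_at_def by meson

lemma quad_rem_at_has_derivative:
  assumes "quad_rem_at F F' a"
  shows "\<forall>\<^sub>F x in nhds a. (F has_derivative F' x) (at x)"
proof -
  obtain C r where C: "0 < C" "0 < r" "\<And>x. x \<in> ball a r \<Longrightarrow> linear (F' x)"
    "\<And>x y. x \<in> ball a r \<Longrightarrow> y \<in> ball a r \<Longrightarrow>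
           norm (F y - F x - F' x (y - x)) \<le> C * (norm (y - x))\<^sup>2"
    using quad_rem_atE[OF assms] by metis
  have "(F has_derivative F' x) (at x)" if x: "x \<in> ball a r" for x
  proof (rule has_derivativeI_sandwich[where e="r - dist x a" and H="\<lambda>y. C * norm (y - x)"])
    show "0 < r - dist x a" using x by (simp add: dist_commute)
    show "bounded_linear (F' x)" using C(3)[OF x] by (simp add: linear_conv_bounded_linear)
    show "((\<lambda>y. C * norm (y - x)) \<longlongrightarrow> 0) (at x)"
      by (auto intro!: tendsto_eq_intros)
    fix y assume y: "y \<noteq> x" "dist y x < r - dist x a"
    then have "y \<in> ball a r" using dist_triangle[of a y x] by (simp add: dist_commute)
    from C(4)[OF x this] have "norm (F y - F x - F' x (y - x)) \<le> (C * norm (y - x)) * norm (y - x)"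
      by (simp add: power2_eq_square mult.assoc)
    with y show "norm (F y - F x - F' x (y - x)) / norm (y - x) \<le> C * norm (y - x)"
      by (simp add: pos_divide_le_eq)
  qed
  then show ?thesis
    using C(2) by (auto simp: eventually_nhds_metric dist_commute)
qed

lemma quad_rem_at_lipschitz:
  assumes "quad_rem_at F F' a"
  obtains C r where "0 < C" "0 < r" "\<And>x y. x \<in> ball a r \<Longrightarrow> y \<in> ball a r \<Longrightarrow>
    norm (F y - F x) \<le> C * norm (y - x)"
proof -
  obtain C r where C: "0 < C" "0 < r"
    "\<And>x h. x \<in> ball a r \<Longrightarrow> norm (F' x h) \<le> C * norm h"
    "\<And>x y. x \<in> ball a r \<Longrightarrow> y \<in> ball a r \<Longrightarrow>
           norm (F y - F x - F' x (y - x)) \<le> C * (norm (y - x))\<^sup>2"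
    using quad_rem_atE[OF assms] by metis
  show ?thesis
  proof (rule that[of "C + C * (2 * r)" r])
    show "0 < C + C * (2 * r)" "0 < r" using C by (auto intro: add_pos_pos)
    fix x y assume xy: "x \<in> ball a r" "y \<in> ball a r"
    have "norm (y - x) \<le> 2 * r"
      using dist_triangle[of y x a] xy by (auto simp: dist_norm norm_minus_commute)
    then have "(norm (y - x))\<^sup>2 \<le> 2 * r * norm (y - x)"
      unfolding power2_eq_square by (intro mult_right_mono) auto
    have "norm (F y - F x) \<le> norm (F y - F x - F' x (y - x)) + norm (F' x (y - x))"
      by norm
    also have "\<dots> \<le> C * (norm (y - x))\<^sup>2 + C * norm (y - x)"
      using C(3)[OF xy(1), of "y - x"] C(4)[OF xy] by linarith
    also have "\<dots> \<le> C * (2 * r * norm (y - x)) + C * norm (y - x)"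
      using \<open>(norm (y - x))\<^sup>2 \<le> _\<close> C(1) by simp
    finally show "norm (F y - F x) \<le> (C + C * (2 * r)) * norm (y - x)"
      by (simp add: algebra_simps)
  qed
qed

text \<open>The increment of \<open>F\<close> from \<open>x\<close> to \<open>x + u\<close> can be expanded at \<open>x\<close>, or at \<open>a\<close> as a difference of
two increments. The two expansions differ by \<open>F' x u - F' a u\<close>, and if \<open>u\<close> is as long as
\<open>x - a\<close> then all remainders are of the order of the square of that length.\<close>

lemma quad_rem_at_derivative_lipschitz:
  assumes "quad_rem_at F F' a"
  obtains C r where "0 < C" "0 < r"
    "\<And>x h. x \<in> ball a r \<Longrightarrow> norm (F' x h - F' a h) \<le> C * norm (x - a) * norm h"
proof -
  obtain C r where C: "0 < C" "0 < r" "\<And>x. x \<in> ball a r \<Longrightarrow> linear (F' x)"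
    "\<And>x y. x \<in> ball a r \<Longrightarrow> y \<in> ball a r \<Longrightarrow>
           norm (F y - F x - F' x (y - x)) \<le> C * (norm (y - x))\<^sup>2"
    using quad_rem_atE[OF assms] by metis
  show ?thesis
  proof (rule that[of "6 * C" "r / 2"])
    show "0 < 6 * C" "0 < r / 2" using C by auto
    fix x h assume x: "x \<in> ball a (r / 2)"
    let ?\<rho> = "norm (x - a)"
    have xr: "x \<in> ball a r" and ar: "a \<in> ball a r" using x C(2) by auto
    note lx = C(3)[OF xr] and la = C(3)[OF ar]
    show "norm (F' x h - F' a h) \<le> 6 * C * norm (x - a) * norm h"
    proof (cases "h = 0 \<or> x = a")
      case True
      then show ?thesis using linear_0[OF lx] linear_0[OF la] by auto
    next
      case False
      define t where "t = ?\<rho> / norm h"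
      have t: "t > 0" using False by (simp add: t_def)
      define u where "u = t *\<^sub>R h"
      have nu: "norm u = ?\<rho>" using False by (simp add: u_def t_def)
      have \<rho>: "?\<rho> < r / 2" using x by (simp add: dist_norm norm_minus_commute)
      have xu: "x + u \<in> ball a r"
      proof -
        have "norm (a - (x + u)) \<le> ?\<rho> + norm u" by norm
        then show ?thesis using nu \<rho> by (simp add: dist_norm)
      qed
      have e1: "norm (F (x + u) - F x - F' x u) \<le> C * ?\<rho>\<^sup>2"
        using C(4)[OF xr xu] nu by simp
      have e2: "norm (F x - F a - F' a (x - a)) \<le> C * ?\<rho>\<^sup>2"
        using C(4)[OF ar xr] by simp
      have "norm (x + u - a) \<le> 2 * ?\<rho>" using nu norm_triangle_ineq[of "x - a" u]
        by (simp add: algebra_simps)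
      then have "(norm (x + u - a))\<^sup>2 \<le> (2 * ?\<rho>)\<^sup>2" by (rule power_mono) simp
      then have e3: "norm (F (x + u) - F a - F' a (x + u - a)) \<le> C * (4 * ?\<rho>\<^sup>2)"
        using C(1) order_trans[OF C(4)[OF ar xu], of "C * (4 * ?\<rho>\<^sup>2)"]
        by (simp add: power_mult_distrib)
      have "F' a (x + u - a) = F' a (x - a) + F' a u"
        using linear_add[OF la, of "x - a" u] by (simp add: algebra_simps)
      then have "F' x u - F' a u = (F (x + u) - F a - F' a (x + u - a))
          - (F (x + u) - F x - F' x u) - (F x - F a - F' a (x - a))" by simp
      have "norm (F' x u - F' a u) \<le> 6 * C * ?\<rho>\<^sup>2"
        unfolding \<open>F' x u - F' a u = _\<close> using e1 e2 e3 norm_triangle_ineq4[of "(F (x + u) - F a - F' a (x + u - a))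
          - (F (x + u) - F x - F' x u)" "F x - F a - F' a (x - a)"]
          norm_triangle_ineq4[of "F (x + u) - F a - F' a (x + u - a)" "F (x + u) - F x - F' x u"]
        by linarith
      moreover have "F' x u - F' a u = t *\<^sub>R (F' x h - F' a h)"
        by (simp add: u_def linear_scale[OF lx] linear_scale[OF la] scaleR_diff_right)
      ultimately have "t * norm (F' x h - F' a h) \<le> 6 * C * ?\<rho>\<^sup>2" using t by simp
      then have "norm (F' x h - F' a h) \<le> 6 * C * ?\<rho>\<^sup>2 / t"
        using t by (simp add: pos_le_divide_eq mult.commute)
      also have "\<dots> = 6 * C * ?\<rho> * norm h" using False
        by (simp add: t_def power2_eq_square field_simps)
      finally show ?thesis .
    qed
  qed
qed

lemma quad_rem_at_tendsto:
  assumes "quad_rem_at F F' a"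
  shows "isCont F a"
proof -
  have "(F has_derivative F' a) (at a)"
    using eventually_nhds_x_imp_x[OF quad_rem_at_has_derivative[OF assms]] .
  then show ?thesis by (rule has_derivative_continuous)
qed

text \<open>The remainder of \<open>G\<close> is quadratic in an increment of \<open>F\<close>, which is Lipschitz; the remainder
of \<open>F\<close> passes through the bounded derivative of \<open>G\<close>.\<close>

lemma quad_rem_at_compose:
  fixes F :: "'a::euclidean_space \<Rightarrow> 'b::euclidean_space" and G :: "'b \<Rightarrow> 'c::real_normed_vector"
  assumes F: "quad_rem_at F F' a" and G: "quad_rem_at G G' (F a)"
  shows "quad_rem_at (\<lambda>x. G (F x)) (\<lambda>x h. G' (F x) (F' x h)) a"
proof -
  obtain C r where C: "0 < C" "0 < r" "\<And>x. x \<in> ball a r \<Longrightarrow> linear (F' x)"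
    "\<And>x h. x \<in> ball a r \<Longrightarrow> norm (F' x h) \<le> C * norm h"
    "\<And>x y. x \<in> ball a r \<Longrightarrow> y \<in> ball a r \<Longrightarrow>
           norm (F y - F x - F' x (y - x)) \<le> C * (norm (y - x))\<^sup>2"
    using quad_rem_atE[OF F] by metis
  obtain D s where D: "0 < D" "0 < s" "\<And>x. x \<in> ball (F a) s \<Longrightarrow> linear (G' x)"
    "\<And>x h. x \<in> ball (F a) s \<Longrightarrow> norm (G' x h) \<le> D * norm h"
    "\<And>x y. x \<in> ball (F a) s \<Longrightarrow> y \<in> ball (F a) s \<Longrightarrow>
           norm (G y - G x - G' x (y - x)) \<le> D * (norm (y - x))\<^sup>2"
    using quad_rem_atE[OF G] by metis
  obtain L q where L: "0 < L" "0 < q" "\<And>x y. x \<in> ball a q \<Longrightarrow> y \<in> ball a q \<Longrightarrow>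
    norm (F y - F x) \<le> L * norm (y - x)"
    using quad_rem_at_lipschitz[OF F] by metis
  obtain p where p: "0 < p" "\<And>x. x \<in> ball a p \<Longrightarrow> F x \<in> ball (F a) s"
    using quad_rem_at_tendsto[OF F] D(2) unfolding continuous_at_eps_delta
    by (auto simp: dist_norm norm_minus_commute)
  define \<rho> where "\<rho> = min r (min q p)"
  have sub: "x \<in> ball a r" "x \<in> ball a q" "x \<in> ball a p" if "x \<in> ball a \<rho>" for x
    using that by (auto simp: \<rho>_def)
  show ?thesis
  proof (rule quad_rem_atI[where r=\<rho> and C="D * C" and D="D * L\<^sup>2 + D * C"])
    show "0 < \<rho>" using C L p by (simp add: \<rho>_def)
    fix x assume x: "x \<in> ball a \<rho>"
    show "linear (\<lambda>h. G' (F x) (F' x h))"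
      using linear_compose[OF C(3)[OF sub(1)[OF x]] D(3)[OF p(2)[OF sub(3)[OF x]]]]
      by (simp add: o_def)
    fix h show "norm (G' (F x) (F' x h)) \<le> D * C * norm h"
      using order_trans[OF D(4)[OF p(2)[OF sub(3)[OF x]]], of _ "D * (C * norm h)"]
        C(4)[OF sub(1)[OF x], of h] D(1) by (simp add: mult.assoc)
  next
    fix x y assume x: "x \<in> ball a \<rho>" and y: "y \<in> ball a \<rho>"
    let ?n = "norm (y - x)"
    note Fx = p(2)[OF sub(3)[OF x]] and Fy = p(2)[OF sub(3)[OF y]]
    have "norm (F y - F x) \<le> L * ?n" using L(3)[OF sub(2)[OF x] sub(2)[OF y]] .
    then have "(norm (F y - F x))\<^sup>2 \<le> (L * ?n)\<^sup>2" by (rule power_mono) simp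
    then have e1: "norm (G (F y) - G (F x) - G' (F x) (F y - F x)) \<le> D * (L * ?n)\<^sup>2"
      using D(1) order_trans[OF D(5)[OF Fx Fy], of "D * (L * ?n)\<^sup>2"] by simp
    have e2: "norm (G' (F x) (F y - F x - F' x (y - x))) \<le> D * (C * ?n\<^sup>2)"
      using D(1) order_trans[OF D(4)[OF Fx], of _ "D * (C * ?n\<^sup>2)"]
        C(5)[OF sub(1)[OF x] sub(1)[OF y]] by simp
    have eq: "G (F y) - G (F x) - G' (F x) (F' x (y - x)) =
        (G (F y) - G (F x) - G' (F x) (F y - F x)) + G' (F x) (F y - F x - F' x (y - x))"
      by (simp add: linear_diff[OF D(3)[OF Fx]])
    have "norm (G (F y) - G (F x) - G' (F x) (F' x (y - x))) \<le> D * (L * ?n)\<^sup>2 + D * (C * ?n\<^sup>2)"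
      unfolding eq using e1 e2 norm_triangle_ineq[of "G (F y) - G (F x) - G' (F x) (F y - F x)"
        "G' (F x) (F y - F x - F' x (y - x))"] by linarith
    then show "norm (G (F y) - G (F x) - G' (F x) (F' x (y - x))) \<le> (D * L\<^sup>2 + D * C) * ?n\<^sup>2"
      by (simp add: power_mult_distrib algebra_simps)
  qed
qed

lemma quad_rem_at_graph:
  fixes F :: "'a::euclidean_space \<Rightarrow> 'b::euclidean_space"
  assumes "quad_rem_at F F' a"
  shows "quad_rem_at (\<lambda>x. (x, F x)) (\<lambda>x h. (h, F' x h)) a"
proof -
  obtain C r where C: "0 < C" "0 < r" "\<And>x. x \<in> ball a r \<Longrightarrow> linear (F' x)"
    "\<And>x h. x \<in> ball a r \<Longrightarrow> norm (F' x h) \<le> C * norm h"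
    "\<And>x y. x \<in> ball a r \<Longrightarrow> y \<in> ball a r \<Longrightarrow>
           norm (F y - F x - F' x (y - x)) \<le> C * (norm (y - x))\<^sup>2"
    using quad_rem_atE[OF assms] by metis
  show ?thesis
  proof (rule quad_rem_atI[where r=r and C="1 + C" and D=C])
    fix x h assume x: "x \<in> ball a r"
    show "linear (\<lambda>h. (h, F' x h))"
      using C(3)[OF x] by (simp add: linear_iff)
    show "norm (h, F' x h) \<le> (1 + C) * norm h"
      using norm_Pair_le[of h "F' x h"] C(4)[OF x, of h] by (simp add: algebra_simps)
  qed (use C in auto)
qed

lemma quad_rem_at_vec:
  fixes F :: "'a::euclidean_space \<Rightarrow> real^'n"
  assumes "\<And>j. quad_rem_at (\<lambda>x. F x $ j) (\<lambda>x h. F' x h $ j) a"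
  shows "quad_rem_at F F' a"
proof -
  have "\<exists>C r. 0 < C \<and> 0 < r \<and> (\<forall>x\<in>ball a r. linear (\<lambda>h. F' x h $ j) \<and>
     (\<forall>h. norm (F' x h $ j) \<le> C * norm h) \<and>
     (\<forall>y\<in>ball a r. norm (F y $ j - F x $ j - F' x (y - x) $ j) \<le> C * (norm (y - x))\<^sup>2))" for j
    using assms[of j] unfolding quad_rem_at_def by blast
  then obtain C r where C: "\<And>j. 0 < C j" "\<And>j. 0 < r j"
    "\<And>j x. x \<in> ball a (r j) \<Longrightarrow> linear (\<lambda>h. F' x h $ j)"
    "\<And>j x h. x \<in> ball a (r j) \<Longrightarrow> norm (F' x h $ j) \<le> C j * norm h"
    "\<And>j x y. x \<in> ball a (r j) \<Longrightarrow> y \<in> ball a (r j) \<Longrightarrow>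
        norm (F y $ j - F x $ j - F' x (y - x) $ j) \<le> C j * (norm (y - x))\<^sup>2"
    by metis
  define \<rho> where "\<rho> = Min (range r)"
  have sub: "x \<in> ball a (r j)" if "x \<in> ball a \<rho>" for x j
  proof -
    have "\<rho> \<le> r j" unfolding \<rho>_def by (rule Min_le) auto
    then show ?thesis using that by auto
  qed
  show ?thesis
  proof (rule quad_rem_atI[where r=\<rho> and C="\<Sum>j\<in>UNIV. C j" and D="\<Sum>j\<in>UNIV. C j"])
    show "0 < \<rho>" unfolding \<rho>_def using C(2) by (subst Min_gr_iff) auto
    fix x assume x: "x \<in> ball a \<rho>"
    show "linear (F' x)"
    proof (rule linearI)
      show "F' x (u + v) = F' x u + F' x v" for u v
        using linear_add[OF C(3)[OF sub[OF x]]] by (simp add: vec_eq_iff)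
      show "F' x (c *\<^sub>R u) = c *\<^sub>R F' x u" for c u
        using linear_scale[OF C(3)[OF sub[OF x]]] by (simp add: vec_eq_iff)
    qed
    fix h
    have "norm (F' x h) \<le> (\<Sum>j\<in>UNIV. C j * norm h)"
      using C(4)[OF sub[OF x]] by (intro order_trans[OF norm_le_l1_cart] sum_mono) auto
    then show "norm (F' x h) \<le> (\<Sum>j\<in>UNIV. C j) * norm h" by (simp add: sum_distrib_right)
  next
    fix x y assume x: "x \<in> ball a \<rho>" and y: "y \<in> ball a \<rho>"
    have "norm (F y - F x - F' x (y - x)) \<le> (\<Sum>j\<in>UNIV. C j * (norm (y - x))\<^sup>2)"
      using C(5)[OF sub[OF x] sub[OF y]]
      by (intro order_trans[OF norm_le_l1_cart] sum_mono) auto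
    then show "norm (F y - F x - F' x (y - x)) \<le> (\<Sum>j\<in>UNIV. C j) * (norm (y - x))\<^sup>2"
      by (simp add: sum_distrib_right)
  qed
qed

lemma quad_rem_at_cong:
  assumes "quad_rem_at F F' a" "\<forall>\<^sub>F x in nhds a. F x = G x" "\<forall>\<^sub>F x in nhds a. F' x = G' x"
  shows "quad_rem_at G G' a"
proof -
  obtain C r where C: "0 < C" "0 < r" "\<And>x. x \<in> ball a r \<Longrightarrow> linear (F' x)"
    "\<And>x h. x \<in> ball a r \<Longrightarrow> norm (F' x h) \<le> C * norm h"
    "\<And>x y. x \<in> ball a r \<Longrightarrow> y \<in> ball a r \<Longrightarrow>
           norm (F y - F x - F' x (y - x)) \<le> C * (norm (y - x))\<^sup>2"
    using quad_rem_atE[OF assms(1)] by metis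
  obtain s where s: "0 < s" "\<And>x. x \<in> ball a s \<Longrightarrow> F x = G x \<and> F' x = G' x"
    using eventually_conj[OF assms(2,3)] unfolding eventually_nhds_metric
    by (auto simp: dist_commute)
  show ?thesis
  proof (rule quad_rem_atI[where r="min r s" and C=C and D=C])
    fix x assume x: "x \<in> ball a (min r s)"
    then have x': "x \<in> ball a r" "x \<in> ball a s" by auto
    show "linear (G' x)" using C(3)[OF x'(1)] s(2)[OF x'(2)] by simp
    show "norm (G' x h) \<le> C * norm h" for h using C(4)[OF x'(1), of h] s(2)[OF x'(2)] by simp
    fix y assume y: "y \<in> ball a (min r s)"
    then have y': "y \<in> ball a r" "y \<in> ball a s" by auto
    show "norm (G y - G x - G' x (y - x)) \<le> C * (norm (y - x))\<^sup>2"
      using C(5)[OF x'(1) y'(1)] s(2)[OF x'(2)] s(2)[OF y'(2)] by simp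
  qed (use C s in auto)
qed

lemma Ck_on_SucD:
  "Ck_on (Suc k) f S \<Longrightarrow> Ck_on k f S"
proof (induction k arbitrary: f)
  case 0
  then show ?case
    by (auto intro!: continuous_at_imp_continuous_on differentiable_imp_continuous_within)
next
  case (Suc k)
  have "Ck_on k (\<lambda>x. frechet_derivative f (at x) b) S" if "b \<in> Basis" for b
    using Suc.prems that by (intro Suc.IH) simp
  then show ?case using Suc.prems by simp
qed

lemma Ck_on_continuous: "Ck_on k f S \<Longrightarrow> continuous_on S f"
  by (induction k) (use Ck_on_SucD in auto)

lemma Ck1_derivative_bounded:
  fixes F :: "'a::euclidean_space \<Rightarrow> 'b::real_normed_vector"
  assumes "Ck_on 1 F S" "compact K" "K \<subseteq> S"
  obtains L where "0 \<le> L"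
    "\<And>x h. x \<in> K \<Longrightarrow> norm (frechet_derivative F (at x) h) \<le> L * norm h"
proof -
  have "\<exists>M\<ge>0. \<forall>x\<in>K. norm (frechet_derivative F (at x) b) \<le> M" if "b \<in> Basis" for b
  proof -
    have "continuous_on K (\<lambda>x. frechet_derivative F (at x) b)"
      using assms that by (auto intro: continuous_on_subset)
    then have "bounded ((\<lambda>x. frechet_derivative F (at x) b) ` K)"
      using assms(2) compact_continuous_image compact_imp_bounded by blast
    then show ?thesis
      by (auto simp: bounded_iff) (metis dual_order.trans linorder_linear)
  qed
  then obtain M where M: "\<And>b. b \<in> Basis \<Longrightarrow> 0 \<le> M b"
    "\<And>b x. b \<in> Basis \<Longrightarrow> x \<in> K \<Longrightarrow> norm (frechet_derivative F (at x) b) \<le> M b"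
    by metis
  show ?thesis
  proof (rule that[of "\<Sum>b\<in>Basis. M b"])
    show "0 \<le> (\<Sum>b\<in>Basis. M b)" using M by (intro sum_nonneg) auto
    fix x h assume x: "x \<in> K"
    then have "F differentiable (at x)" using assms by auto
    then have l: "linear (frechet_derivative F (at x))" by (rule linear_frechet_derivative)
    have "frechet_derivative F (at x) h = (\<Sum>b\<in>Basis. (h \<bullet> b) *\<^sub>R frechet_derivative F (at x) b)"
      by (subst euclidean_representation[of h, symmetric])
        (simp add: linear_sum[OF l] linear_scale[OF l])
    also have "norm \<dots> \<le> (\<Sum>b\<in>Basis. norm h * M b)"
      using M x by (intro order_trans[OF norm_sum] sum_mono)
        (auto intro!: mult_mono Basis_le_norm)
    finally show "norm (frechet_derivative F (at x) h) \<le> (\<Sum>b\<in>Basis. M b) * norm h"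
      by (simp add: sum_distrib_left mult.commute)
  qed
qed

text \<open>Two uses of the mean value inequality: the partial derivatives are Lipschitz on a compact ball,
hence the derivative is, and this bounds the remainder along a segment.\<close>

lemma quad_rem_at_Ck2:
  fixes F :: "'a::euclidean_space \<Rightarrow> 'b::real_normed_vector"
  assumes "open S" "a \<in> S" "Ck_on 2 F S"
  shows "quad_rem_at F (\<lambda>x. frechet_derivative F (at x)) a"
proof -
  let ?D = "\<lambda>x. frechet_derivative F (at x)"
  obtain r where r: "0 < r" "cball a r \<subseteq> S"
    using assms(1,2) open_contains_cball by blast
  have Ck: "Ck_on (Suc (Suc 0)) F S" using assms(3) by (simp add: numeral_2_eq_2)
  have diff: "F differentiable (at x)" if "x \<in> S" for x using Ck that by simp
  have lin: "linear (?D x)" if "x \<in> S" for x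
    by (rule linear_frechet_derivative[OF diff[OF that]])
  have C1: "Ck_on 1 F S" using Ck_on_SucD[OF Ck] by simp
  obtain L where L: "0 \<le> L" "\<And>x h. x \<in> cball a r \<Longrightarrow> norm (?D x h) \<le> L * norm h"
    using Ck1_derivative_bounded[OF C1 compact_cball r(2)] by metis
  have "\<exists>K\<ge>0. \<forall>x\<in>cball a r. \<forall>y\<in>cball a r. norm (?D x b - ?D y b) \<le> K * norm (x - y)"
    if b: "b \<in> Basis" for b
  proof -
    have C: "Ck_on 1 (\<lambda>x. ?D x b) S" using Ck b by simp
    obtain K where K: "0 \<le> K" "\<And>x h. x \<in> cball a r \<Longrightarrow>
        norm (frechet_derivative (\<lambda>x. ?D x b) (at x) h) \<le> K * norm h"
      using Ck1_derivative_bounded[OF C compact_cball r(2)] by metis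
    have "norm (?D x b - ?D y b) \<le> K * norm (x - y)" if "x \<in> cball a r" "y \<in> cball a r" for x y
    proof (rule differentiable_bound[OF convex_cball[of a r] _ _ that])
      fix z assume z: "z \<in> cball a r"
      then have "(\<lambda>x. ?D x b) differentiable (at z)" using C r by auto
      then show "((\<lambda>x. ?D x b) has_derivative frechet_derivative (\<lambda>x. ?D x b) (at z)) (at z within cball a r)"
        by (simp add: frechet_derivative_works has_derivative_at_withinI)
      show "onorm (frechet_derivative (\<lambda>x. ?D x b) (at z)) \<le> K"
        using K(2)[OF z] by (intro onorm_le) auto
    qed
    then show ?thesis using K by blast
  qed
  then obtain K where K: "\<And>b. b \<in> Basis \<Longrightarrow> 0 \<le> K b"
    "\<And>b x y. b \<in> Basis \<Longrightarrow> x \<in> cball a r \<Longrightarrow> y \<in> cball a r \<Longrightarrow>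
       norm (?D x b - ?D y b) \<le> K b * norm (x - y)"
    by metis
  define N where "N = (\<Sum>b\<in>Basis. K b)"
  have N: "0 \<le> N" unfolding N_def using K by (intro sum_nonneg) auto
  have lip: "norm (?D x h - ?D y h) \<le> N * norm (x - y) * norm h"
    if "x \<in> cball a r" "y \<in> cball a r" for x y h
  proof -
    have lx: "linear (?D x)" and ly: "linear (?D y)" using lin that r by auto
    have "?D x h - ?D y h = (\<Sum>b\<in>Basis. (h \<bullet> b) *\<^sub>R (?D x b - ?D y b))"
      by (subst (1 2) euclidean_representation[of h, symmetric])
        (simp add: linear_sum[OF lx] linear_scale[OF lx] linear_sum[OF ly] linear_scale[OF ly]
          sum_subtractf scaleR_diff_right)
    also have "norm \<dots> \<le> (\<Sum>b\<in>Basis. norm h * (K b * norm (x - y)))"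
      using K that by (intro order_trans[OF norm_sum] sum_mono)
        (auto intro!: mult_mono Basis_le_norm)
    finally show ?thesis
      by (simp add: N_def sum_distrib_left sum_distrib_right mult.commute mult.left_commute)
  qed
  show ?thesis
  proof (rule quad_rem_atI[where r=r and C=L and D=N])
    show "linear (?D x)" if "x \<in> ball a r" for x
      using that r(2) by (intro lin) auto
    show "norm (?D x h) \<le> L * norm h" if "x \<in> ball a r" for x h using that L(2)[of x h] by simp
    fix x y assume "x \<in> ball a r" and "y \<in> ball a r"
    then have x: "x \<in> cball a r" and y: "y \<in> cball a r" by auto
    have seg: "closed_segment x y \<subseteq> cball a r"
      using x y by (intro closed_segment_subset) auto
    have "norm (F y - F x - ?D x (y - x)) \<le> norm (y - x) * (N * norm (y - x))"
    proof (rule differentiable_bound_linearization[where S="closed_segment x y"])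
      show "x + t *\<^sub>R (y - x) \<in> closed_segment x y" if "t \<in> {0..1}" for t
        using that by (auto simp: in_segment algebra_simps)
      fix z assume z: "z \<in> closed_segment x y"
      then show "(F has_derivative ?D z) (at z within closed_segment x y)"
        using diff seg r(2) by (meson frechet_derivative_works has_derivative_at_withinI subsetD)
      have "norm (z - x) \<le> norm (y - x)"
        using segment_bound1[OF z] by (simp add: norm_minus_commute)
      moreover have "onorm (?D z - ?D x) \<le> N * norm (z - x)"
        using lip[of z x] seg z x by (intro onorm_le) (auto simp: fun_diff_def)
      ultimately show "onorm (?D z - ?D x) \<le> N * norm (y - x)"
        using N by (meson mult_left_mono order_trans)
    qed auto
    then show "norm (F y - F x - ?D x (y - x)) \<le> N * (norm (y - x))\<^sup>2"
      by (simp add: power2_eq_square mult.left_commute)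
  qed (use r in auto)
qed

section \<open>Symmetric and positive definite matrices\<close>

text \<open>Minimize the Rayleigh quotient of \<open>D\<close> and \<open>A\<close> over the unit sphere. At the minimizer the
semidefinite form of \<open>D - l A\<close> vanishes, so the minimizer lies in its kernel. Matrices acting on
vectors and linear maps acting on matrices are both used below, hence the abstract setting.\<close>

lemma generalized_eigenpair:
  fixes A D :: "'a::euclidean_space \<Rightarrow> 'a"
  assumes A: "linear A" "\<And>u v. A u \<bullet> v = u \<bullet> A v" "\<And>u. u \<noteq> 0 \<Longrightarrow> 0 < u \<bullet> A u"
    and D: "linear D" "\<And>u v. D u \<bullet> v = u \<bullet> D v"
  obtains l v where "v \<noteq> 0" "D v = l *\<^sub>R A v" "\<And>u. l * (u \<bullet> A u) \<le> u \<bullet> D u"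
proof -
  define q where "q u = (u \<bullet> D u) / (u \<bullet> A u)" for u
  let ?S = "sphere (0::'a) 1"
  have "continuous_on ?S q" unfolding q_def
    using A(3) linear_continuous_on[OF linear_conv_bounded_linear[THEN iffD1, OF A(1)], of ?S]
      linear_continuous_on[OF linear_conv_bounded_linear[THEN iffD1, OF D(1)], of ?S]
    by (intro continuous_intros ballI less_imp_neq[THEN not_sym] A(3)) auto
  moreover have "?S \<noteq> {}" by simp
  ultimately obtain v where v: "v \<in> ?S" "\<And>u. u \<in> ?S \<Longrightarrow> q v \<le> q u"
    using continuous_attains_inf[OF compact_sphere] by metis
  define l where "l = q v"
  have v0: "v \<noteq> 0" using v by auto
  have le: "l * (u \<bullet> A u) \<le> u \<bullet> D u" for u
  proof (cases "u = 0")
    case True then show ?thesis by simp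
  next
    case False
    define c where "c = 1 / norm u"
    have "c *\<^sub>R u \<in> ?S" using False by (simp add: c_def)
    from v(2)[OF this] have "l \<le> (c\<^sup>2 * (u \<bullet> D u)) / (c\<^sup>2 * (u \<bullet> A u))"
      by (simp add: q_def l_def linear_scale[OF A(1)] linear_scale[OF D(1)] power2_eq_square mult.assoc)
    moreover have "c\<^sup>2 > 0" using False by (simp add: c_def)
    ultimately have "l \<le> (u \<bullet> D u) / (u \<bullet> A u)" by simp
    then show ?thesis using A(3)[OF False] by (simp add: pos_le_divide_eq)
  qed
  define Q where "Q u = D u - l *\<^sub>R A u" for u
  have linQ: "linear Q" unfolding Q_def
    by (intro linear_compose_sub linear_compose_scale_right A D)
  have selfQ: "Q u \<bullet> w = u \<bullet> Q w" for u w by (simp add: Q_def inner_diff A D inner_diff_left inner_diff_right)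
  have psdQ: "0 \<le> u \<bullet> Q u" for u using le[of u] by (simp add: Q_def inner_diff_right)
  have vQ: "v \<bullet> Q v = 0" using A(3)[OF v0] by (simp add: Q_def inner_diff_right l_def q_def)
  \<comment> \<open>Otherwise the form would be negative at \<open>v - t *\<^sub>R Q v\<close> for small \<open>t\<close>.\<close>
  have "Q v = 0"
  proof (rule ccontr)
    assume nz: "Q v \<noteq> 0"
    let ?b = "Q v \<bullet> Q v" and ?c = "Q v \<bullet> Q (Q v)"
    have b: "?b > 0" using nz by simp
    have "0 \<le> (v - t *\<^sub>R Q v) \<bullet> Q (v - t *\<^sub>R Q v)" for t by (rule psdQ)
    moreover have "(v - t *\<^sub>R Q v) \<bullet> Q (v - t *\<^sub>R Q v) = t * (t * ?c - 2 * ?b)" for t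
      using vQ selfQ[of v "Q v"]
      by (simp add: linear_diff[OF linQ] linear_scale[OF linQ] inner_diff algebra_simps)
    ultimately have *: "0 \<le> t * (t * ?c - 2 * ?b)" for t by simp
    have c: "?c \<ge> 0" by (rule psdQ)
    define t where "t = ?b / (?c + 1)"
    have "t > 0" using b c by (simp add: t_def)
    moreover have "t * ?c - 2 * ?b < 0"
    proof -
      have "t * ?c = ?b * (?c / (?c + 1))" by (simp add: t_def)
      also have "\<dots> \<le> ?b * 1" using b c by (intro mult_left_mono) auto
      finally show ?thesis using b by linarith
    qed
    ultimately show False using *[of t] by (simp add: mult_le_0_iff zero_le_mult_iff)
  qed
  then show ?thesis using that[OF v0 _ le] by (simp add: Q_def)
qed

lemma sym_inner: "X \<in> sym_mat \<Longrightarrow> (X *v u) \<bullet> v = u \<bullet> (X *v v)"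
  unfolding sym_mat_def by (simp add: dot_lmul_matrix[symmetric]) (metis transpose_matrix_vector)

lemma pd_sym: "X \<in> pd \<Longrightarrow> X \<in> sym_mat" and psd_sym: "X \<in> psd \<Longrightarrow> X \<in> sym_mat"
  by (auto simp: pd_def psd_def)

lemma pd_pos: "X \<in> pd \<Longrightarrow> v \<noteq> 0 \<Longrightarrow> 0 < v \<bullet> (X *v v)"
  by (auto simp: pd_def)

lemma sym_mat_add: "X \<in> sym_mat \<Longrightarrow> Y \<in> sym_mat \<Longrightarrow> X + Y \<in> sym_mat"
  and sym_mat_diff: "X \<in> sym_mat \<Longrightarrow> Y \<in> sym_mat \<Longrightarrow> X - Y \<in> sym_mat"
  and sym_mat_scaleR: "X \<in> sym_mat \<Longrightarrow> c *\<^sub>R X \<in> sym_mat"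
  and sym_mat_zero: "0 \<in> sym_mat"
  and sym_mat_one: "mat 1 \<in> sym_mat"
  by (auto simp: sym_mat_def transpose_def vec_eq_iff mat_def)

lemma sym_mat_sum: "(\<And>i. i \<in> I \<Longrightarrow> X i \<in> sym_mat) \<Longrightarrow> (\<Sum>i\<in>I. X i) \<in> sym_mat"
  by (induction I rule: infinite_finite_induct) (auto simp: sym_mat_zero sym_mat_add)

lemma transpose_add_real: "transpose (X + Y :: real^'m^'n) = transpose X + transpose Y"
  by (simp add: transpose_def vec_eq_iff)

lemma jprod_sym: "X \<in> sym_mat \<Longrightarrow> Y \<in> sym_mat \<Longrightarrow> jprod X Y \<in> sym_mat"
  by (simp add: sym_mat_def jprod_def transpose_scalar transpose_add_real matrix_transpose_mul add.commute)

lemma bounded_bilinear_matrix_mul: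
  "bounded_bilinear ((**) :: real^'m^'m \<Rightarrow> real^'m^'m \<Rightarrow> real^'m^'m)"
  unfolding bilinear_conv_bounded_bilinear[symmetric] bilinear_def
  by (auto intro!: linearI simp: matrix_matrix_mult_def vec_eq_iff sum.distrib algebra_simps sum_distrib_left)

lemma bounded_bilinear_jprod:
  "bounded_bilinear (jprod :: real^'m^'m \<Rightarrow> real^'m^'m \<Rightarrow> real^'m^'m)"
proof -
  interpret M: bounded_bilinear "(**) :: real^'m^'m \<Rightarrow> real^'m^'m \<Rightarrow> real^'m^'m"
    by (rule bounded_bilinear_matrix_mul)
  show ?thesis
    unfolding bilinear_conv_bounded_bilinear[symmetric] bilinear_def jprod_def
    by (auto intro!: linearI simp: M.add_left M.add_right M.scaleR_left M.scaleR_right algebra_simps)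
qed

global_interpretation mat_mul: bounded_bilinear "(**) :: real^'m^'m \<Rightarrow> real^'m^'m \<Rightarrow> real^'m^'m"
  by (rule bounded_bilinear_matrix_mul)

global_interpretation jprod: bounded_bilinear "jprod :: real^'m^'m \<Rightarrow> real^'m^'m \<Rightarrow> real^'m^'m"
  by (rule bounded_bilinear_jprod)

lemma inner_matrix_mul_left:
  fixes A X Y :: "real^'m^'m"
  shows "(A ** X) \<bullet> Y = X \<bullet> (transpose A ** Y)"
proof -
  have "(A ** X) \<bullet> Y = (\<Sum>i\<in>UNIV. \<Sum>j\<in>UNIV. \<Sum>k\<in>UNIV. A$i$k * X$k$j * Y$i$j)"
    by (simp add: inner_vec_def matrix_matrix_mult_def sum_distrib_right)
  also have "\<dots> = (\<Sum>i\<in>UNIV. \<Sum>k\<in>UNIV. \<Sum>j\<in>UNIV. A$i$k * X$k$j * Y$i$j)"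
    by (rule sum.cong[OF refl], rule sum.swap)
  also have "\<dots> = (\<Sum>k\<in>UNIV. \<Sum>i\<in>UNIV. \<Sum>j\<in>UNIV. A$i$k * X$k$j * Y$i$j)"
    by (rule sum.swap)
  also have "\<dots> = (\<Sum>k\<in>UNIV. \<Sum>j\<in>UNIV. \<Sum>i\<in>UNIV. A$i$k * X$k$j * Y$i$j)"
    by (rule sum.cong[OF refl], rule sum.swap)
  also have "\<dots> = X \<bullet> (transpose A ** Y)"
    by (simp add: inner_vec_def matrix_matrix_mult_def transpose_def sum_distrib_left mult_ac)
  finally show ?thesis .
qed

lemma inner_transpose: "transpose X \<bullet> transpose Y = X \<bullet> (Y::real^'m^'m)"
  unfolding inner_vec_def transpose_def by simp (rule sum.swap)

lemma inner_matrix_mul_right: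
  fixes A X Y :: "real^'m^'m"
  shows "(X ** A) \<bullet> Y = X \<bullet> (Y ** transpose A)"
proof -
  have "(X ** A) \<bullet> Y = transpose (X ** A) \<bullet> transpose Y" by (simp add: inner_transpose)
  also have "\<dots> = transpose X \<bullet> (A ** transpose Y)"
    by (simp add: matrix_transpose_mul inner_matrix_mul_left)
  also have "\<dots> = X \<bullet> (Y ** transpose A)"
    by (subst inner_transpose[symmetric]) (simp add: matrix_transpose_mul)
  finally show ?thesis .
qed

lemma inner_mat_eq_sum_columns:
  "(X::real^'m^'m) \<bullet> Y = (\<Sum>j\<in>UNIV. column j X \<bullet> column j Y)"
  unfolding inner_vec_def column_def by simp (rule sum.swap)

lemma column_matrix_mul: "column j (A ** X) = A *v column j (X::real^'m^'m)"
  by (simp add: column_def matrix_matrix_mult_def matrix_vector_mult_def vec_eq_iff)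

lemma inner_jprod_lower_bound:
  fixes F Y :: "real^'m^'m"
  assumes "F \<in> sym_mat" "\<And>v. l * (v \<bullet> v) \<le> v \<bullet> (F *v v)"
  shows "l * (Y \<bullet> Y) \<le> Y \<bullet> jprod F Y"
proof -
  have *: "l * (Z \<bullet> Z) \<le> Z \<bullet> (F ** Z)" for Z :: "real^'m^'m"
    unfolding inner_mat_eq_sum_columns sum_distrib_left column_matrix_mul
    by (intro sum_mono assms(2))
  have "Y \<bullet> (Y ** F) = transpose Y \<bullet> (F ** transpose Y)"
    using assms(1) by (subst inner_transpose[symmetric]) (simp add: matrix_transpose_mul sym_mat_def)
  then show ?thesis
    using *[of Y] *[of "transpose Y"] by (simp add: jprod_def inner_add_right inner_transpose)
qed

lemma norm_le_l_inverse_jprod: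
  fixes F Y :: "real^'m^'m"
  assumes "F \<in> sym_mat" "\<And>v. l * (v \<bullet> v) \<le> v \<bullet> (F *v v)" "0 < l"
  shows "norm Y \<le> norm (jprod F Y) / l"
proof (cases "Y = 0")
  case False
  have "l * (norm Y * norm Y) \<le> norm Y * norm (jprod F Y)"
    using inner_jprod_lower_bound[OF assms(1,2), where Y=Y] norm_cauchy_schwarz[of Y "jprod F Y"]
    by (simp add: dot_square_norm power2_eq_square)
  then have "l * norm Y \<le> norm (jprod F Y)" using False
    by (simp add: mult.left_commute[of l])
  then show ?thesis using assms(3) by (simp add: pos_le_divide_eq mult.commute)
qed (use assms in simp)

lemma pd_lower_bound:
  assumes "F \<in> pd"
  obtains l where "0 < l" "\<And>v. l * (v \<bullet> v) \<le> v \<bullet> (F *v v)"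
proof -
  obtain l v where lv: "v \<noteq> 0" "F *v v = l *\<^sub>R v" "\<And>u. l * (u \<bullet> u) \<le> u \<bullet> (F *v u)"
    by (rule generalized_eigenpair[where A="\<lambda>x. x" and D="\<lambda>x. F *v x"])
      (auto simp: sym_inner[OF pd_sym[OF assms]] linear_iff matrix_vector_right_distrib
         matrix_vector_mult_scaleR)
  have "0 < l * (v \<bullet> v)" using pd_pos[OF assms lv(1)] lv(2) by simp
  then have "0 < l" by (meson inner_ge_zero linorder_not_le mult_nonpos_nonneg)
  then show ?thesis using that lv(3) by blast
qed

lemma pdI_lower_bound:
  assumes "X \<in> sym_mat" "0 < l" "\<And>v. l * (v \<bullet> v) \<le> v \<bullet> (X *v v)"
  shows "X \<in> pd"
proof -
  have "0 < v \<bullet> (X *v v)" if "v \<noteq> 0" for v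
  proof -
    have "0 < l * (v \<bullet> v)" using assms(2) that by simp
    then show ?thesis using assms(3)[of v] by linarith
  qed
  then show ?thesis using assms(1) by (simp add: pd_def)
qed

lemma quadratic_form_le_norm:
  fixes X :: "real^'m^'m"
  shows "\<bar>v \<bullet> (X *v v)\<bar> \<le> norm X * (v \<bullet> v)"
proof -
  have "(norm (X *v v))\<^sup>2 \<le> (norm X * norm v)\<^sup>2"
  proof -
    have "(norm (X *v v))\<^sup>2 = (\<Sum>i\<in>UNIV. (X$i \<bullet> v)\<^sup>2)"
      by (simp add: norm_vec_def L2_set_def sum_nonneg matrix_vector_mult_def inner_vec_def)
    also have "\<dots> \<le> (\<Sum>i\<in>UNIV. (norm (X$i))\<^sup>2 * (norm v)\<^sup>2)"
      by (intro sum_mono) (metis Cauchy_Schwarz_ineq2 abs_ge_zero power2_abs power_mono power_mult_distrib)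
    also have "\<dots> = (norm X * norm v)\<^sup>2"
      by (simp add: norm_vec_def[of X] L2_set_def sum_nonneg power_mult_distrib sum_distrib_right)
    finally show ?thesis .
  qed
  then have "norm (X *v v) \<le> norm X * norm v" by (rule power2_le_imp_le) simp
  then have "\<bar>v \<bullet> (X *v v)\<bar> \<le> norm v * (norm X * norm v)"
    using Cauchy_Schwarz_ineq2[of v "X *v v"] by (meson mult_left_mono norm_ge_zero order_trans)
  then show ?thesis by (simp add: dot_square_norm power2_eq_square mult_ac)
qed

lemma pd_perturbation:
  assumes "X \<in> pd"
  obtains e where "0 < e" "\<And>Y. Y \<in> sym_mat \<Longrightarrow> norm (Y - X) < e \<Longrightarrow> Y \<in> pd"
proof -
  obtain l where l: "0 < l" "\<And>v. l * (v \<bullet> v) \<le> v \<bullet> (X *v v)"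
    using pd_lower_bound[OF assms] by metis
  have "Y \<in> pd" if "Y \<in> sym_mat" "norm (Y - X) < l / 2" for Y
  proof (rule pdI_lower_bound[OF that(1), of "l / 2"])
    fix v
    have "v \<bullet> (Y *v v) = v \<bullet> (X *v v) + v \<bullet> ((Y - X) *v v)"
      by (simp add: matrix_vector_mult_diff_rdistrib inner_diff_right)
    moreover have "norm (Y - X) * (v \<bullet> v) \<le> l / 2 * (v \<bullet> v)"
      using that by (intro mult_right_mono) auto
    ultimately show "l / 2 * (v \<bullet> v) \<le> v \<bullet> (Y *v v)"
      using quadratic_form_le_norm[of v "Y - X"] l(2)[of v] by (simp add: abs_le_iff)
  qed (use l in simp)
  then show ?thesis using that[of "l / 2"] l by simp
qed

lemma jprod_quadratic_form:
  assumes "A \<in> sym_mat" "A *v v = l *\<^sub>R v"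
  shows "v \<bullet> (jprod A B *v v) = l * (v \<bullet> (B *v v))"
proof -
  have "v \<bullet> ((A ** B) *v v) = l * (v \<bullet> (B *v v))"
    using sym_inner[OF assms(1), of v "B *v v"] assms(2) by (simp add: matrix_vector_mul_assoc[symmetric])
  moreover have "v \<bullet> ((B ** A) *v v) = l * (v \<bullet> (B *v v))"
    using assms(2) by (simp add: matrix_vector_mul_assoc[symmetric] matrix_vector_mult_scaleR)
  ultimately show ?thesis
    by (simp add: jprod_def scaleR_matrix_vector_assoc[symmetric] matrix_vector_mult_add_rdistrib inner_add_right)
qed

text \<open>If \<open>v\<close> is a unit eigenvector of \<open>A\<close> for its least eigenvalue \<open>l\<close> and \<open>b = v \<bullet> (B *v v)\<close>, then
both \<open>l * b\<close> and \<open>l + b\<close> are positive, and therefore \<open>l\<close> is. This recovers the two positive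
definiteness conditions from information on the product and the sum alone.\<close>

lemma pd_if_jprod_and_sum_pd:
  assumes A: "A \<in> sym_mat" and AB: "jprod A B \<in> pd" "A + B \<in> pd"
  shows "A \<in> pd"
proof -
  obtain l v where lv: "v \<noteq> 0" "A *v v = l *\<^sub>R v" "\<And>u. l * (u \<bullet> u) \<le> u \<bullet> (A *v u)"
    by (rule generalized_eigenpair[where A="\<lambda>x. x" and D="\<lambda>x. A *v x"])
      (auto simp: sym_inner[OF A] linear_iff matrix_vector_right_distrib matrix_vector_mult_scaleR)
  have "0 < l * (v \<bullet> (B *v v))"
    using pd_pos[OF AB(1) lv(1)] jprod_quadratic_form[OF A lv(2)] by simp
  moreover have "0 < l * (v \<bullet> v) + v \<bullet> (B *v v)"
    using pd_pos[OF AB(2) lv(1)] lv(2) by (simp add: matrix_vector_mult_add_rdistrib inner_add_right)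
  ultimately have "0 < l"
    by (smt (verit) inner_ge_zero mult_nonneg_nonneg mult_nonpos_nonneg zero_less_mult_iff)
  then show ?thesis using pdI_lower_bound[OF A _ lv(3)] by blast
qed

lemma jprod_commute: "jprod A B = jprod B A"
  by (simp add: jprod_def add.commute)

section \<open>Eigenvalues of a matrix pencil and step sizes\<close>

lemma pd_invertible:
  fixes X :: "real^'m^'m"
  assumes "X \<in> pd"
  shows "X ** matrix_inv X = mat 1" "matrix_inv X ** X = mat 1"
proof -
  have "X *v v = 0 \<longrightarrow> v = 0" for v
    using pd_pos[OF assms, of v] by (metis inner_zero_right less_irrefl)
  then have "\<exists>B. B ** X = mat 1" by (simp add: matrix_left_invertible_ker)
  then have "invertible X" by (simp add: invertible_left_inverse)
  then show "X ** matrix_inv X = mat 1" "matrix_inv X ** X = mat 1"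
    unfolding invertible_def matrix_inv_def by (metis (mono_tags, lifting) someI_ex)+
qed

text \<open>Eigenvectors for different eigenvalues are orthogonal in the inner product of \<open>X\<close>, hence linearly
independent. Without finiteness the minimum in \<^const>\<open>lambda_min\<close> would carry no information.\<close>

lemma generalized_eigenvalues_finite:
  fixes X D :: "real^'m^'m"
  assumes X: "X \<in> pd" and D: "D \<in> sym_mat"
  shows "finite {l. \<exists>v. v \<noteq> 0 \<and> D *v v = l *\<^sub>R (X *v v)}" (is "finite ?L")
proof -
  define e where "e l = (SOME v. v \<noteq> 0 \<and> D *v v = l *\<^sub>R (X *v v))" for l
  have e: "e l \<noteq> 0" "D *v e l = l *\<^sub>R (X *v e l)" if "l \<in> ?L" for l
  proof -
    have "\<exists>v. v \<noteq> 0 \<and> D *v v = l *\<^sub>R (X *v v)" using that by blast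
    from someI_ex[OF this] show "e l \<noteq> 0" "D *v e l = l *\<^sub>R (X *v e l)" by (auto simp: e_def)
  qed
  have orth: "e k \<bullet> (X *v e l) = 0" if "k \<in> ?L" "l \<in> ?L" "k \<noteq> l" for k l
  proof -
    have "l * (e k \<bullet> (X *v e l)) = e k \<bullet> (D *v e l)" using e(2)[OF that(2)] by simp
    also have "\<dots> = (D *v e k) \<bullet> e l" by (simp add: sym_inner[OF D])
    also have "\<dots> = k * (e k \<bullet> (X *v e l))" using e(2)[OF that(1)] by (simp add: sym_inner[OF pd_sym[OF X]])
    finally show ?thesis using that(3) by simp
  qed
  have inj: "inj_on e ?L"
  proof (rule inj_onI, rule ccontr)
    fix k l assume kl: "k \<in> ?L" "l \<in> ?L" "e k = e l" "k \<noteq> l"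
    then show False using orth[OF kl(1,2,4)] pd_pos[OF X e(1)[OF kl(1)]] by simp
  qed
  have "independent (e ` ?L)"
    unfolding dependent_explicit
  proof (safe)
    fix T u v assume T: "finite T" "T \<subseteq> e ` ?L" "(\<Sum>a\<in>T. u a *\<^sub>R a) = 0" "v \<in> T" "u v \<noteq> 0"
    obtain l where l: "l \<in> ?L" "v = e l" using T by blast
    have "0 = (\<Sum>a\<in>T. u a *\<^sub>R a) \<bullet> (X *v v)" using T(3) by simp
    also have "\<dots> = (\<Sum>a\<in>T. u a * (a \<bullet> (X *v v)))" by (simp add: inner_sum_left)
    also have "\<dots> = u v * (v \<bullet> (X *v v)) + (\<Sum>a\<in>T - {v}. u a * (a \<bullet> (X *v v)))"
      using T by (simp add: sum.remove)
    also have "(\<Sum>a\<in>T - {v}. u a * (a \<bullet> (X *v v))) = 0"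
    proof (rule sum.neutral, rule ballI)
      fix a assume a: "a \<in> T - {v}"
      then obtain k where "k \<in> ?L" "a = e k" using T by blast
      then show "u a * (a \<bullet> (X *v v)) = 0" using orth[of k l] l a by auto
    qed
    finally show False using pd_pos[OF X e(1)[OF l(1)]] l T(5) by simp
  qed
  then have "finite (e ` ?L)" using independent_bound by blast
  then show ?thesis using inj finite_image_iff by blast
qed

text \<open>At an eigenvector \<open>u\<close> for the eigenvalue \<open>l\<close>, the form of \<open>X + D\<close> is \<open>1 + l\<close> times that of \<open>X\<close>,
so no eigenvalue is \<open>-1\<close> or less.\<close>

lemma max_step_eq_one:
  fixes X D :: "real^'m^'m"
  assumes X: "X \<in> pd" and D: "D \<in> sym_mat" and XD: "X + D \<in> pd"
  shows "max_step del X D = 1"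
proof -
  have eq: "(matrix_inv X ** D) *v v = l *\<^sub>R v \<longleftrightarrow> D *v v = l *\<^sub>R (X *v v)" for l v
  proof
    assume "(matrix_inv X ** D) *v v = l *\<^sub>R v"
    then have "X *v ((matrix_inv X ** D) *v v) = l *\<^sub>R (X *v v)" by (simp add: matrix_vector_mult_scaleR)
    then show "D *v v = l *\<^sub>R (X *v v)"
      by (simp add: matrix_vector_mul_assoc matrix_mul_assoc pd_invertible[OF X])
  next
    assume "D *v v = l *\<^sub>R (X *v v)"
    then have "matrix_inv X *v (D *v v) = l *\<^sub>R (matrix_inv X *v (X *v v))"
      by (simp add: matrix_vector_mult_scaleR)
    then show "(matrix_inv X ** D) *v v = l *\<^sub>R v"
      by (simp add: matrix_vector_mul_assoc pd_invertible[OF X])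
  qed
  let ?L = "{l. \<exists>v. v \<noteq> 0 \<and> D *v v = l *\<^sub>R (X *v v)}"
  have lm: "lambda_min (matrix_inv X ** D) = Min ?L" by (simp add: lambda_min_def eq)
  obtain l v where "v \<noteq> 0" "D *v v = l *\<^sub>R (X *v v)"
    by (rule generalized_eigenpair[where A="\<lambda>x. X *v x" and D="\<lambda>x. D *v x"])
      (auto simp: sym_inner[OF D] sym_inner[OF pd_sym[OF X]] pd_pos[OF X])
  then have "?L \<noteq> {}" by blast
  then have "Min ?L \<in> ?L" using generalized_eigenvalues_finite[OF X D] by (rule Min_in[rotated])
  then obtain u where u: "u \<noteq> 0" "D *v u = Min ?L *\<^sub>R (X *v u)" by blast
  have "0 < u \<bullet> ((X + D) *v u)" by (rule pd_pos[OF XD u(1)])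
  also have "\<dots> = (1 + Min ?L) * (u \<bullet> (X *v u))"
    unfolding matrix_vector_mult_add_rdistrib u(2) by (simp add: inner_add_right algebra_simps)
  finally have "0 < 1 + Min ?L"
    using pd_pos[OF X u(1)] by (simp add: zero_less_mult_iff)
  then show ?thesis unfolding max_step_def lm by (simp add: Let_def)
qed


section \<open>The scaled complementarity operator\<close>

lemma inner_left_mul_pos:
  fixes F Z :: "real^'m^'m"
  assumes "F \<in> pd" "Z \<noteq> 0"
  shows "0 < Z \<bullet> (F ** Z)"
proof -
  obtain l where l: "0 < l" "\<And>v. l * (v \<bullet> v) \<le> v \<bullet> (F *v v)"
    using pd_lower_bound[OF assms(1)] by metis
  have "l * (Z \<bullet> Z) \<le> Z \<bullet> (F ** Z)"
    unfolding inner_mat_eq_sum_columns sum_distrib_left column_matrix_mul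
    by (intro sum_mono l)
  moreover have "0 < l * (Z \<bullet> Z)" using l(1) assms(2) by simp
  ultimately show ?thesis by linarith
qed

lemma inner_right_mul_pos:
  fixes F Z :: "real^'m^'m"
  assumes "F \<in> pd" "Z \<noteq> 0"
  shows "0 < Z \<bullet> (Z ** F)"
proof -
  have "transpose Z \<noteq> 0" using assms(2) by (metis transpose_transpose transpose_iff transpose_mat mat_0)
  from inner_left_mul_pos[OF assms(1) this] show ?thesis
    using pd_sym[OF assms(1)]
    by (subst inner_transpose[symmetric]) (simp add: matrix_transpose_mul sym_mat_def)
qed

text \<open>The map \<open>W \<mapsto> F W F\<close> is a product of two commuting positive maps. To avoid square roots, take an
extremal eigenpair \<open>F X F = l X\<close>: its inner product with \<open>X F\<close> equates a positive number with \<open>l\<close>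
times a positive number.\<close>

lemma inner_congruence_nonneg:
  fixes F W :: "real^'m^'m"
  assumes F: "F \<in> pd"
  shows "0 \<le> W \<bullet> (F ** W ** F)"
proof -
  have tF: "transpose F = F" using pd_sym[OF F] by (simp add: sym_mat_def)
  have sa: "(F ** U ** F) \<bullet> Y = U \<bullet> (F ** Y ** F)" for U Y :: "real^'m^'m"
    using inner_matrix_mul_right[of "F ** U" F Y] inner_matrix_mul_left[of F U "Y ** F"]
    by (simp add: tF matrix_mul_assoc)
  obtain l X where lX: "X \<noteq> 0" "F ** X ** F = l *\<^sub>R X" "\<And>W. l * (W \<bullet> W) \<le> W \<bullet> (F ** W ** F)"
    by (rule generalized_eigenpair[where A="\<lambda>W::real^'m^'m. W" and D="\<lambda>W. F ** W ** F"])
      (auto simp: linear_iff sa mat_mul.add_left mat_mul.add_right mat_mul.scaleR_left mat_mul.scaleR_right)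
  have "X ** F \<noteq> 0"
    using inner_right_mul_pos[OF F lX(1)] by auto
  then have "0 < (X ** F) \<bullet> (F ** (X ** F))" by (rule inner_left_mul_pos[OF F])
  also have "\<dots> = l * (X \<bullet> (X ** F))"
    using lX(2) by (simp add: matrix_mul_assoc inner_commute)
  finally have "0 < l" using inner_right_mul_pos[OF F lX(1)] by (simp add: zero_less_mult_iff)
  then have "0 \<le> l * (W \<bullet> W)" by simp
  then show ?thesis using lX(3)[of W] by linarith
qed

text \<open>Passing from \<open>V\<close> to \<open>W = V - mu F\<^sup>-\<^sup>1\<close> changes \<open>F V\<close> and \<open>V F\<close> by the same matrix, so the
commutator stays the same while the anticommutator becomes twice the deviation of \<open>jprod F V\<close>
from \<open>mu\<close> times the identity. The squared norms of anticommutator and commutator differ by four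
times \<open>(F W) \<bullet> (W F) \<ge> 0\<close>. The point is that the bound does not deteriorate as \<open>F\<close> becomes singular.\<close>

lemma norm_commutator_le:
  fixes F V :: "real^'m^'m"
  assumes F: "F \<in> pd" and V: "V \<in> sym_mat"
  shows "norm (F ** V - V ** F) \<le> 2 * norm (jprod F V - mu *\<^sub>R mat 1)"
proof -
  have tF: "transpose F = F" using pd_sym[OF F] by (simp add: sym_mat_def)
  define G where "G = matrix_inv F"
  note inv = pd_invertible[OF F, folded G_def]
  define W where "W = V - mu *\<^sub>R G"
  have FW: "F ** W = F ** V - mu *\<^sub>R mat 1" "W ** F = V ** F - mu *\<^sub>R mat 1"
    by (simp_all add: W_def mat_mul.diff_left mat_mul.diff_right mat_mul.scaleR_left
        mat_mul.scaleR_right inv)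
  have "(F ** W) \<bullet> (W ** F) = W \<bullet> (F ** W ** F)"
    by (simp add: inner_matrix_mul_left tF matrix_mul_assoc)
  then have nn: "0 \<le> (F ** W) \<bullet> (W ** F)" using inner_congruence_nonneg[OF F] by simp
  have "(norm (F ** W - W ** F))\<^sup>2 \<le> (norm (F ** W + W ** F))\<^sup>2"
    using nn by (simp add: power2_norm_eq_inner inner_diff inner_add algebra_simps inner_commute)
  then have "norm (F ** W - W ** F) \<le> norm (F ** W + W ** F)" by (rule power2_le_imp_le) simp
  moreover have "F ** W - W ** F = F ** V - V ** F" by (simp add: FW)
  moreover have "F ** W + W ** F = 2 *\<^sub>R (jprod F V - mu *\<^sub>R mat 1)"
    by (simp add: FW jprod_def vec_eq_iff field_simps)
  ultimately show ?thesis by simp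
qed

lemma jprod_commutator:
  fixes F V X :: "real^'m^'m"
  shows "jprod F (jprod V X) - jprod V (jprod F X) =
    (1/4) *\<^sub>R ((F ** V - V ** F) ** X - X ** (F ** V - V ** F))"
  by (simp add: jprod_def mat_mul.diff_left mat_mul.diff_right mat_mul.scaleR_left
      mat_mul.scaleR_right mat_mul.add_left mat_mul.add_right matrix_mul_assoc algebra_simps)

lemma jprod_inv:
  fixes F Z :: "real^'m^'m"
  assumes F: "F \<in> pd" and Z: "Z \<in> sym_mat"
  shows "jprod F (jprod_inv F Z) = Z" "jprod_inv F Z \<in> sym_mat"
proof -
  obtain l where l: "0 < l" "\<And>v. l * (v \<bullet> v) \<le> v \<bullet> (F *v v)"
    using pd_lower_bound[OF F] by metis
  have "linear (jprod F)" by (simp add: linear_conv_bounded_linear jprod.bounded_linear_right)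
  moreover have inj: "inj (jprod F)"
  proof (rule injI)
    fix X Y assume "jprod F X = jprod F Y"
    then have "jprod F (X - Y) = 0" by (simp add: jprod.diff_right)
    then show "X = Y" using norm_le_l_inverse_jprod[OF pd_sym[OF F] l(2,1), of "X - Y"] by simp
  qed
  ultimately have "surj (jprod F)" by (rule linear_inj_imp_surj)
  then obtain Y where Y: "jprod F Y = Z" by (metis surjD)
  have "jprod F (transpose Y) = transpose (jprod F Y)"
    using pd_sym[OF F]
    by (simp add: jprod_def transpose_scalar transpose_add_real matrix_transpose_mul sym_mat_def add.commute)
  also have "\<dots> = jprod F Y" using Y Z by (simp add: sym_mat_def)
  finally have "transpose Y = Y" using inj by (simp add: inj_eq)
  then have "Z \<in> jprod F ` sym_mat" using Y by (auto simp: sym_mat_def)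
  then show "jprod F (jprod_inv F Z) = Z" "jprod_inv F Z \<in> sym_mat"
    unfolding jprod_inv_def by (auto intro: f_inv_into_f inv_into_into)
qed

text \<open>The operator \<open>(L\<^sub>V + L\<^sub>F L\<^sub>V L\<^sub>F\<^sup>-\<^sup>1) / 2\<close> that multiplies the change of \<open>F\<close> in the linearized
complementarity equation, where \<open>L\<^sub>X\<close> is \<open>jprod X\<close>.\<close>

definition scaled_op :: "real^'m^'m \<Rightarrow> real^'m^'m \<Rightarrow> real^'m^'m \<Rightarrow> real^'m^'m" where
  "scaled_op F V Z = (1/2) *\<^sub>R (jprod V Z + jprod F (jprod V (jprod_inv F Z)))"

text \<open>The deviation from \<open>L\<^sub>V\<close> is half of \<open>(L\<^sub>F L\<^sub>V - L\<^sub>V L\<^sub>F) L\<^sub>F\<^sup>-\<^sup>1\<close>. The first factor is a bracket with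
the commutator of \<open>F\<close> and \<open>V\<close>, which is as small as the centrality residual; only the second
factor costs the reciprocal of the least eigenvalue of \<open>F\<close>.\<close>

lemma scaled_op_error:
  obtains C where "0 < C"
   "\<And>F V Z l mu. F \<in> pd \<Longrightarrow> V \<in> sym_mat \<Longrightarrow> Z \<in> sym_mat \<Longrightarrow>
     0 < l \<Longrightarrow> (\<And>v. l * (v \<bullet> v) \<le> v \<bullet> (F *v v)) \<Longrightarrow>
     norm (scaled_op F V Z - jprod V (Z::real^'m^'m))
      \<le> C * norm (jprod F V - mu *\<^sub>R mat 1) * norm Z / l"
proof -
  obtain K where K: "0 < K" "\<And>X Y. norm ((X::real^'m^'m) ** (Y::real^'m^'m)) \<le> norm X * norm Y * K"
    using mat_mul.pos_bounded by metis
  show ?thesis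
  proof (rule that[of K])
    fix F V Z :: "real^'m^'m" and l mu
    assume F: "F \<in> pd" and V: "V \<in> sym_mat" and Z: "Z \<in> sym_mat" and l: "0 < l"
      "\<And>v. l * (v \<bullet> v) \<le> v \<bullet> (F *v v)"
    define Y where "Y = jprod_inv F Z"
    define B where "B = F ** V - V ** F"
    let ?e = "norm (jprod F V - mu *\<^sub>R mat 1)"
    have Y: "jprod F Y = Z" using jprod_inv[OF F Z] by (simp add: Y_def)
    have nY: "norm Y \<le> norm Z / l"
      using norm_le_l_inverse_jprod[OF pd_sym[OF F] l(2,1), of Y] Y by simp
    have nB: "norm B \<le> 2 * ?e" unfolding B_def by (rule norm_commutator_le[OF F V])
    have "scaled_op F V Z - jprod V Z
        = (1/2) *\<^sub>R (jprod F (jprod V Y) - jprod V (jprod F Y))"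
      unfolding scaled_op_def Y_def[symmetric] Y by (simp add: scaleR_add_right scaleR_diff_right)
    also have "\<dots> = (1/8) *\<^sub>R (B ** Y - Y ** B)"
      by (simp add: jprod_commutator B_def)
    also have "norm \<dots> = (1/8) * norm (B ** Y - Y ** B)" by simp
    also have "\<dots> \<le> (1/8) * (norm B * norm Y * K + norm Y * norm B * K)"
      using K(2)[of B Y] K(2)[of Y B] norm_triangle_ineq4[of "B ** Y" "Y ** B"]
      by (intro mult_left_mono) (linarith, simp)
    also have "\<dots> = (1/4) * K * (norm B * norm Y)" by (simp add: algebra_simps)
    also have "\<dots> \<le> (1/4) * K * ((2 * ?e) * (norm Z / l))"
      using nB nY K(1) by (intro mult_left_mono mult_mono) auto
    also have "\<dots> \<le> K * ?e * norm Z / l" using K(1) l(1) by (simp add: field_simps)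
    finally show "norm (scaled_op F V Z - jprod V Z) \<le> K * ?e * norm Z / l" .
  qed (use K in simp)
qed

text \<open>Near the central path \<open>F\<close> cannot be closer to singularity than a multiple of \<open>mu\<close>: at an
eigenvector \<open>u\<close> for the least eigenvalue \<open>l\<close>, the form of \<open>jprod F V\<close> is \<open>l * (u \<bullet> (V *v u))\<close>, and
it is at least \<open>mu / 2\<close> times the squared length of \<open>u\<close>.\<close>

lemma pd_lower_bound_from_jprod:
  fixes F V :: "real^'m^'m"
  assumes F: "F \<in> pd" and V: "V \<in> pd" "norm V \<le> K" "0 < K"
    and D: "norm (jprod F V - mu *\<^sub>R mat 1) \<le> mu / 2"
  shows "mu / (2 * K) * (v \<bullet> v) \<le> v \<bullet> (F *v v)"
proof -
  obtain l u where lu: "u \<noteq> 0" "F *v u = l *\<^sub>R u" "\<And>u. l * (u \<bullet> u) \<le> u \<bullet> (F *v u)"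
    by (rule generalized_eigenpair[where A="\<lambda>x. x" and D="\<lambda>x. F *v x"])
      (auto simp: sym_inner[OF pd_sym[OF F]] linear_iff matrix_vector_right_distrib
         matrix_vector_mult_scaleR)
  have uu: "0 < u \<bullet> u" using lu by simp
  have "0 < l * (u \<bullet> u)" using pd_pos[OF F lu(1)] lu(2) by simp
  then have l: "0 < l" by (meson inner_ge_zero linorder_not_le mult_nonpos_nonneg)
  have "u \<bullet> (jprod F V *v u) = mu * (u \<bullet> u) + u \<bullet> ((jprod F V - mu *\<^sub>R mat 1) *v u)"
    by (simp add: matrix_vector_mult_diff_rdistrib inner_diff_right scaleR_matrix_vector_assoc[symmetric])
  moreover have "\<bar>u \<bullet> ((jprod F V - mu *\<^sub>R mat 1) *v u)\<bar> \<le> mu / 2 * (u \<bullet> u)"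
    using D by (intro order_trans[OF quadratic_form_le_norm] mult_right_mono) auto
  ultimately have "mu / 2 * (u \<bullet> u) \<le> u \<bullet> (jprod F V *v u)" by (simp add: abs_le_iff)
  also have "\<dots> = l * (u \<bullet> (V *v u))" by (rule jprod_quadratic_form[OF pd_sym[OF F] lu(2)])
  also have "\<dots> \<le> l * (K * (u \<bullet> u))"
    using quadratic_form_le_norm[of u V] V(2) l uu
    by (intro mult_left_mono) (auto simp: abs_le_iff intro: order_trans mult_right_mono)
  finally have "mu / 2 \<le> l * K" using uu by (simp add: mult.assoc[symmetric])
  then have "mu / (2 * K) \<le> l" using V(3) by (simp add: field_simps)
  then have "mu / (2 * K) * (v \<bullet> v) \<le> l * (v \<bullet> v)" by (intro mult_right_mono) auto
  then show ?thesis using lu(3)[of v] by linarith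
qed

lemma pd_if_near_scaled_identity:
  fixes X :: "real^'m^'m"
  assumes "X \<in> sym_mat" "0 < mu" "norm (X - mu *\<^sub>R mat 1) \<le> mu / 2"
  shows "X \<in> pd"
proof (rule pdI_lower_bound[OF assms(1), of "mu / 2"])
  fix v :: "real^'m"
  have "v \<bullet> (X *v v) = mu * (v \<bullet> v) + v \<bullet> ((X - mu *\<^sub>R mat 1) *v v)"
    by (simp add: matrix_vector_mult_diff_rdistrib inner_diff_right scaleR_matrix_vector_assoc[symmetric])
  moreover have "\<bar>v \<bullet> ((X - mu *\<^sub>R mat 1) *v v)\<bar> \<le> mu / 2 * (v \<bullet> v)"
    using assms(3) by (intro order_trans[OF quadratic_form_le_norm] mult_right_mono) auto
  ultimately show "mu / 2 * (v \<bullet> v) \<le> v \<bullet> (X *v v)" by (simp add: abs_le_iff)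
qed (use assms in simp)

text \<open>The factor \<open>sqrt 2\<close> accounts for the mirror image of each off-diagonal entry.\<close>

lemma svec_norm_sym:
  fixes X :: "real^'m::{finite,linorder}^'m::{finite,linorder}"
  assumes "X \<in> sym_mat"
  shows "svec_norm X = norm X"
proof -
  have sym: "X $ a $ b = X $ b $ a" for a b
    using assms by (simp add: sym_mat_def) (metis transpose_def vec_lambda_beta)
  let ?g = "\<lambda>(a, b). (X $ a $ b)\<^sup>2"
  let ?U = "{(a::'m, b). b < a}" and ?D = "{(a::'m, b). a = b}" and ?L = "{(a::'m, b). a < b}"
  have "(svec_norm X)\<^sup>2 = (\<Sum>p\<in>?U \<union> ?D. (svec X p)\<^sup>2)"
    unfolding svec_norm_def L2_set_def svec_idx_def
    by (simp add: sum_nonneg) (rule sum.cong, auto)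
  also have "\<dots> = (\<Sum>p\<in>?U. (svec X p)\<^sup>2) + (\<Sum>p\<in>?D. (svec X p)\<^sup>2)"
    by (rule sum.union_disjoint) auto
  also have "(\<Sum>p\<in>?U. (svec X p)\<^sup>2) = (\<Sum>p\<in>?U. ?g p + ?g p)"
    by (rule sum.cong) (auto simp: svec_def power_mult_distrib)
  also have "\<dots> = sum ?g ?U + sum ?g ?L"
  proof -
    have "sum ?g ?U = sum ?g ?L"
      by (rule sum.reindex_bij_witness[of _ "\<lambda>(a, b). (b, a)" "\<lambda>(a, b). (b, a)"]) (auto simp: sym)
    then show ?thesis by (simp only: sum.distrib)
  qed
  also have "(\<Sum>p\<in>?D. (svec X p)\<^sup>2) = sum ?g ?D"
    by (rule sum.cong) (auto simp: svec_def)
  also have "sum ?g ?U + sum ?g ?L + sum ?g ?D = sum ?g UNIV"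
  proof -
    have "sum ?g (?U \<union> ?L \<union> ?D) = sum ?g (?U \<union> ?L) + sum ?g ?D" by (rule sum.union_disjoint) auto
    also have "sum ?g (?U \<union> ?L) = sum ?g ?U + sum ?g ?L" by (rule sum.union_disjoint) auto
    also have "?U \<union> ?L \<union> ?D = UNIV" by auto
    finally show ?thesis by simp
  qed
  also have "sum ?g UNIV = (norm X)\<^sup>2"
    by (simp add: norm_vec_def L2_set_def sum_nonneg sum.cartesian_product[symmetric] UNIV_Times_UNIV[symmetric]
        del: UNIV_Times_UNIV)
  finally show ?thesis
    by (simp add: svec_norm_def L2_set_nonneg)
qed

section \<open>Finitely supported measures\<close>

lemma restrict_borel_iff:
  "T \<in> sets borel \<Longrightarrow> A \<in> sets (restrict_space borel T) \<longleftrightarrow> A \<subseteq> T \<and> A \<in> sets borel"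
  by (simp add: sets_restrict_space_iff)

lemma finite_borel: "finite A \<Longrightarrow> (A :: 'a::t1_space set) \<in> sets borel"
  by (intro borel_closed finite_imp_closed)

text \<open>Up to a null set the integrand is a finite sum of indicator functions.\<close>

lemma integral_finite_support:
  fixes f :: "real^'q \<Rightarrow> 'b::{banach, second_countable_topology}"
  assumes y: "space y = T" "sets y = sets (restrict_space borel T)" "finite_measure y"
    and S: "finite S" "S \<subseteq> T" "emeasure y (T - S) = 0" and T: "T \<in> sets borel"
    and f: "continuous_on T f"
  shows "(\<integral>t. f t \<partial>y) = (\<Sum>t\<in>S. measure y {t} *\<^sub>R f t)"
proof -
  interpret finite_measure y by (rule y(3))
  have [measurable]: "f \<in> borel_measurable y"
    using borel_measurable_continuous_on_restrict[OF f] measurable_cong_sets[OF y(2) refl] by blast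
  have st: "A \<in> sets y" if "finite A" "A \<subseteq> T" for A
    unfolding y(2) restrict_borel_iff[OF T] using that finite_borel by blast
  have TS: "T - S \<in> sets y" using sets.compl_sets[OF st[OF S(1,2)]] y(1) by simp
  let ?g = "\<lambda>t. \<Sum>s\<in>S. indicator {s} t *\<^sub>R f s"
  have "(\<integral>t. f t \<partial>y) = (\<integral>t. ?g t \<partial>y)"
  proof (rule integral_cong_AE)
    have [measurable]: "{s} \<in> sets y" if "s \<in> S" for s using st[of "{s}"] that S by auto
    show "?g \<in> borel_measurable y" by measurable
    show "AE t in y. f t = ?g t"
    proof (rule AE_I[where N="T - S"])
      have "f t = ?g t" if "t \<in> S" for t
      proof -
        have "?g t = (\<Sum>s\<in>S. if s = t then f s else 0)"
          by (rule sum.cong) (auto simp: indicator_def)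
        then show ?thesis using that S(1) by simp
      qed
      then show "{t \<in> space y. f t \<noteq> ?g t} \<subseteq> T - S" using y(1) by auto
    qed (use TS S in auto)
  qed measurable
  also have "\<dots> = (\<Sum>s\<in>S. \<integral>t. indicator {s} t *\<^sub>R f s \<partial>y)"
  proof (rule Bochner_Integration.integral_sum)
    fix s assume "s \<in> S"
    then have "{s} \<in> sets y" using st[of "{s}"] S by auto
    then show "integrable y (\<lambda>t. indicator {s} t *\<^sub>R f s)"
      by (intro integrable_scaleR_left impI) (simp add: emeasure_eq_measure)
  qed
  also have "\<dots> = (\<Sum>s\<in>S. measure y {s} *\<^sub>R f s)"
  proof (rule sum.cong[OF refl])
    fix s assume s: "s \<in> S"
    then have "{s} \<in> sets y" using st[of "{s}"] S by auto
    moreover have "{s} \<inter> space y = {s}" using s S y by auto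
    ultimately show "(\<integral>t. indicator {s} t *\<^sub>R f s \<partial>y) = measure y {s} *\<^sub>R f s"
      by (simp add: emeasure_eq_measure)
  qed
  finally show ?thesis .
qed

text \<open>The measure component of \<^const>\<open>from_masses\<close>, for arbitrary points.\<close>

definition point_masses ::
  "(real^'q) set \<Rightarrow> nat \<Rightarrow> (nat \<Rightarrow> real) \<Rightarrow> (nat \<Rightarrow> real^'q) \<Rightarrow> (real^'q) measure" where
  "point_masses T n c p = measure_of T (sets (restrict_space borel T))
     (\<lambda>A. \<Sum>i<n. ennreal (c i) * indicator A (p i))"

lemma space_point_masses: "space (point_masses T n c p) = T"
  unfolding point_masses_def by (rule space_measure_of) (auto simp: sets_restrict_space)

lemma sets_point_masses: "sets (point_masses T n c p) = sets (restrict_space borel T)"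
proof -
  have "sets (point_masses T n c p) = sigma_sets T (sets (restrict_space borel T))"
    unfolding point_masses_def by (rule sets_measure_of) (auto simp: sets_restrict_space)
  also have "\<dots> = sets (restrict_space borel T)"
    using sets.sigma_sets_eq[of "restrict_space borel T"] by (simp add: space_restrict_space)
  finally show ?thesis .
qed

lemma emeasure_point_masses:
  assumes "A \<in> sets (restrict_space borel T)"
  shows "emeasure (point_masses T n c p) A = (\<Sum>i<n. ennreal (c i) * indicator A (p i))"
proof (rule emeasure_measure_of[OF point_masses_def])
  show "sets (restrict_space borel T) \<subseteq> Pow T"
    by (auto simp: sets_restrict_space)
  show "A \<in> sets (point_masses T n c p)" using assms by (simp add: sets_point_masses)
  show "positive (sets (point_masses T n c p)) (\<lambda>A. \<Sum>i<n. ennreal (c i) * indicator A (p i))"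
    by (simp add: positive_def)
  show "countably_additive (sets (point_masses T n c p)) (\<lambda>A. \<Sum>i<n. ennreal (c i) * indicator A (p i))"
  proof (rule countably_additiveI)
    fix B :: "nat \<Rightarrow> (real^'a) set" assume "disjoint_family B"
    then show "(\<Sum>k. \<Sum>i<n. ennreal (c i) * indicator (B k) (p i)) =
      (\<Sum>i<n. ennreal (c i) * indicator (\<Union> (range B)) (p i))"
      by (subst suminf_sum) (auto simp: suminf_indicator)
  qed
qed

text \<open>For regularity of a set \<open>A\<close>: the atoms in \<open>A\<close> form a compact set, and removing from \<open>T\<close> the atoms
outside \<open>A\<close> leaves a relatively open set; both have the mass of \<open>A\<close>.\<close>

lemma point_masses_Mplus:
  fixes T :: "(real^'q::finite) set"
  assumes T: "T \<in> sets borel" and p: "\<And>i. i < n \<Longrightarrow> p i \<in> T"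
  shows "point_masses T n c p \<in> Mplus T"
proof -
  let ?y = "point_masses T n c p"
  have mono: "emeasure ?y A \<le> emeasure ?y B" if "A \<subseteq> B" "B \<in> sets ?y" for A B
    using that by (rule emeasure_mono)
  note rs = restrict_borel_iff[OF T]
  have fm: "finite_measure ?y"
  proof (rule finite_measureI)
    have "emeasure ?y (space ?y) \<le> (\<Sum>i<n. ennreal (c i))"
      unfolding space_point_masses
      by (subst emeasure_point_masses) (auto simp: rs T p intro!: sum_mono)
    also have "\<dots> < \<infinity>" by simp
    finally show "emeasure ?y (space ?y) \<noteq> \<infinity>" by simp
  qed
  have inner: "emeasure ?y A = (SUP K\<in>{K. compact K \<and> K \<subseteq> A}. emeasure ?y K)"
    if A: "A \<in> sets ?y" for A
  proof (rule antisym)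
    let ?K = "A \<inter> p ` {..<n}"
    have A': "A \<subseteq> T" "A \<in> sets borel" using A unfolding sets_point_masses rs by auto
    have fin: "finite ?K" by simp
    have "?K \<in> sets (restrict_space borel T)" using finite_borel[OF fin] A' by (auto simp: rs)
    moreover have "A \<in> sets (restrict_space borel T)" using A' by (simp add: rs)
    moreover have "indicator ?K (p i) = (indicator A (p i) :: ennreal)" if "i < n" for i
      using that by (simp add: indicator_def)
    ultimately have "emeasure ?y A = emeasure ?y ?K" by (simp add: emeasure_point_masses)
    also have "\<dots> \<le> (SUP K\<in>{K. compact K \<and> K \<subseteq> A}. emeasure ?y K)"
      using finite_imp_compact[OF fin] by (intro SUP_upper) auto
    finally show "emeasure ?y A \<le> \<dots>" .
    show "(SUP K\<in>{K. compact K \<and> K \<subseteq> A}. emeasure ?y K) \<le> emeasure ?y A"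
      using A by (intro SUP_least mono) auto
  qed
  have outer: "emeasure ?y A = (INF G\<in>{G. openin (top_of_set T) G \<and> A \<subseteq> G}. emeasure ?y G)"
    if A: "A \<in> sets ?y" for A
  proof (rule antisym)
    have A': "A \<subseteq> T" "A \<in> sets borel" using A unfolding sets_point_masses rs by auto
    let ?N = "p ` {..<n} - A"
    let ?G = "T - ?N"
    have "open (- ?N)" by (intro open_Compl finite_imp_closed) simp
    then have G: "openin (top_of_set T) ?G" by (auto simp: openin_open Diff_eq)
    have "?G \<in> sets borel" by (intro sets.Diff T finite_borel) simp
    then have "?G \<in> sets (restrict_space borel T)" by (simp add: rs Diff_subset)
    moreover have "A \<in> sets (restrict_space borel T)" using A' by (simp add: rs)
    moreover have "indicator ?G (p i) = (indicator A (p i) :: ennreal)" if "i < n" for i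
      using that p[OF that] by (simp add: indicator_def)
    ultimately have "emeasure ?y ?G = emeasure ?y A" by (simp add: emeasure_point_masses)
    then show "(INF G\<in>{G. openin (top_of_set T) G \<and> A \<subseteq> G}. emeasure ?y G) \<le> emeasure ?y A"
      using G A'(1) by (intro INF_lower2[of ?G]) auto
    show "emeasure ?y A \<le> (INF G\<in>{G. openin (top_of_set T) G \<and> A \<subseteq> G}. emeasure ?y G)"
    proof (rule INF_greatest)
      fix G assume G: "G \<in> {G. openin (top_of_set T) G \<and> A \<subseteq> G}"
      then obtain U where "open U" "G = T \<inter> U" by (auto simp: openin_open)
      then have "G \<in> sets ?y" using T unfolding sets_point_masses rs by auto
      then show "emeasure ?y A \<le> emeasure ?y G" using G by (intro mono) auto
    qed
  qed
  show ?thesis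
    unfolding Mplus_def mem_Collect_eq
    by (intro conjI ballI space_point_masses sets_point_masses fm inner outer)
qed

lemma measure_point_masses:
  fixes T :: "(real^'q::finite) set"
  assumes T: "T \<in> sets borel" and p: "\<And>i. i < n \<Longrightarrow> p i \<in> T" and inj: "inj_on p {..<n}"
    and c: "\<And>i. i < n \<Longrightarrow> 0 \<le> c i" and i: "i < n"
  shows "measure (point_masses T n c p) {p i} = c i"
proof -
  have "{p i} \<in> sets (restrict_space borel T)"
    using p[OF i] by (simp add: restrict_borel_iff[OF T] finite_borel)
  then have "emeasure (point_masses T n c p) {p i} = (\<Sum>j<n. ennreal (c j) * indicator {p i} (p j))"
    by (rule emeasure_point_masses)
  also have "\<dots> = (\<Sum>j<n. if j = i then ennreal (c i) else 0)"
    using inj i by (intro sum.cong) (auto simp: indicator_def inj_on_def)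
  also have "\<dots> = ennreal (c i)" using i by simp
  finally show ?thesis using c[OF i] by (simp add: measure_def)
qed

lemma integral_point_masses:
  fixes T :: "(real^'q::finite) set" and f :: "real^'q \<Rightarrow> 'b::{banach, second_countable_topology}"
  assumes T: "T \<in> sets borel" and p: "\<And>i. i < n \<Longrightarrow> p i \<in> T" and inj: "inj_on p {..<n}"
    and c: "\<And>i. i < n \<Longrightarrow> 0 \<le> c i" and f: "continuous_on T f"
  shows "(\<integral>t. f t \<partial>point_masses T n c p) = (\<Sum>i<n. c i *\<^sub>R f (p i))"
proof -
  let ?y = "point_masses T n c p"
  have "?y \<in> Mplus T" by (rule point_masses_Mplus[OF T p])
  then have y: "space ?y = T" "sets ?y = sets (restrict_space borel T)" "finite_measure ?y"
    by (auto simp: Mplus_def)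
  have "T - p ` {..<n} \<in> sets (restrict_space borel T)"
    unfolding restrict_borel_iff[OF T] by (intro conjI Diff_subset sets.Diff T finite_borel) simp
  then have "emeasure ?y (T - p ` {..<n}) = 0"
    by (subst emeasure_point_masses) (auto simp: indicator_def)
  then have "(\<integral>t. f t \<partial>?y) = (\<Sum>t\<in>p ` {..<n}. measure ?y {t} *\<^sub>R f t)"
    using p by (intro integral_finite_support[OF y] f T) auto
  also have "\<dots> = (\<Sum>i<n. c i *\<^sub>R f (p i))"
    using measure_point_masses[where n=n and c=c and p=p, OF T p inj c]
    by (simp add: sum.reindex[OF inj])
  finally show ?thesis .
qed

lemma discrete_integral:
  fixes f :: "real^'q::finite \<Rightarrow> 'b::{banach, second_countable_topology}" and p :: "nat \<Rightarrow> real^'q"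
  assumes y: "y \<in> Mplus T" "discrete_measure y" "msupp y \<subseteq> p ` {..<n}"
    and T: "T \<in> sets borel" and p: "\<And>i. i < n \<Longrightarrow> p i \<in> T" and inj: "inj_on p {..<n}"
    and f: "continuous_on T f"
  shows "(\<integral>t. f t \<partial>y) = (\<Sum>i<n. measure y {p i} *\<^sub>R f (p i))"
proof -
  have y': "space y = T" "sets y = sets (restrict_space borel T)" "finite_measure y"
    using y(1) by (auto simp: Mplus_def)
  have fin: "finite (msupp y)" by (rule finite_subset[OF y(3)]) simp
  have sub: "msupp y \<subseteq> T" using y'(1) by (auto simp: msupp_def)
  have "T - msupp y \<in> sets y" unfolding y'(2)
    unfolding restrict_borel_iff[OF T] by (intro conjI Diff_subset sets.Diff T finite_borel fin)
  then have "emeasure y (T - p ` {..<n}) \<le> emeasure y (T - msupp y)"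
    using y(3) by (intro emeasure_mono) auto
  then have "emeasure y (T - p ` {..<n}) = 0"
    using y(2) y'(1) by (simp add: discrete_measure_def)
  then have "(\<integral>t. f t \<partial>y) = (\<Sum>t\<in>p ` {..<n}. measure y {t} *\<^sub>R f t)"
    using p by (intro integral_finite_support[OF y'] f T) auto
  then show ?thesis by (simp add: sum.reindex[OF inj])
qed

section \<open>The reduced constraint functions\<close>

lemma grad_inner:
  fixes f :: "real^'n \<Rightarrow> real"
  assumes "(f has_derivative f') (at x)"
  shows "grad f x \<bullet> h = f' h"
proof -
  have f': "frechet_derivative f (at x) = f'" using frechet_derivative_at[OF assms] by simp
  have l: "linear f'" using assms has_derivative_linear by blast
  have "f' h = (\<Sum>i\<in>UNIV. h $ i * f' (axis i 1))"
    by (subst basis_expansion[of h, symmetric])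
      (simp add: linear_sum[OF l] linear_scale[OF l] scalar_mult_eq_scaleR)
  then show ?thesis by (simp add: grad_def inner_vec_def f' mult.commute)
qed

lemma grad_eqI:
  fixes f :: "real^'n \<Rightarrow> real"
  assumes "(f has_derivative (\<lambda>h. g \<bullet> h)) (at x)"
  shows "grad f x = g"
  using grad_inner[OF assms] by (metis inner_commute vector_eq_rdot)

lemma hess_mul:
  assumes "(grad f has_derivative f') (at x)"
  shows "hess f x *v h = f' h"
proof -
  have "frechet_derivative (grad f) (at x) = f'" using frechet_derivative_at[OF assms] by simp
  moreover have "linear f'" using assms has_derivative_linear by blast
  ultimately show ?thesis by (simp add: hess_def jacobian_def matrix_works)
qed

lemma quad_rem_at_grad:
  fixes f :: "real^'n \<Rightarrow> real"
  assumes "quad_rem_at f F' a"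
  shows "quad_rem_at f (\<lambda>x h. grad f x \<bullet> h) a"
proof (rule quad_rem_at_cong[OF assms])
  show "\<forall>\<^sub>F x in nhds a. F' x = (\<lambda>h. grad f x \<bullet> h)"
    using quad_rem_at_has_derivative[OF assms] by eventually_elim (simp add: fun_eq_iff grad_inner)
qed simp

lemma quad_rem_at_hess:
  assumes "quad_rem_at (grad f) F' a"
  shows "quad_rem_at (grad f) (\<lambda>x h. hess f x *v h) a"
proof (rule quad_rem_at_cong[OF assms])
  show "\<forall>\<^sub>F x in nhds a. F' x = (\<lambda>h. hess f x *v h)"
    using quad_rem_at_has_derivative[OF assms] by eventually_elim (simp add: fun_eq_iff hess_mul)
qed simp

lemma has_derivative_eventually_iff:
  assumes "\<forall>\<^sub>F x' in nhds x. f x' = g x'"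
  shows "(f has_derivative D) (at x) \<longleftrightarrow> (g has_derivative D) (at x)"
proof -
  obtain S where "open S" "x \<in> S" "\<And>x'. x' \<in> S \<Longrightarrow> f x' = g x'"
    using assms unfolding eventually_nhds by blast
  then show ?thesis by (metis has_derivative_transform_within_open)
qed

lemma grad_cong:
  assumes "\<forall>\<^sub>F x' in nhds x. f x' = g x'"
  shows "grad f x = grad g x"
proof -
  show ?thesis
    by (simp add: grad_def frechet_derivative_def has_derivative_eventually_iff[OF assms])
qed

lemma hess_cong:
  assumes "\<forall>\<^sub>F x' in nhds x. f x' = g x'"
  shows "hess f x = hess g x"
proof -
  have "\<forall>\<^sub>F x' in nhds x. grad f x' = grad g x'"
    using eventually_eventually[THEN iffD2, OF assms] by eventually_elim (rule grad_cong)
  from has_derivative_eventually_iff[OF this] show ?thesis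
    by (simp add: hess_def jacobian_def frechet_derivative_def)
qed

lemma eventually_pos_on_compact:
  fixes \<phi> :: "'a::metric_space \<times> 'b::metric_space \<Rightarrow> real"
  assumes "compact K" "continuous_on (UNIV \<times> K) \<phi>" "\<And>t. t \<in> K \<Longrightarrow> 0 < \<phi> (x, t)"
  shows "\<forall>\<^sub>F x' in nhds x. \<forall>t\<in>K. 0 < \<phi> (x', t)"
proof -
  have "openin (top_of_set (UNIV \<times> K)) ((UNIV \<times> K) \<inter> \<phi> -` {0<..})"
    by (rule continuous_openin_preimage_gen[OF assms(2)]) simp
  then obtain W where W: "open W" "(UNIV \<times> K) \<inter> \<phi> -` {0<..} = (UNIV \<times> K) \<inter> W"
    by (auto simp: openin_open)
  have "{x} \<times> K \<subseteq> W" using W(2) assms(3) by auto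
  then obtain X0 where "x \<in> X0" "open X0" "X0 \<times> K \<subseteq> W"
    using Elementary_Topology.tube_lemma[OF assms(1) W(1)] by blast
  then show ?thesis using W(2) unfolding eventually_nhds by blast
qed

locale sisdp_setting =
  fixes P :: "('n::finite, 'm::finite, 'q::finite) sisdp"
  assumes problem: "sisdp_problem P"
begin

lemma T_compact: "compact (Tset P)" and T_borel: "Tset P \<in> sets borel" and T_nonempty: "Tset P \<noteq> {}"
  using problem by (auto simp: sisdp_problem_def compact_eq_bounded_closed)

lemma con_continuous: "continuous_on (UNIV \<times> Tset P) (\<lambda>(x, t). con P x t)"
  using problem by (auto simp: sisdp_problem_def)

lemma con_continuous_t: "continuous_on (Tset P) (con P x)"
proof -
  have "continuous_on (Tset P) ((\<lambda>(x, t). con P x t) \<circ> (\<lambda>t. (x, t)))"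
    by (intro continuous_on_compose continuous_intros continuous_on_subset[OF con_continuous]) auto
  then show ?thesis by (simp add: o_def)
qed

lemma con_SUP_attained:
  obtains t where "t \<in> Tset P" "\<And>t'. t' \<in> Tset P \<Longrightarrow> con P x t' \<le> con P x t"
    "(SUP t\<in>Tset P. con P x t) = con P x t"
proof -
  obtain t where t: "t \<in> Tset P" "\<And>t'. t' \<in> Tset P \<Longrightarrow> con P x t' \<le> con P x t"
    using continuous_attains_sup[OF T_compact T_nonempty con_continuous_t] by metis
  then have "(SUP t\<in>Tset P. con P x t) = con P x t"
    by (intro cSup_eq_maximum) auto
  then show ?thesis using that t by blast
qed

lemma global_max_in_Ssig:
  assumes "0 < s" "t \<in> Tset P" "\<And>t'. t' \<in> Tset P \<Longrightarrow> con P x t' \<le> con P x t"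
  shows "t \<in> Ssig P s x"
proof -
  have "(SUP t\<in>Tset P. con P x t) = con P x t"
    using assms by (intro cSup_eq_maximum) auto
  then show ?thesis using assms by (auto simp: Ssig_def local_max_def intro: exI[of _ 1])
qed

lemma con_le_theta: "t \<in> Tset P \<Longrightarrow> con P x t \<le> theta P x"
proof -
  assume t: "t \<in> Tset P"
  have "bdd_above ((\<lambda>t. max (con P x t) 0) ` Tset P)"
    using T_compact con_continuous_t
    by (intro bounded_imp_bdd_above compact_imp_bounded compact_continuous_image continuous_intros) auto
  then have "max (con P x t) 0 \<le> theta P x"
    unfolding theta_def using t by (intro cSUP_upper)
  then show ?thesis by simp
qed

lemma theta_nonneg: "0 \<le> theta P x"
proof -
  obtain t where t: "t \<in> Tset P" using T_nonempty by blast
  have "bdd_above ((\<lambda>t. max (con P x t) 0) ` Tset P)"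
    using T_compact con_continuous_t
    by (intro bounded_imp_bdd_above compact_imp_bounded compact_continuous_image continuous_intros) auto
  then have "max (con P x t) 0 \<le> theta P x"
    unfolding theta_def using t by (intro cSUP_upper)
  then show ?thesis by simp
qed

lemma theta_le:
  assumes R: "0 < s" "Ssig P s x = p ` {..<n}" and c: "0 \<le> c" "\<And>i. i < n \<Longrightarrow> con P x (p i) \<le> c"
  shows "theta P x \<le> c"
proof -
  obtain t where t: "t \<in> Tset P" "\<And>t'. t' \<in> Tset P \<Longrightarrow> con P x t' \<le> con P x t"
    using con_SUP_attained by metis
  then have "t \<in> p ` {..<n}" using global_max_in_Ssig[OF R(1)] R(2) by auto
  then have "con P x t \<le> c" using c by auto
  then show ?thesis unfolding theta_def using t(2) c(1) T_nonempty
    by (intro cSUP_least) (auto intro: order_trans)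
qed

text \<open>The gradient in the first argument, read off the joint derivative so that its smoothness in
both arguments is immediate.\<close>

definition con_x :: "(real^'n) \<times> (real^'q) \<Rightarrow> real^'n" where
  "con_x z = (\<chi> j. frechet_derivative (\<lambda>(x, t). con P x t) (at z) (axis j 1, 0))"

definition smooth_nbhd :: "(real^'q) set" where
  "smooth_nbhd = (SOME W. open W \<and> Tset P \<subseteq> W \<and> Ck_on 3 (\<lambda>(x, t). con P x t) (UNIV \<times> W))"

lemma smooth_nbhd: "open smooth_nbhd" "Tset P \<subseteq> smooth_nbhd"
  "Ck_on 3 (\<lambda>(x, t). con P x t) (UNIV \<times> smooth_nbhd)"
proof -
  have "\<exists>W. open W \<and> Tset P \<subseteq> W \<and> Ck_on 3 (\<lambda>(x, t). con P x t) (UNIV \<times> W)"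
    using problem by (simp add: sisdp_problem_def)
  from someI_ex[OF this] show "open smooth_nbhd" "Tset P \<subseteq> smooth_nbhd"
    "Ck_on 3 (\<lambda>(x, t). con P x t) (UNIV \<times> smooth_nbhd)"
    by (simp_all add: smooth_nbhd_def)
qed

lemma smooth_nbhd_Suc: "Ck_on (Suc 2) (\<lambda>(x, t). con P x t) (UNIV \<times> smooth_nbhd)"
proof -
  have "(3::nat) = Suc 2" by simp
  then show ?thesis using smooth_nbhd(3) by metis
qed

lemma con_joint_differentiable:
  assumes "t \<in> smooth_nbhd"
  shows "((\<lambda>(x, t). con P x t) has_derivative frechet_derivative (\<lambda>(x, t). con P x t) (at (x, t))) (at (x, t))"
  using smooth_nbhd(3) assms by (simp add: numeral_3_eq_3 frechet_derivative_works)

lemma con_x_has_derivative: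
  assumes "t \<in> smooth_nbhd"
  shows "((\<lambda>x. con P x t) has_derivative (\<lambda>h. con_x (x, t) \<bullet> h)) (at x)"
proof -
  let ?D = "frechet_derivative (\<lambda>(x, t). con P x t) (at (x, t))"
  have D: "((\<lambda>x. (\<lambda>(x, t). con P x t) (x, t)) has_derivative (\<lambda>h. ?D (h, 0))) (at x)"
    by (rule has_derivative_compose[where f="\<lambda>x. (x, t)" and f'="\<lambda>h. (h, 0)"])
      (auto intro!: derivative_eq_intros con_joint_differentiable[OF assms])
  then have d: "((\<lambda>x. con P x t) has_derivative (\<lambda>h. ?D (h, 0))) (at x)" by simp
  have "?D (h, 0) = con_x (x, t) \<bullet> h" for h
    using grad_inner[OF d, of h]
    by (simp add: con_x_def grad_def fun_cong[OF frechet_derivative_at[OF d]])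
  with d show ?thesis by simp
qed

lemma grad_con: "t \<in> smooth_nbhd \<Longrightarrow> grad (\<lambda>x. con P x t) x = con_x (x, t)"
  by (rule grad_eqI[OF con_x_has_derivative])

lemma con_x_component_Ck2:
  "Ck_on 2 (\<lambda>z. con_x z $ j) (UNIV \<times> smooth_nbhd)"
proof -
  have "\<forall>b\<in>Basis. Ck_on 2 (\<lambda>z. frechet_derivative (\<lambda>(x, t). con P x t) (at z) b) (UNIV \<times> smooth_nbhd)"
    by (rule conjunct2[OF smooth_nbhd_Suc[unfolded Ck_on.simps]])
  moreover have "(axis j (1::real), 0 :: real^'q) \<in> Basis"
    by (auto simp: Basis_prod_def Basis_vec_def)
  ultimately show ?thesis unfolding con_x_def vec_lambda_beta by (rule bspec)
qed

lemma grad_con_continuous_t: "continuous_on (Tset P) (\<lambda>t. grad (\<lambda>x. con P x t) x)"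
proof -
  have "continuous_on (Tset P) (\<lambda>t. con_x (x, t))"
  proof -
    have "continuous_on (UNIV \<times> smooth_nbhd) (\<lambda>z. \<chi> j. con_x z $ j)"
      by (intro continuous_on_vec_lambda Ck_on_continuous[OF con_x_component_Ck2])
    then have "continuous_on (UNIV \<times> smooth_nbhd) con_x" by simp
    then have "continuous_on (Tset P) (con_x \<circ> (\<lambda>t. (x, t)))"
      using smooth_nbhd(2)
      by (intro continuous_on_compose continuous_intros) (auto elim: continuous_on_subset)
    then show ?thesis by (simp add: o_def)
  qed
  then show ?thesis
    using smooth_nbhd(2) grad_con by (subst continuous_on_cong[OF refl]) auto
qed

end

locale reduced_setting = sisdp_setting P for P :: "('n::finite, 'm::finite, 'q::finite) sisdp" +
  fixes R :: "('n, 'q) reduction" and xs :: "real^'n"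
  assumes thresh: "0 < thresh R" and reduction: "local_reduction P R xs"
begin

abbreviation "p \<equiv> np P R xs"
abbreviation "\<tau> \<equiv> branch R xs"
abbreviation "gh \<equiv> ghat P R xs"
abbreviation "gg i \<equiv> grad (gh i)"
abbreviation "Hg i \<equiv> hess (gh i)"
abbreviation "gf \<equiv> grad (obj P)"
abbreviation "Hf \<equiv> hess (obj P)"

lemma rdom_open: "open (rdom R xs)" and xs_rdom: "xs \<in> rdom R xs"
  and tau_Ck: "\<And>i. i < p \<Longrightarrow> Ck_on 2 (\<tau> i) (rdom R xs)"
  and Ssig_eq: "\<And>x. x \<in> rdom R xs \<Longrightarrow> Ssig P (thresh R) x = (\<lambda>i. \<tau> i x) ` {..<p}"
  and tau_strict: "\<And>x i. x \<in> rdom R xs \<Longrightarrow> i < p \<Longrightarrow> \<tau> i x \<in> strict_local_max P x"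
  using reduction by (auto simp: local_reduction_def)

lemma tau_in_T: "x \<in> rdom R xs \<Longrightarrow> i < p \<Longrightarrow> \<tau> i x \<in> Tset P"
  using tau_strict by (auto simp: strict_local_max_def)

lemma tau_in_smooth: "x \<in> rdom R xs \<Longrightarrow> i < p \<Longrightarrow> \<tau> i x \<in> smooth_nbhd"
  using tau_in_T smooth_nbhd(2) by blast

lemma tau_isCont: "x \<in> rdom R xs \<Longrightarrow> i < p \<Longrightarrow> isCont (\<tau> i) x"
  using Ck_on_continuous[OF tau_Ck] rdom_open continuous_on_eq_continuous_at by blast

lemma eventually_rdom: "x \<in> rdom R xs \<Longrightarrow> \<forall>\<^sub>F x' in nhds x. x' \<in> rdom R xs"
  using rdom_open by (rule eventually_nhds_in_open)

lemma tau_tendsto: "x \<in> rdom R xs \<Longrightarrow> i < p \<Longrightarrow> ((\<tau> i) \<longlongrightarrow> \<tau> i x) (nhds x)"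
  using tau_isCont unfolding continuous_at tendsto_at_iff_tendsto_nhds by blast

lemma inj_tau_xs: "inj_on (\<lambda>i. \<tau> i xs) {..<p}"
proof -
  have "card ((\<lambda>i. \<tau> i xs) ` {..<p}) = card {..<p}"
    using Ssig_eq[OF xs_rdom] by (simp add: np_def)
  then show ?thesis by (intro eq_card_imp_inj_on) auto
qed

text \<open>Where the branch points are pairwise distinct, so that the measures supported on them correspond
to vectors of masses.\<close>

definition inj_dom :: "(real^'n) set" where
  "inj_dom = {x \<in> rdom R xs. inj_on (\<lambda>i. \<tau> i x) {..<p}}"

lemma eventually_inj_dom:
  "x \<in> inj_dom \<Longrightarrow> \<forall>\<^sub>F x' in nhds x. x' \<in> inj_dom"
proof -
  assume x: "x \<in> inj_dom"
  then have xr: "x \<in> rdom R xs" by (simp add: inj_dom_def)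
  have "\<forall>\<^sub>F x' in nhds x. \<tau> i x' \<noteq> \<tau> j x'" if "i < p" "j < p" "i \<noteq> j" for i j
  proof -
    have ne: "\<tau> i x \<noteq> \<tau> j x" using x that by (auto simp: inj_dom_def inj_on_def)
    have "((\<lambda>x'. \<tau> i x' - \<tau> j x') \<longlongrightarrow> \<tau> i x - \<tau> j x) (nhds x)"
      using that by (intro tendsto_intros tau_tendsto xr)
    then have "\<forall>\<^sub>F x' in nhds x. \<tau> i x' - \<tau> j x' \<noteq> 0"
      using ne by (intro tendsto_imp_eventually_ne) auto
    then show ?thesis by eventually_elim simp
  qed
  then have "\<forall>\<^sub>F x' in nhds x. \<forall>i\<in>{..<p}. \<forall>j\<in>{..<p}. i \<noteq> j \<longrightarrow> \<tau> i x' \<noteq> \<tau> j x'"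
    by (intro eventually_ball_finite ballI) (auto intro: eventually_mono)
  with eventually_rdom[OF xr] show ?thesis
    by eventually_elim (auto simp: inj_dom_def inj_on_def)
qed

lemma xs_inj_dom: "xs \<in> inj_dom"
  using xs_rdom inj_tau_xs by (simp add: inj_dom_def)

text \<open>A branch point beats the frozen point \<open>\<tau> i x\<close> at nearby parameters. Since \<open>\<tau> i x\<close> is a strict
local maximizer, the values on a small sphere around it stay below the value at the centre when
\<open>x\<close> is perturbed to \<open>x'\<close>. Hence the maximum over the ball is attained inside, at a local maximizer
whose value is within the threshold of the global maximum, that is, at a branch point; the other
branches stay outside the ball.\<close>

lemma eventually_tau_maximal:
  assumes x: "x \<in> inj_dom" and i: "i < p"
  shows "\<forall>\<^sub>F x' in nhds x. con P x' (\<tau> i x) \<le> con P x' (\<tau> i x')"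
proof -
  have xr: "x \<in> rdom R xs" and inj: "inj_on (\<lambda>i. \<tau> i x) {..<p}" using x by (auto simp: inj_dom_def)
  define t0 where "t0 = \<tau> i x"
  have t0T: "t0 \<in> Tset P" unfolding t0_def by (rule tau_in_T[OF xr i])
  obtain e0 where e0: "0 < e0" "\<And>t'. t' \<in> Tset P \<Longrightarrow> dist t' t0 < e0 \<Longrightarrow> t' \<noteq> t0 \<Longrightarrow> con P x t' < con P x t0"
    using tau_strict[OF xr i] by (auto simp: strict_local_max_def t0_def)
  \<comment> \<open>The ball stays inside the region of strict maximality and away from all other branch points.\<close>
  define e where "e = Min (insert (e0 / 2) ((\<lambda>j. dist (\<tau> j x) t0 / 2) ` ({..<p} - {i})))"
  have dpos: "0 < dist (\<tau> j x) t0" if "j < p" "j \<noteq> i" for j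
    using inj i that by (auto simp: t0_def inj_on_def)
  have e: "0 < e" "e < e0" "\<And>j. j < p \<Longrightarrow> j \<noteq> i \<Longrightarrow> e < dist (\<tau> j x) t0"
  proof -
    show "0 < e" unfolding e_def using e0(1) dpos by (subst Min_gr_iff) auto
    have "e \<le> e0 / 2" unfolding e_def by (rule Min_le) auto
    then show "e < e0" using e0(1) by simp
    fix j assume j: "j < p" "j \<noteq> i"
    then have "e \<le> dist (\<tau> j x) t0 / 2" unfolding e_def by (intro Min_le) auto
    then show "e < dist (\<tau> j x) t0" using dpos[OF j] by linarith
  qed
  let ?K = "Tset P \<inter> sphere t0 e"
  have cx: "continuous_on (UNIV \<times> Tset P) (\<lambda>z. con P (fst z) (snd z))"
    using con_continuous by (simp add: case_prod_unfold)
  have c0: "continuous_on (UNIV \<times> Tset P) (\<lambda>z. con P (fst z) t0)"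
  proof -
    have "continuous_on (UNIV \<times> Tset P) ((\<lambda>z. con P (fst z) (snd z)) \<circ> (\<lambda>z. (fst z, t0)))"
      using t0T by (intro continuous_on_compose continuous_intros continuous_on_subset[OF cx]) auto
    then show ?thesis by (simp add: o_def)
  qed
  have s1: "\<forall>\<^sub>F x' in nhds x. \<forall>t\<in>?K. 0 < con P (fst (x', t)) t0 - con P (fst (x', t)) (snd (x', t))"
  proof (rule eventually_pos_on_compact)
    show "compact ?K" by (intro compact_Int_closed T_compact) auto
    show "continuous_on (UNIV \<times> ?K) (\<lambda>z. con P (fst z) t0 - con P (fst z) (snd z))"
      by (intro continuous_intros continuous_on_subset[OF cx] continuous_on_subset[OF c0]) auto
    show "0 < con P (fst (x, t)) t0 - con P (fst (x, t)) (snd (x, t))" if "t \<in> ?K" for t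
      using e0(2)[of t] that e by (auto simp: dist_commute)
  qed
  have s2: "\<forall>\<^sub>F x' in nhds x. \<forall>t\<in>Tset P.
    0 < con P (fst (x', t)) t0 - con P (fst (x', t)) (snd (x', t)) + thresh R"
  proof (rule eventually_pos_on_compact)
    show "compact (Tset P)" by (rule T_compact)
    show "continuous_on (UNIV \<times> Tset P) (\<lambda>z. con P (fst z) t0 - con P (fst z) (snd z) + thresh R)"
      by (intro continuous_intros cx c0)
    fix t assume t: "t \<in> Tset P"
    have "t0 \<in> Ssig P (thresh R) x" using Ssig_eq[OF xr] i by (auto simp: t0_def)
    then have gt: "con P x t0 > (SUP t\<in>Tset P. con P x t) - thresh R" by (simp add: Ssig_def)
    obtain tm where "(SUP t\<in>Tset P. con P x t) = con P x tm" "con P x t \<le> con P x tm"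
      using con_SUP_attained t by metis
    then show "0 < con P (fst (x, t)) t0 - con P (fst (x, t)) (snd (x, t)) + thresh R"
      using gt by simp
  qed
  have s3: "\<forall>\<^sub>F x' in nhds x. \<forall>j\<in>{..<p} - {i}. e < dist (\<tau> j x') t0"
  proof (rule eventually_ball_finite)
    show "finite ({..<p} - {i})" by simp
    show "\<forall>j\<in>{..<p} - {i}. \<forall>\<^sub>F x' in nhds x. e < dist (\<tau> j x') t0"
    proof
      fix j assume j: "j \<in> {..<p} - {i}"
      have "((\<lambda>x'. dist (\<tau> j x') t0) \<longlongrightarrow> dist (\<tau> j x) t0) (nhds x)"
        using j by (intro tendsto_intros tau_tendsto xr) auto
      then show "\<forall>\<^sub>F x' in nhds x. e < dist (\<tau> j x') t0"
        using e(3)[of j] j by (intro order_tendstoD) auto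
    qed
  qed
  show ?thesis using s1 s2 s3 eventually_rdom[OF xr]
  proof eventually_elim
    case (elim x')
    let ?C = "Tset P \<inter> cball t0 e"
    have "compact ?C" by (intro compact_Int_closed T_compact) auto
    moreover have "t0 \<in> ?C" using t0T e(1) by simp
    ultimately obtain t where t: "t \<in> ?C" "\<And>t'. t' \<in> ?C \<Longrightarrow> con P x' t' \<le> con P x' t"
      using continuous_attains_sup[of ?C "con P x'"] continuous_on_subset[OF con_continuous_t]
      by (metis Int_lower1 empty_iff)
    have t0t: "con P x' t0 \<le> con P x' t" using t(2) \<open>t0 \<in> ?C\<close> by blast
    have "t \<notin> sphere t0 e"
    proof
      assume "t \<in> sphere t0 e"
      then have "con P x' t < con P x' t0" using elim(1) t(1) by auto
      then show False using t0t by simp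
    qed
    then have dt: "dist t t0 < e" using t(1) by (auto simp: dist_commute less_le)
    have "t \<in> local_max P x'"
      unfolding local_max_def
    proof (intro CollectI conjI exI[of _ "e - dist t t0"] ballI impI)
      fix t' assume "t' \<in> Tset P" "dist t' t < e - dist t t0"
      then have "t' \<in> ?C" using dist_triangle[of t' t0 t] by (simp add: dist_commute)
      then show "con P x' t' \<le> con P x' t" by (rule t(2))
    qed (use t dt in auto)
    moreover have "con P x' t > (SUP t\<in>Tset P. con P x' t) - thresh R"
    proof -
      obtain tm where "tm \<in> Tset P" "(SUP t\<in>Tset P. con P x' t) = con P x' tm"
        using con_SUP_attained by metis
      then show ?thesis using bspec[OF elim(2), of tm] t0t by simp
    qed
    ultimately have "t \<in> Ssig P (thresh R) x'" by (simp add: Ssig_def)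
    then obtain j where j: "j < p" "t = \<tau> j x'" using Ssig_eq[OF elim(4)] by auto
    have "j = i"
    proof (rule ccontr)
      assume "j \<noteq> i"
      then have "e < dist t t0" using elim(3) j by auto
      then show False using dt by simp
    qed
    then show ?case using t0t j by (simp add: t0_def)
  qed
qed

lemma ghat_quad_rem_raw:
  assumes "i < p" "x \<in> rdom R xs"
  shows "quad_rem_at (gh i) (\<lambda>x h. frechet_derivative (\<lambda>(x, t). con P x t) (at (x, \<tau> i x))
     (h, frechet_derivative (\<tau> i) (at x) h)) x"
proof -
  have q: "quad_rem_at (\<lambda>x. (x, \<tau> i x)) (\<lambda>x h. (h, frechet_derivative (\<tau> i) (at x) h)) x"
    by (intro quad_rem_at_graph quad_rem_at_Ck2[OF rdom_open] assms tau_Ck)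
  have "Ck_on 2 (\<lambda>(x, t). con P x t) (UNIV \<times> smooth_nbhd)"
    by (rule Ck_on_SucD[OF smooth_nbhd_Suc])
  then have "quad_rem_at (\<lambda>(x, t). con P x t) (\<lambda>z. frechet_derivative (\<lambda>(x, t). con P x t) (at z)) (x, \<tau> i x)"
    using assms tau_in_smooth smooth_nbhd(1)
    by (intro quad_rem_at_Ck2[where S="UNIV \<times> smooth_nbhd"] open_Times) auto
  from quad_rem_at_compose[OF q this] show ?thesis by (simp add: ghat_def[abs_def])
qed

text \<open>An envelope theorem: by the previous lemma, \<open>gh i\<close> minus the constraint with frozen index has a
local minimum at \<open>x\<close>. It identifies the gradients in the algorithm with those in the residual, and
shows that \<open>gh i\<close> is one order smoother than the branches.\<close>

lemma grad_ghat:
  assumes x: "x \<in> inj_dom" and i: "i < p"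
  shows "gg i x = con_x (x, \<tau> i x)"
proof -
  have xr: "x \<in> rdom R xs" using x by (simp add: inj_dom_def)
  let ?D = "\<lambda>h. gg i x \<bullet> h"
  have "(gh i has_derivative ?D) (at x)"
    using eventually_nhds_x_imp_x[OF quad_rem_at_has_derivative[OF quad_rem_at_grad[OF ghat_quad_rem_raw[OF i xr]]]] .
  then have "((\<lambda>x'. gh i x' - con P x' (\<tau> i x)) has_derivative (\<lambda>h. ?D h - con_x (x, \<tau> i x) \<bullet> h)) (at x)"
    by (intro has_derivative_diff con_x_has_derivative tau_in_smooth xr i)
  moreover have "\<forall>\<^sub>F x' in at x. gh i x - con P x (\<tau> i x) \<le> gh i x' - con P x' (\<tau> i x)"
    using eventually_at_filter[THEN iffD2, OF eventually_mono[OF eventually_tau_maximal[OF x i]]]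
    by (auto simp: ghat_def elim!: eventually_mono)
  ultimately have "(\<lambda>h. ?D h - con_x (x, \<tau> i x) \<bullet> h) = (\<lambda>h. 0)"
    by (rule has_derivative_local_min)
  then have "\<forall>h. gg i x \<bullet> h = con_x (x, \<tau> i x) \<bullet> h" by (simp add: fun_eq_iff)
  then show ?thesis by (metis inner_commute vector_eq_rdot)
qed

lemma ghat_quad_rem:
  assumes "i < p"
  shows "quad_rem_at (gh i) (\<lambda>x h. gg i x \<bullet> h) xs"
  by (rule quad_rem_at_grad[OF ghat_quad_rem_raw[OF assms xs_rdom]])

lemma grad_ghat_quad_rem:
  assumes i: "i < p"
  shows "quad_rem_at (gg i) (\<lambda>x h. Hg i x *v h) xs"
proof -
  have q: "quad_rem_at (\<lambda>x. (x, \<tau> i x)) (\<lambda>x h. (h, frechet_derivative (\<tau> i) (at x) h)) xs"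
    by (intro quad_rem_at_graph quad_rem_at_Ck2[OF rdom_open] xs_rdom i tau_Ck)
  have "quad_rem_at (\<lambda>x. con_x (x, \<tau> i x) $ j)
      (\<lambda>x h. frechet_derivative (\<lambda>z. con_x z $ j) (at (x, \<tau> i x)) (h, frechet_derivative (\<tau> i) (at x) h)) xs" for j
    by (rule quad_rem_at_compose[OF q quad_rem_at_Ck2[OF _ _ con_x_component_Ck2]])
      (use tau_in_smooth[OF xs_rdom i] smooth_nbhd(1) in \<open>auto intro: open_Times\<close>)
  then have "quad_rem_at (\<lambda>x. con_x (x, \<tau> i x))
      (\<lambda>x h. \<chi> j. frechet_derivative (\<lambda>z. con_x z $ j) (at (x, \<tau> i x)) (h, frechet_derivative (\<tau> i) (at x) h)) xs"
    by (intro quad_rem_at_vec) simp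
  then have "quad_rem_at (gg i)
      (\<lambda>x h. \<chi> j. frechet_derivative (\<lambda>z. con_x z $ j) (at (x, \<tau> i x)) (h, frechet_derivative (\<tau> i) (at x) h)) xs"
    by (rule quad_rem_at_cong)
      (use eventually_inj_dom[OF xs_inj_dom] in \<open>auto elim!: eventually_mono simp: grad_ghat[OF _ i]\<close>)
  then show ?thesis by (rule quad_rem_at_hess)
qed

end

lemma grad_obj_quad_rem:
  fixes f :: "real^'n \<Rightarrow> real"
  assumes "Ck_on 3 f UNIV"
  shows "quad_rem_at (grad f) (\<lambda>x h. hess f x *v h) a"
proof -
  have "(3::nat) = Suc 2" by simp
  then have C: "\<forall>b\<in>Basis. Ck_on 2 (\<lambda>x. frechet_derivative f (at x) b) UNIV"
    using assms by (metis Ck_on.simps(2))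
  have "Ck_on 2 (\<lambda>x. grad f x $ j) UNIV" for j
  proof -
    have "axis j (1::real) \<in> Basis" by (auto simp: Basis_vec_def)
    then show ?thesis using C unfolding grad_def vec_lambda_beta by blast
  qed
  then have "quad_rem_at (\<lambda>x. grad f x $ j) (\<lambda>x. frechet_derivative (\<lambda>x. grad f x $ j) (at x)) a" for j
    by (intro quad_rem_at_Ck2[where S=UNIV]) auto
  then have "quad_rem_at (grad f) (\<lambda>x h. \<chi> j. frechet_derivative (\<lambda>x. grad f x $ j) (at x) h) a"
    by (intro quad_rem_at_vec) simp
  then show ?thesis by (rule quad_rem_at_hess)
qed

section \<open>Nonsingularity of the Jacobian as an error bound\<close>

text \<open>The right-hand sum attains its minimum on the compact set of vectors supported on \<open>I\<close> with unit
sum norm, and nonsingularity makes this minimum positive.\<close>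

lemma nonsingular_on_bound:
  fixes M :: "'c \<Rightarrow> 'c \<Rightarrow> real"
  assumes fin: "finite I" and ns: "nonsingular_on I M"
  obtains C where "0 < C"
    "\<And>v. (\<Sum>s\<in>I. \<bar>v s\<bar>) \<le> C * (\<Sum>r\<in>I. \<bar>\<Sum>s\<in>I. M r s * v s\<bar>)"
proof (cases "I = {}")
  case True
  then show ?thesis using that[of 1] by simp
next
  case False
  define B where "B = (\<Pi>\<^sub>E s\<in>UNIV. if s \<in> I then {-1..1::real} else {0})"
  define N where "N v = (\<Sum>s\<in>I. \<bar>v s\<bar>)" for v :: "'c \<Rightarrow> real"
  define Q where "Q v = (\<Sum>r\<in>I. \<bar>\<Sum>s\<in>I. M r s * v s\<bar>)" for v
  have "compactin (product_topology (\<lambda>_. euclidean) UNIV) B"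
    unfolding B_def compactin_PiE by auto
  then have cB: "compact B"
    by (simp add: euclidean_product_topology)
  have coord: "continuous_on S (\<lambda>v::'c \<Rightarrow> real. v s)" for s and S :: "('c \<Rightarrow> real) set"
    by (rule continuous_on_subset[OF continuous_on_product_coordinates]) simp
  have cN: "continuous_on S N" for S unfolding N_def by (intro continuous_intros coord)
  have cQ: "continuous_on S Q" for S unfolding Q_def by (intro continuous_intros coord)
  have "closed (N -` {1})" by (rule closed_vimage[OF closed_singleton cN])
  then have cS: "compact (B \<inter> N -` {1})" by (rule compact_Int_closed[OF cB])
  obtain s0 where s0: "s0 \<in> I" using False by blast
  have "(\<lambda>s. if s = s0 then 1 else 0) \<in> B \<inter> N -` {1}"
    using s0 fin by (auto simp: B_def N_def if_distrib[of abs] cong: if_cong)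
  then have "B \<inter> N -` {1} \<noteq> {}" by blast
  then obtain u where u: "u \<in> B \<inter> N -` {1}" "\<And>v. v \<in> B \<inter> N -` {1} \<Longrightarrow> Q u \<le> Q v"
    using continuous_attains_inf[OF cS _ cQ] by metis
  have Qnn: "0 \<le> Q v" for v unfolding Q_def by (intro sum_nonneg) simp
  have "Q u \<noteq> 0"
  proof
    assume "Q u = 0"
    then have "\<forall>r\<in>I. (\<Sum>s\<in>I. M r s * u s) = 0"
      unfolding Q_def using fin by (simp add: sum_nonneg_eq_0_iff)
    then have "\<forall>s\<in>I. u s = 0" using ns unfolding nonsingular_on_def by blast
    then show False using u(1) by (simp add: N_def)
  qed
  then have Qpos: "0 < Q u" using Qnn[of u] by simp
  show ?thesis
  proof (rule that[of "1 / Q u"])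
    show "0 < 1 / Q u" using Qpos by simp
    fix v :: "'c \<Rightarrow> real"
    show "(\<Sum>s\<in>I. \<bar>v s\<bar>) \<le> 1 / Q u * (\<Sum>r\<in>I. \<bar>\<Sum>s\<in>I. M r s * v s\<bar>)"
    proof (cases "N v = 0")
      case True
      then show ?thesis using Qpos Qnn[of v] by (simp add: N_def Q_def)
    next
      case nz: False
      have Nnn: "0 \<le> N v" unfolding N_def by (intro sum_nonneg) simp
      with nz have Npos: "0 < N v" by simp
      define v' where "v' s = (if s \<in> I then v s / N v else 0)" for s
      have "\<bar>v s\<bar> \<le> N v" if "s \<in> I" for s
        unfolding N_def using fin that by (intro member_le_sum) auto
      then have "\<bar>v s / N v\<bar> \<le> 1" if "s \<in> I" for s using Npos that by (simp add: abs_divide)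
      then have "- 1 \<le> v s / N v \<and> v s / N v \<le> 1" if "s \<in> I" for s
        using that by (metis abs_le_iff minus_le_iff)
      then have "v' \<in> B" by (simp add: B_def v'_def PiE_iff)
      moreover have "N v' = 1"
      proof -
        have "N v' = (\<Sum>s\<in>I. \<bar>v s\<bar> / N v)"
          unfolding N_def[of v'] using Npos by (intro sum.cong) (auto simp: v'_def)
        also have "\<dots> = N v / N v" unfolding N_def by (rule sum_divide_distrib[symmetric])
        finally show ?thesis using Npos by simp
      qed
      ultimately have "Q u \<le> Q v'" using u(2) by simp
      also have "Q v' = Q v / N v"
      proof -
        have "(\<Sum>s\<in>I. M r s * v' s) = (\<Sum>s\<in>I. M r s * v s) / N v" for r
          unfolding sum_divide_distrib by (intro sum.cong) (auto simp: v'_def)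
        then show ?thesis using Npos
          by (simp only: Q_def abs_divide abs_of_pos sum_divide_distrib[of "\<lambda>r. \<bar>\<Sum>s\<in>I. M r s * v s\<bar>"])
      qed
      finally have "Q u * N v \<le> Q v" using Npos by (simp add: pos_le_divide_eq)
      then show ?thesis using Qpos by (simp add: N_def Q_def field_simps)
    qed
  qed
qed

text \<open>Unlike the power notation for matrices, this form does not constrain the sort of the index type, so
it can be used where that type is also linearly ordered.\<close>

type_synonym 'm sqmat = "((real, 'm) vec, 'm) vec"

lemma smat_svec: "X \<in> sym_mat \<Longrightarrow> smat (svec X) = X"
proof -
  assume "X \<in> sym_mat"
  then have sym: "X $ a $ b = X $ b $ a" for a b
    by (simp add: sym_mat_def) (metis transpose_def vec_lambda_beta)
  have "X $ max a b $ min a b = X $ a $ b" for a b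
    using sym[of a b] by (cases "a \<le> b") (auto simp: max_def min_def)
  moreover have "max a b \<noteq> min a b" if "a \<noteq> b" for a b :: 'a
    using that by (simp add: max_def min_def)
  ultimately show ?thesis by (simp add: smat_def svec_def vec_eq_iff)
qed

lemma smat_cong: "(\<And>ab. ab \<in> svec_idx \<Longrightarrow> f ab = g ab) \<Longrightarrow> smat f = smat g"
  by (auto simp: smat_def vec_eq_iff svec_idx_def max_def min_def)

lemma smat_linear: "smat (\<lambda>ab. f ab + c * g ab) = smat f + c *\<^sub>R smat g"
  by (auto simp: smat_def vec_eq_iff add_divide_distrib)

lemma svec_linear: "svec (X + c *\<^sub>R Y) ab = svec X ab + c * svec Y ab"
  by (auto simp: svec_def algebra_simps split: prod.splits)

lemma Flin_linear: "linear (Flin P)"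
  unfolding Flin_def
  by (rule linearI) (auto simp: algebra_simps sum.distrib scaleR_sum_right)

lemma bounded_linear_Flin: "bounded_linear (Flin P)"
  using Flin_linear linear_conv_bounded_linear by blast

lemma trace_scaleR: "trace (c *\<^sub>R (X :: real^'m^'m)) = c * trace X"
  by (simp add: trace_def sum_distrib_left)

lemma Fadj_linear: "linear (Fadj P)"
  unfolding Fadj_def tr_prod_def
  by (rule linearI) (auto simp: vec_eq_iff mat_mul.add_right mat_mul.scaleR_right trace_add trace_scaleR)

lemma bounded_linear_Fadj: "bounded_linear (Fadj P)"
  using Fadj_linear linear_conv_bounded_linear by blast

lemma Fmat_add: "Fmat P (x + h) = Fmat P x + Flin P h"
  by (simp add: Fmat_def linear_add[OF Flin_linear])

context sisdp_setting
begin

lemma Flin_sym: "Flin P h \<in> sym_mat"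
  unfolding Flin_def using problem
  by (intro sym_mat_sum sym_mat_scaleR) (auto simp: sisdp_problem_def)

lemma Fmat_sym: "Fmat P x \<in> sym_mat"
  unfolding Fmat_def using problem Flin_sym
  by (intro sym_mat_add) (auto simp: sisdp_problem_def)

end

lemma finite_svec_idx: "finite svec_idx"
  by (rule finite_subset[of _ UNIV]) auto

lemma sum_coords:
  fixes f :: "('n::finite, 'm::{finite,linorder}) coord \<Rightarrow> real"
  assumes "finite I"
  shows "(\<Sum>s\<in>coords I. f s) = (\<Sum>j\<in>UNIV. f (CX j)) + (\<Sum>i\<in>I. f (CY i)) + (\<Sum>ab\<in>svec_idx. f (CV ab))"
proof -
  have "(\<Sum>s\<in>coords I. f s) = sum f (range CX \<union> CY ` I) + sum f (CV ` svec_idx)"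
    unfolding coords_def using assms finite_svec_idx by (intro sum.union_disjoint) auto
  also have "sum f (range CX \<union> CY ` I) = sum f (range CX) + sum f (CY ` I)"
    using assms by (intro sum.union_disjoint) auto
  finally show ?thesis by (simp add: sum.reindex inj_on_def)
qed

lemma finite_coords: "finite I \<Longrightarrow> finite (coords I :: ('n::finite, 'm::{finite,linorder}) coord set)"
  unfolding coords_def using finite_svec_idx by auto

locale kkt_jacobian = reduced_setting P R xs
  for P :: "('n::finite, 'm::{finite,linorder}, 'q::finite) sisdp" and R :: "('n, 'q) reduction" and xs +
  fixes ys :: "nat \<Rightarrow> real" and Vs :: "'m sqmat"
  assumes obj_C3: "Ck_on 3 (obj P) UNIV" and Vs_sym: "Vs \<in> sym_mat"
begin

abbreviation "I \<equiv> Iact P R xs"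

lemma finite_I: "finite I" and I_lt: "i \<in> I \<Longrightarrow> i < p"
  by (auto simp: Iact_def)

text \<open>The three blocks of the derivative of the KKT map at the limit, in the direction \<open>(dx, dy, dV)\<close>:
stationarity and complementarity here, the active constraints as \<open>gg i xs \<bullet> dx\<close>.\<close>

definition lin_stat :: "real^'n \<Rightarrow> (nat \<Rightarrow> real) \<Rightarrow> 'm sqmat \<Rightarrow> real^'n" where
  "lin_stat dx dy dV = Hf xs *v dx + (\<Sum>i\<in>I. ys i *\<^sub>R (Hg i xs *v dx))
     + (\<Sum>i\<in>I. dy i *\<^sub>R gg i xs) - Fadj P dV"

definition lin_compl :: "real^'n \<Rightarrow> 'm sqmat \<Rightarrow> 'm sqmat" where
  "lin_compl dx dV = jprod (Fmat P xs) dV + jprod (Flin P dx) Vs"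

definition lin_Phi :: "('n, 'm) vpoint \<Rightarrow> ('n, 'm) coord \<Rightarrow> real" where
  "lin_Phi = (\<lambda>(dx, dy, dV) r. case r of CX j \<Rightarrow> lin_stat dx dy dV $ j
     | CY i \<Rightarrow> gg i xs \<bullet> dx | CV ab \<Rightarrow> svec (lin_compl dx dV) ab)"

lemma lin_stat_linear:
  "lin_stat (x + c *\<^sub>R x') (\<lambda>i. y i + c * y' i) (V + c *\<^sub>R V')
    = lin_stat x y V + c *\<^sub>R lin_stat x' y' V'"
  unfolding lin_stat_def
  by (simp add: matrix_vector_right_distrib matrix_vector_mult_scaleR sum.distrib scaleR_sum_right
      scaleR_add_right scaleR_add_left scaleR_diff_right linear_add[OF Fadj_linear]
      linear_scale[OF Fadj_linear] mult.commute[of _ c])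

lemma lin_compl_linear:
  "lin_compl (x + c *\<^sub>R x') (V + c *\<^sub>R V') = lin_compl x V + c *\<^sub>R lin_compl x' V'"
  unfolding lin_compl_def
  by (simp add: linear_add[OF Flin_linear] linear_scale[OF Flin_linear] jprod.add_left jprod.add_right
      jprod.scaleR_left jprod.scaleR_right scaleR_add_right)

lemma lin_Phi_decode_linear:
  "lin_Phi (decode (\<lambda>q. u q + c * v q)) r = lin_Phi (decode u) r + c * lin_Phi (decode v) r"
proof -
  have vec: "(\<chi> j. u (CX j) + c * v (CX j)) = (\<chi> j. u (CX j)) + c *\<^sub>R (\<chi> j. v (CX j))"
    by (simp add: vec_eq_iff)
  show ?thesis
    unfolding lin_Phi_def decode_def prod.case smat_linear vec
    by (cases r) (simp_all add: lin_stat_linear lin_compl_linear svec_linear inner_add_right)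
qed

lemma lin_Phi_decode_sum:
  assumes "finite S"
  shows "lin_Phi (decode (\<lambda>q. \<Sum>s\<in>S. v s * u s q)) r = (\<Sum>s\<in>S. v s * lin_Phi (decode (u s)) r)"
  using assms
proof (induction S rule: finite_induct)
  case empty
  show ?case using lin_Phi_decode_linear[of "\<lambda>_. 0" "-1" "\<lambda>_. 0" r] by simp
next
  case (insert s S)
  then show ?case
    using lin_Phi_decode_linear[of "\<lambda>q. \<Sum>s\<in>S. v s * u s q" "v s" "u s" r]
    by (simp add: add.commute)
qed

lemma Phi0_line_derivative:
  assumes r: "r \<in> coords I" and dec: "decode u = (ux, uy, uV)" "decode z = (xs, ys, Vs)"
  shows "((\<lambda>c. Phi0 P R xs (\<lambda>q. z q + c * u q) r) has_real_derivative lin_Phi (ux, uy, uV) r) (at 0)"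
proof -
  have vec: "(\<chi> j. z (CX j) + c * u (CX j)) = (\<chi> j. z (CX j)) + c *\<^sub>R (\<chi> j. u (CX j))" for c
    by (simp add: vec_eq_iff)
  have d: "decode (\<lambda>q. z q + c * u q) = (xs + c *\<^sub>R ux, \<lambda>i. ys i + c * uy i, Vs + c *\<^sub>R uV)" for c
    using dec unfolding decode_def smat_linear vec by auto
  have line: "((\<lambda>c. xs + c *\<^sub>R ux) has_derivative (\<lambda>c. c *\<^sub>R ux)) (at 0)"
    by (auto intro!: derivative_eq_intros)
  have comp: "((\<lambda>c. f (xs + c *\<^sub>R ux)) has_derivative (\<lambda>c. c *\<^sub>R f' xs ux)) (at 0)"
    if q: "quad_rem_at f f' xs" for f :: "real^'n \<Rightarrow> 'b::real_normed_vector" and f'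
  proof -
    have fd: "(f has_derivative f' xs) (at (xs + 0 *\<^sub>R ux))"
      using eventually_nhds_x_imp_x[OF quad_rem_at_has_derivative[OF q]] by simp
    then have "linear (f' xs)" using has_derivative_linear by blast
    with has_derivative_compose[OF line fd] show ?thesis by (simp add: linear_scale)
  qed
  have gradobj: "((\<lambda>c. gf (xs + c *\<^sub>R ux)) has_derivative (\<lambda>c. c *\<^sub>R (Hf xs *v ux))) (at 0)"
    by (rule comp[OF grad_obj_quad_rem[OF obj_C3]])
  have gg: "((\<lambda>c. gg i (xs + c *\<^sub>R ux)) has_derivative (\<lambda>c. c *\<^sub>R (Hg i xs *v ux))) (at 0)"
    if "i \<in> I" for i by (rule comp[OF grad_ghat_quad_rem[OF I_lt[OF that]]])
  have g: "((\<lambda>c. gh i (xs + c *\<^sub>R ux)) has_derivative (\<lambda>c. c *\<^sub>R (gg i xs \<bullet> ux))) (at 0)"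
    if "i \<in> I" for i by (rule comp[OF ghat_quad_rem[OF I_lt[OF that]]])
  have prodd: "((\<lambda>c. (ys i + c * uy i) *\<^sub>R gg i (xs + c *\<^sub>R ux)) has_derivative
     (\<lambda>c. c *\<^sub>R (ys i *\<^sub>R (Hg i xs *v ux) + uy i *\<^sub>R gg i xs))) (at 0)" if "i \<in> I" for i
  proof -
    have "((\<lambda>c. ys i + c * uy i) has_derivative (\<lambda>c. c * uy i)) (at 0)"
      by (auto intro!: derivative_eq_intros)
    from has_derivative_scaleR[OF this gg[OF that]] show ?thesis
      by (rule has_derivative_eq_rhs) (simp add: fun_eq_iff scaleR_add_right mult.commute)
  qed
  have stat: "((\<lambda>c. gf (xs + c *\<^sub>R ux) + (\<Sum>i\<in>I. (ys i + c * uy i) *\<^sub>R gg i (xs + c *\<^sub>R ux))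
      - Fadj P (Vs + c *\<^sub>R uV)) has_derivative (\<lambda>c. c *\<^sub>R lin_stat ux uy uV)) (at 0)"
    by (rule has_derivative_eq_rhs, rule has_derivative_diff[OF has_derivative_add[OF gradobj has_derivative_sum[OF prodd]]],
          assumption, rule bounded_linear.has_derivative[OF bounded_linear_Fadj])
      (auto intro!: derivative_eq_intros simp: lin_stat_def fun_eq_iff algebra_simps sum.distrib
         scaleR_sum_right linear_scale[OF Fadj_linear])
  have compl: "((\<lambda>c. jprod (Fmat P (xs + c *\<^sub>R ux)) (Vs + c *\<^sub>R uV)) has_derivative
      (\<lambda>c. c *\<^sub>R lin_compl ux uV)) (at 0)"
    unfolding Fmat_add linear_scale[OF Flin_linear]
    by (rule has_derivative_eq_rhs[OF jprod.FDERIV[where f'="\<lambda>c. c *\<^sub>R Flin P ux" and g'="\<lambda>c. c *\<^sub>R uV"]])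
      (auto intro!: derivative_eq_intros simp: lin_compl_def fun_eq_iff algebra_simps
         jprod.scaleR_left jprod.scaleR_right)
  have svec_bl: "bounded_linear (\<lambda>X::'m sqmat. svec X ab)" for ab
    unfolding linear_conv_bounded_linear[symmetric]
    by (rule linearI) (auto simp: svec_def algebra_simps split: prod.splits)
  show ?thesis
  proof (cases r)
    case (CX j)
    have "((\<lambda>c. (gf (xs + c *\<^sub>R ux) + (\<Sum>i\<in>I. (ys i + c * uy i) *\<^sub>R gg i (xs + c *\<^sub>R ux))
      - Fadj P (Vs + c *\<^sub>R uV)) $ j) has_derivative (\<lambda>c. (c *\<^sub>R lin_stat ux uy uV) $ j)) (at 0)"
      by (rule bounded_linear.has_derivative[OF bounded_linear_vec_nth stat])
    then show ?thesis unfolding CX Phi0_def d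
      by (simp add: lin_Phi_def has_field_derivative_def mult.commute[of _ "lin_stat ux uy uV $ j"])
  next
    case (CY i)
    then have "i \<in> I" using r by (auto simp: coords_def)
    from g[OF this] show ?thesis unfolding CY Phi0_def d
      by (simp add: lin_Phi_def has_field_derivative_def mult.commute[of _ "gg i xs \<bullet> ux"])
  next
    case (CV ab)
    have "((\<lambda>c. svec (jprod (Fmat P (xs + c *\<^sub>R ux)) (Vs + c *\<^sub>R uV)) ab) has_derivative
      (\<lambda>c. svec (c *\<^sub>R lin_compl ux uV) ab)) (at 0)"
      by (rule bounded_linear.has_derivative[OF svec_bl compl])
    moreover have "svec (c *\<^sub>R lin_compl ux uV) ab = svec (lin_compl ux uV) ab * c" for c
      by (auto simp: svec_def split: prod.splits)
    ultimately show ?thesis unfolding CV Phi0_def d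
      by (simp add: lin_Phi_def has_field_derivative_def)
  qed
qed

lemma decode_encode: "decode (encode (xs, ys, Vs)) = (xs, ys, Vs)"
  using smat_svec[OF Vs_sym] by (simp add: decode_def encode_def vec_eq_iff)

text \<open>Varying one coordinate moves the argument along a line, so a partial derivative is \<^term>\<open>lin_Phi\<close>
in a coordinate direction.\<close>

lemma jacobian_entry_Phi0:
  assumes r: "r \<in> coords I"
  shows "jacobian_entry (Phi0 P R xs) (encode (xs, ys, Vs)) r s
    = lin_Phi (decode (\<lambda>q. if q = s then 1 else 0)) r"
proof -
  let ?z = "encode (xs, ys, Vs)" and ?u = "\<lambda>q. if q = s then 1 else (0::real)"
  obtain ux uy uV where u: "decode ?u = (ux, uy, uV)" by (metis prod_cases3)
  have eq: "?z(s := t) = (\<lambda>q. ?z q + (t - ?z s) * ?u q)" for t by (auto simp: fun_eq_iff)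
  have "((\<lambda>t. t - ?z s) has_real_derivative 1) (at (?z s))" by (auto intro!: derivative_eq_intros)
  from DERIV_chain2[OF _ this, of "\<lambda>c. Phi0 P R xs (\<lambda>q. ?z q + c * ?u q) r"]
    Phi0_line_derivative[OF r u decode_encode]
  have "((\<lambda>t. Phi0 P R xs (?z(s := t)) r) has_real_derivative lin_Phi (ux, uy, uV) r) (at (?z s))"
    unfolding eq by simp
  then show ?thesis unfolding jacobian_entry_def u by (rule DERIV_imp_deriv)
qed

text \<open>By linearity, the Jacobian matrix applied to the coordinates of \<open>(dx, dy, dV)\<close> gives the
coordinates of \<^term>\<open>lin_Phi\<close>; it remains to pass from coordinate sums to norms.\<close>

lemma error_bound:
  assumes ns: "nonsingular_on (coords I) (jacobian_entry (Phi0 P R xs) (encode (xs, ys, Vs)))"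
  obtains C where "0 < C" "\<And>dx dy dV. dV \<in> sym_mat \<Longrightarrow>
    norm dx + (\<Sum>i\<in>I. \<bar>dy i\<bar>) + norm dV \<le>
      C * (norm (lin_stat dx dy dV) + (\<Sum>i\<in>I. \<bar>gg i xs \<bullet> dx\<bar>) + norm (lin_compl dx dV))"
proof -
  let ?M = "jacobian_entry (Phi0 P R xs) (encode (xs, ys, Vs))"
  let ?S = "coords I :: ('n, 'm) coord set"
  obtain C where C: "0 < C"
    "\<And>v. (\<Sum>s\<in>?S. \<bar>v s\<bar>) \<le> C * (\<Sum>r\<in>?S. \<bar>\<Sum>s\<in>?S. ?M r s * v s\<bar>)"
    by (rule nonsingular_on_bound[OF finite_coords[OF finite_I] ns], rule that)
  define K where "K = real CARD('n) + 1 + real (card (svec_idx :: ('m \<times> 'm) set))"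
  have K: "1 \<le> K" "real CARD('n) \<le> K" "real (card (svec_idx :: ('m \<times> 'm) set)) \<le> K" by (auto simp: K_def)
  show ?thesis
  proof (rule that[of "C * K"])
    show "0 < C * K" using C K by simp
    fix dx :: "real^'n" and dy and dV :: "'m sqmat" assume dV: "dV \<in> sym_mat"
    define v where "v = encode (dx, dy, dV)"
    have Mv: "(\<Sum>s\<in>?S. ?M r s * v s) = lin_Phi (dx, dy, dV) r" if r: "r \<in> ?S" for r
    proof -
      have "(\<Sum>s\<in>?S. ?M r s * v s) = (\<Sum>s\<in>?S. v s * lin_Phi (decode (\<lambda>q. if q = s then 1 else 0)) r)"
        by (simp add: jacobian_entry_Phi0[OF r] mult.commute)
      also have "\<dots> = lin_Phi (decode (\<lambda>q. \<Sum>s\<in>?S. v s * (if q = s then 1 else 0))) r"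
        by (rule lin_Phi_decode_sum[OF finite_coords[OF finite_I], symmetric])
      also have "(\<lambda>q. \<Sum>s\<in>?S. v s * (if q = s then 1 else 0)) = (\<lambda>q. if q \<in> ?S then v q else 0)"
        by (auto simp: fun_eq_iff finite_coords[OF finite_I] if_distrib cong: if_cong)
      also have "decode \<dots> = (dx, \<lambda>i. if i \<in> I then dy i else 0, dV)"
      proof -
        have "smat (\<lambda>ab. if CV ab \<in> ?S then v (CV ab) else 0) = smat (svec dV)"
          by (rule smat_cong) (auto simp: coords_def v_def encode_def)
        then show ?thesis using smat_svec[OF dV]
          by (auto simp: decode_def coords_def v_def encode_def vec_eq_iff)
      qed
      also have "lin_Phi \<dots> r = lin_Phi (dx, dy, dV) r"
        by (cases r) (auto simp: lin_Phi_def lin_stat_def)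
      finally show ?thesis .
    qed
    have lc: "lin_compl dx dV \<in> sym_mat"
      unfolding lin_compl_def by (intro sym_mat_add jprod_sym Fmat_sym Flin_sym dV Vs_sym)
    have "norm dx + (\<Sum>i\<in>I. \<bar>dy i\<bar>) + norm dV \<le> (\<Sum>s\<in>?S. \<bar>v s\<bar>)"
    proof -
      have "norm dV \<le> (\<Sum>ab\<in>svec_idx. \<bar>svec dV ab\<bar>)"
        unfolding svec_norm_sym[OF dV, symmetric] svec_norm_def by (rule L2_set_le_sum_abs)
      then show ?thesis
        unfolding sum_coords[OF finite_I] using norm_le_l1_cart[of dx] by (simp add: v_def encode_def)
    qed
    also have "\<dots> \<le> C * (\<Sum>r\<in>?S. \<bar>lin_Phi (dx, dy, dV) r\<bar>)"
      using C(2)[of v] Mv by simp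
    also have "(\<Sum>r\<in>?S. \<bar>lin_Phi (dx, dy, dV) r\<bar>) \<le> K * norm (lin_stat dx dy dV)
        + K * (\<Sum>i\<in>I. \<bar>gg i xs \<bullet> dx\<bar>) + K * norm (lin_compl dx dV)"
      unfolding sum_coords[OF finite_I]
    proof (intro add_mono)
      have "(\<Sum>j\<in>UNIV. \<bar>lin_Phi (dx, dy, dV) (CX j)\<bar>) \<le> (\<Sum>j\<in>(UNIV::'n set). norm (lin_stat dx dy dV))"
        by (intro sum_mono) (simp add: lin_Phi_def component_le_norm_cart)
      also have "\<dots> \<le> K * norm (lin_stat dx dy dV)" using K(2) by (simp add: mult_right_mono)
      finally show "(\<Sum>j\<in>UNIV. \<bar>lin_Phi (dx, dy, dV) (CX j)\<bar>) \<le> K * norm (lin_stat dx dy dV)" .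
      have "(\<Sum>i\<in>I. \<bar>lin_Phi (dx, dy, dV) (CY i)\<bar>) = 1 * (\<Sum>i\<in>I. \<bar>gg i xs \<bullet> dx\<bar>)"
        by (simp add: lin_Phi_def)
      also have "\<dots> \<le> K * (\<Sum>i\<in>I. \<bar>gg i xs \<bullet> dx\<bar>)"
        using K(1) by (intro mult_right_mono sum_nonneg) auto
      finally show "(\<Sum>i\<in>I. \<bar>lin_Phi (dx, dy, dV) (CY i)\<bar>) \<le> K * (\<Sum>i\<in>I. \<bar>gg i xs \<bullet> dx\<bar>)" .
      have "(\<Sum>ab\<in>svec_idx. \<bar>lin_Phi (dx, dy, dV) (CV ab)\<bar>)
          \<le> (\<Sum>ab\<in>(svec_idx::('m \<times> 'm) set). norm (lin_compl dx dV))"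
      proof (rule sum_mono)
        fix ab :: "'m \<times> 'm" assume ab: "ab \<in> svec_idx"
        have "\<bar>svec (lin_compl dx dV) ab\<bar>\<le> L2_set (\<lambda>ab. \<bar>svec (lin_compl dx dV) ab\<bar>) svec_idx"
          by (rule member_le_L2_set[OF finite_svec_idx ab])
        also have "\<dots> = norm (lin_compl dx dV)"
          unfolding svec_norm_sym[OF lc, symmetric] svec_norm_def L2_set_def by simp
        finally show "\<bar>lin_Phi (dx, dy, dV) (CV ab)\<bar> \<le> norm (lin_compl dx dV)"
          by (simp add: lin_Phi_def)
      qed
      also have "\<dots> \<le> K * norm (lin_compl dx dV)" using K(3) by (simp add: mult_right_mono)
      finally show "(\<Sum>ab\<in>svec_idx. \<bar>lin_Phi (dx, dy, dV) (CV ab)\<bar>) \<le> K * norm (lin_compl dx dV)" .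
    qed
    finally show "norm dx + (\<Sum>i\<in>I. \<bar>dy i\<bar>) + norm dV \<le>
      C * K * (norm (lin_stat dx dy dV) + (\<Sum>i\<in>I. \<bar>gg i xs \<bullet> dx\<bar>) + norm (lin_compl dx dV))"
      using C(1) by (simp add: algebra_simps)
  qed
qed

end

section \<open>Domination of sequences\<close>

text \<open>The relation \<open>f = O(g)\<close> for sequences with values in different normed spaces.\<close>

definition dominated :: "(nat \<Rightarrow> 'a::real_normed_vector) \<Rightarrow> (nat \<Rightarrow> 'b::real_normed_vector) \<Rightarrow> bool"
  (infix "\<preceq>" 50) where
  "f \<preceq> g \<longleftrightarrow> (\<exists>C>0. \<forall>\<^sub>F k in sequentially. norm (f k) \<le> C * norm (g k))"

lemma dominatedI:
  assumes "\<forall>\<^sub>F k in sequentially. norm (f k) \<le> C * norm (g k)"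
  shows "f \<preceq> g"
proof -
  have "\<forall>\<^sub>F k in sequentially. norm (f k) \<le> max C 1 * norm (g k)"
    using assms by eventually_elim (meson max.cobounded1 mult_right_mono norm_ge_zero order_trans)
  moreover have "0 < max C 1" by simp
  ultimately show ?thesis unfolding dominated_def by blast
qed

lemma dominatedE:
  assumes "f \<preceq> g"
  obtains C where "0 < C" "\<forall>\<^sub>F k in sequentially. norm (f k) \<le> C * norm (g k)"
  using assms unfolding dominated_def by blast

lemma dominated_refl: "f \<preceq> f"
  by (rule dominatedI[of _ 1]) simp

lemma dominated_trans:
  assumes "f \<preceq> g" "g \<preceq> h"
  shows "f \<preceq> h"
proof -
  obtain C where C: "0 < C" "\<forall>\<^sub>F k in sequentially. norm (f k) \<le> C * norm (g k)"
    by (rule dominatedE[OF assms(1)])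
  obtain D where D: "0 < D" "\<forall>\<^sub>F k in sequentially. norm (g k) \<le> D * norm (h k)"
    by (rule dominatedE[OF assms(2)])
  have "\<forall>\<^sub>F k in sequentially. norm (f k) \<le> C * D * norm (h k)"
    using C(2) D(2)
  proof eventually_elim
    case (elim k)
    have "C * norm (g k) \<le> C * (D * norm (h k))" using elim C(1) by simp
    with elim(1) show ?case by (simp add: mult.assoc)
  qed
  then show ?thesis by (rule dominatedI)
qed

lemma dominated_eventually_le:
  "\<forall>\<^sub>F k in sequentially. norm (f k) \<le> norm (g k) \<Longrightarrow> f \<preceq> g"
  by (rule dominatedI[of _ 1]) simp

lemma dominated_cong:
  assumes "\<forall>\<^sub>F k in sequentially. f k = f' k" "f' \<preceq> g"
  shows "f \<preceq> g"
proof -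
  have "f \<preceq> f'" using assms(1) by (intro dominated_eventually_le) (auto elim!: eventually_mono)
  then show ?thesis using assms(2) by (rule dominated_trans)
qed

lemma dominated_add:
  assumes "f \<preceq> h" "g \<preceq> h"
  shows "(\<lambda>k. f k + g k) \<preceq> h"
proof -
  obtain C where C: "\<forall>\<^sub>F k in sequentially. norm (f k) \<le> C * norm (h k)"
    by (rule dominatedE[OF assms(1)])
  obtain D where D: "\<forall>\<^sub>F k in sequentially. norm (g k) \<le> D * norm (h k)"
    by (rule dominatedE[OF assms(2)])
  have "\<forall>\<^sub>F k in sequentially. norm (f k + g k) \<le> (C + D) * norm (h k)"
    using C D
  proof eventually_elim
    case (elim k)
    then show ?case using norm_triangle_ineq[of "f k" "g k"] by (simp add: algebra_simps)
  qed
  then show ?thesis by (rule dominatedI)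
qed

lemma dominated_uminus: "f \<preceq> h \<Longrightarrow> (\<lambda>k. - f k) \<preceq> h"
  by (simp add: dominated_def)

lemma dominated_diff: "f \<preceq> h \<Longrightarrow> g \<preceq> h \<Longrightarrow> (\<lambda>k. f k - g k) \<preceq> h"
  using dominated_add[OF _ dominated_uminus, of f h g] by simp

lemma dominated_zero: "(\<lambda>k. 0) \<preceq> h"
  by (rule dominatedI[of _ 0]) simp

lemma dominated_sum: "(\<And>i. i \<in> A \<Longrightarrow> f i \<preceq> h) \<Longrightarrow> (\<lambda>k. \<Sum>i\<in>A. f i k) \<preceq> h"
  by (induction A rule: infinite_finite_induct) (auto intro: dominated_add dominated_zero)

lemma dominated_norm_left: "(\<lambda>k. norm (f k)) \<preceq> g \<longleftrightarrow> f \<preceq> g"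
  by (simp add: dominated_def)

lemma dominated_norm_right: "f \<preceq> (\<lambda>k. norm (g k)) \<longleftrightarrow> f \<preceq> g"
  by (simp add: dominated_def)

lemma dominated_bounded_linear:
  assumes "bounded_linear T" "f \<preceq> h"
  shows "(\<lambda>k. T (f k)) \<preceq> h"
proof -
  obtain K where K: "\<And>x. norm (T x) \<le> norm x * K"
    using bounded_linear.bounded[OF assms(1)] by blast
  have "(\<lambda>k. T (f k)) \<preceq> f"
    by (rule dominatedI[of _ K]) (use K in \<open>simp add: mult.commute\<close>)
  then show ?thesis using assms(2) by (rule dominated_trans)
qed

lemma dominated_bilinear:
  fixes a b :: "nat \<Rightarrow> real"
  assumes "bounded_bilinear B" "f \<preceq> a" "g \<preceq> b"
  shows "(\<lambda>k. B (f k) (g k)) \<preceq> (\<lambda>k. a k * b k)"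
proof -
  obtain K where K: "0 < K" "\<And>x y. norm (B x y) \<le> norm x * norm y * K"
    using bounded_bilinear.pos_bounded[OF assms(1)] by blast
  obtain C where C: "0 < C" "\<forall>\<^sub>F k in sequentially. norm (f k) \<le> C * norm (a k)"
    by (rule dominatedE[OF assms(2)])
  obtain D where D: "0 < D" "\<forall>\<^sub>F k in sequentially. norm (g k) \<le> D * norm (b k)"
    by (rule dominatedE[OF assms(3)])
  have "\<forall>\<^sub>F k in sequentially. norm (B (f k) (g k)) \<le> (C * D * K) * norm (a k * b k)"
    using C(2) D(2)
  proof eventually_elim
    case (elim k)
    have "norm (B (f k) (g k)) \<le> norm (f k) * norm (g k) * K" by (rule K)
    also have "\<dots> \<le> (C * norm (a k)) * (D * norm (b k)) * K"
      using elim K(1) C(1) by (intro mult_right_mono mult_mono) auto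
    finally show ?case by (simp add: abs_mult mult_ac)
  qed
  then show ?thesis by (rule dominatedI)
qed

lemma dominated_bilinear_trans:
  fixes a b :: "nat \<Rightarrow> real"
  assumes "bounded_bilinear B" "f \<preceq> a" "g \<preceq> b" "(\<lambda>k. a k * b k) \<preceq> h"
  shows "(\<lambda>k. B (f k) (g k)) \<preceq> h"
  using dominated_bilinear[OF assms(1-3)] assms(4) by (rule dominated_trans)

lemmas dominated_mult = dominated_bilinear[OF bounded_bilinear_mult]

lemma dominated_const_scaleR: "f \<preceq> h \<Longrightarrow> (\<lambda>k. c *\<^sub>R f k) \<preceq> h"
  by (rule dominated_bounded_linear[OF bounded_linear_scaleR_right])

lemma dominated_tendsto_one:
  assumes "f \<longlonglongrightarrow> l"
  shows "f \<preceq> (\<lambda>_. 1 :: real)"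
proof -
  obtain K where "\<And>k. norm (f k) \<le> K"
    using convergent_imp_Bseq[OF convergentI[OF assms]] by (auto simp: Bseq_def)
  then show ?thesis by (intro dominatedI[of _ K]) simp
qed

lemma dominated_tendsto_zero:
  assumes "f \<preceq> g" "g \<longlonglongrightarrow> 0"
  shows "f \<longlonglongrightarrow> 0"
proof -
  obtain C where C: "\<forall>\<^sub>F k in sequentially. norm (f k) \<le> C * norm (g k)"
    by (rule dominatedE[OF assms(1)])
  have "(\<lambda>k. C * norm (g k)) \<longlonglongrightarrow> 0"
    using assms(2) by (auto intro!: tendsto_eq_intros)
  then show ?thesis by (rule tendsto_0_le[where K=1, OF _ eventually_mono[OF C]]) auto
qed

text \<open>A fraction of \<open>u\<close> on the right that tends to zero can be moved to the left.\<close>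

lemma dominated_absorb:
  fixes q :: "nat \<Rightarrow> real"
  assumes u: "u \<preceq> (\<lambda>k. norm (r k) + q k * norm (u k))" and q: "q \<longlonglongrightarrow> 0"
  shows "u \<preceq> r"
proof -
  obtain C where C: "0 < C" "\<forall>\<^sub>F k in sequentially. norm (u k) \<le> C * norm (norm (r k) + q k * norm (u k))"
    by (rule dominatedE[OF u])
  have "\<forall>\<^sub>F k in sequentially. norm (q k) < 1 / (2 * C)"
    using order_tendstoD(2)[OF tendsto_norm_zero[OF q], of "1 / (2 * C)"] C(1) by simp
  with C(2) have "\<forall>\<^sub>F k in sequentially. norm (u k) \<le> (2 * C) * norm (r k)"
  proof eventually_elim
    case (elim k)
    have "norm (norm (r k) + q k * norm (u k)) \<le> norm (r k) + \<bar>q k\<bar> * norm (u k)"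
      using abs_triangle_ineq[of "norm (r k)" "q k * norm (u k)"] by (simp add: abs_mult)
    also have "\<dots> \<le> norm (r k) + 1 / (2 * C) * norm (u k)"
      using elim(2) by (intro add_left_mono mult_right_mono) auto
    finally have "C * norm (norm (r k) + q k * norm (u k)) \<le> C * (norm (r k) + 1 / (2 * C) * norm (u k))"
      using C(1) by simp
    also have "\<dots> = C * norm (r k) + norm (u k) / 2" using C(1) by (simp add: field_simps)
    finally show ?case using elim(1) by simp
  qed
  then show ?thesis by (rule dominatedI)
qed

lemma dominated_cancel_factor:
  fixes f g :: "nat \<Rightarrow> real"
  assumes "(\<lambda>k. f k * g k) \<preceq> r" "f \<longlonglongrightarrow> l" "l \<noteq> 0"
  shows "g \<preceq> r"
proof -
  obtain C where C: "0 < C" "\<forall>\<^sub>F k in sequentially. norm (f k * g k) \<le> C * norm (r k)"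
    by (rule dominatedE[OF assms(1)])
  have "\<forall>\<^sub>F k in sequentially. norm (f k) > norm l / 2"
    using order_tendstoD(1)[OF tendsto_norm[OF assms(2)], of "norm l / 2"] assms(3) by simp
  with C(2) have "\<forall>\<^sub>F k in sequentially. norm (g k) \<le> (2 * C / norm l) * norm (r k)"
  proof eventually_elim
    case (elim k)
    have "norm l / 2 * norm (g k) \<le> norm (f k) * norm (g k)"
      using elim(2) by (intro mult_right_mono) auto
    then have "norm l / 2 * norm (g k) \<le> C * norm (r k)" using elim(1) by (simp add: norm_mult)
    then show ?case using assms(3) by (simp add: field_simps)
  qed
  then show ?thesis by (rule dominatedI)
qed

lemma dominated_powr:
  fixes f g :: "nat \<Rightarrow> real"
  assumes "f \<preceq> g" "\<And>k. 0 \<le> f k" "\<And>k. 0 \<le> g k" "0 \<le> a"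
  shows "(\<lambda>k. f k powr a) \<preceq> (\<lambda>k. g k powr a)"
proof -
  obtain C where C: "0 < C" "\<forall>\<^sub>F k in sequentially. norm (f k) \<le> C * norm (g k)"
    by (rule dominatedE[OF assms(1)])
  have "\<forall>\<^sub>F k in sequentially. norm (f k powr a) \<le> C powr a * norm (g k powr a)"
    using C(2)
  proof eventually_elim
    case (elim k)
    then have "f k powr a \<le> (C * g k) powr a" using assms by (intro powr_mono2) auto
    also have "\<dots> = C powr a * g k powr a" using C assms by (simp add: powr_mult)
    finally show ?case by simp
  qed
  then show ?thesis by (rule dominatedI)
qed

lemma powr_dominated:
  fixes f :: "nat \<Rightarrow> real"
  assumes "f \<longlonglongrightarrow> 0" "\<And>k. 0 < f k" "b \<le> a"
  shows "(\<lambda>k. f k powr a) \<preceq> (\<lambda>k. f k powr b)"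
proof (rule dominated_eventually_le)
  have "\<forall>\<^sub>F k in sequentially. f k < 1" using order_tendstoD(2)[OF assms(1)] by simp
  then show "\<forall>\<^sub>F k in sequentially. norm (f k powr a) \<le> norm (f k powr b)"
  proof eventually_elim
    case (elim k)
    then show ?case using assms(2)[of k] assms(3) by (simp add: powr_mono')
  qed
qed

lemma quad_rem_sequence:
  assumes q: "quad_rem_at F F' a" and u: "u \<longlonglongrightarrow> a" and v: "v \<longlonglongrightarrow> a"
  shows "(\<lambda>k. F (v k) - F (u k) - F' (u k) (v k - u k)) \<preceq> (\<lambda>k. (norm (v k - u k))\<^sup>2)"
proof -
  obtain C r where C: "0 < C" "0 < r"
    "\<And>x y. x \<in> ball a r \<Longrightarrow> y \<in> ball a r \<Longrightarrow>
           norm (F y - F x - F' x (y - x)) \<le> C * (norm (y - x))\<^sup>2"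
    using quad_rem_atE[OF q] by metis
  have "\<forall>\<^sub>F k in sequentially. norm (F (v k) - F (u k) - F' (u k) (v k - u k)) \<le> C * norm ((norm (v k - u k))\<^sup>2)"
    using tendstoD[OF u C(2)] tendstoD[OF v C(2)]
    by eventually_elim (use C(3) in \<open>simp add: dist_commute\<close>)
  then show ?thesis by (rule dominatedI)
qed

lemma quad_rem_diff_sequence:
  assumes q: "quad_rem_at F F' a" and u: "u \<longlonglongrightarrow> a"
  shows "(\<lambda>k. F (u k) - F a) \<preceq> (\<lambda>k. u k - a)"
proof -
  obtain C r where C: "0 < C" "0 < r"
    "\<And>x y. x \<in> ball a r \<Longrightarrow> y \<in> ball a r \<Longrightarrow> norm (F y - F x) \<le> C * norm (y - x)"
    using quad_rem_at_lipschitz[OF q] by metis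
  have "\<forall>\<^sub>F k in sequentially. norm (F (u k) - F a) \<le> C * norm (u k - a)"
    using tendstoD[OF u C(2)] by eventually_elim (use C(2,3) in \<open>simp add: dist_commute\<close>)
  then show ?thesis by (rule dominatedI)
qed

lemma quad_rem_tendsto:
  assumes "quad_rem_at F F' a" "u \<longlonglongrightarrow> a"
  shows "(\<lambda>k. F (u k)) \<longlonglongrightarrow> F a"
  using isCont_tendsto_compose[OF quad_rem_at_tendsto[OF assms(1)] assms(2)] .

lemma quad_rem_derivative_diff_sequence:
  assumes q: "quad_rem_at F F' a" and u: "u \<longlonglongrightarrow> a"
  shows "(\<lambda>k. F' (u k) (h k) - F' a (h k)) \<preceq> (\<lambda>k. norm (u k - a) * norm (h k))"
proof -
  obtain C r where C: "0 < C" "0 < r"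
    "\<And>x h. x \<in> ball a r \<Longrightarrow> norm (F' x h - F' a h) \<le> C * norm (x - a) * norm h"
    using quad_rem_at_derivative_lipschitz[OF q] by metis
  have "\<forall>\<^sub>F k in sequentially. norm (F' (u k) (h k) - F' a (h k)) \<le> C * norm (norm (u k - a) * norm (h k))"
    using tendstoD[OF u C(2)] by eventually_elim (use C(3) in \<open>simp add: dist_commute mult.assoc\<close>)
  then show ?thesis by (rule dominatedI)
qed

lemma quad_rem_derivative_sequence:
  assumes q: "quad_rem_at F F' a" and u: "u \<longlonglongrightarrow> a"
  shows "(\<lambda>k. F' (u k) (h k)) \<preceq> h"
proof -
  obtain C r where C: "0 < C" "0 < r"
    "\<And>x h. x \<in> ball a r \<Longrightarrow> norm (F' x h) \<le> C * norm h"
    using quad_rem_atE[OF q] by metis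
  have "\<forall>\<^sub>F k in sequentially. norm (F' (u k) (h k)) \<le> C * norm (h k)"
    using tendstoD[OF u C(2)] by eventually_elim (use C(3) in \<open>simp add: dist_commute\<close>)
  then show ?thesis by (rule dominatedI)
qed

section \<open>One Newton step near the solution\<close>

text \<open>A sequence of iterates \<open>(x, y, V)\<close> and Newton directions \<open>(dx, dy, dV)\<close>, in the enumeration of
the branches at the limit. The residual of an iterate is small with respect to \<open>mu'\<close>, the barrier
parameter for which it was accepted; the Newton step aims at the smaller parameter \<open>mu\<close>. Once
the active constraints are identified, the complementarity system of the step reduces to the linear
equations \<open>step_active\<close> and \<open>step_inactive\<close>.\<close>

locale newton_iterates = kkt_jacobian P R xs ys Vs
  for P :: "('n::finite, 'm::{finite,linorder}, 'q::finite) sisdp" and R :: "('n, 'q) reduction" and xs ys Vs +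
  fixes x dx :: "nat \<Rightarrow> real^'n" and y dy :: "nat \<Rightarrow> nat \<Rightarrow> real" and V dV :: "nat \<Rightarrow> 'm sqmat"
    and mu' mu eps' :: "nat \<Rightarrow> real" and al c g1 g2 :: real
  assumes al: "0 < al" "al < 1" and c: "0 < c" "c < 1" and g1: "0 < g1" and g2: "0 < g2"
    and mu'_pos: "0 < mu' k" and mu'_tendsto: "mu' \<longlonglongrightarrow> 0"
    and mu_eq: "\<forall>\<^sub>F k in sequentially. mu k = g2 * mu' k powr (1 + c * al)"
    and eps'_eq: "eps' k = g1 * mu' k powr (1 + al)"
    and nonsing: "nonsingular_on (coords I) (jacobian_entry (Phi0 P R xs) (encode (xs, ys, Vs)))"
    and compl_xs: "jprod (Fmat P xs) Vs = 0" and strict_xs: "Fmat P xs + Vs \<in> pd"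
    and g_nonpos: "i < p \<Longrightarrow> gh i xs \<le> 0" and ys_nonneg: "0 \<le> ys i"
    and strict_g: "i < p \<Longrightarrow> 0 < - gh i xs + ys i"
    and x_tendsto: "x \<longlonglongrightarrow> xs" and y_tendsto: "i < p \<Longrightarrow> (\<lambda>k. y k i) \<longlonglongrightarrow> ys i" and V_tendsto: "V \<longlonglongrightarrow> Vs"
    and F_pd: "\<forall>\<^sub>F k in sequentially. Fmat P (x k) \<in> pd" and V_pd: "\<forall>\<^sub>F k in sequentially. V k \<in> pd"
    and y_nonneg: "0 \<le> y k i"
    and res_stat: "\<forall>\<^sub>F k in sequentially. norm (gf (x k)
      + (\<Sum>i<p. y k i *\<^sub>R gg i (x k)) - Fadj P (V k)) \<le> eps' k"
    and res_compl: "\<forall>\<^sub>F k in sequentially. \<bar>\<Sum>i<p. y k i * gh i (x k)\<bar> \<le> eps' k"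
    and res_feas: "\<forall>\<^sub>F k in sequentially. \<forall>i<p. gh i (x k) \<le> eps' k"
    and res_sdp: "\<forall>\<^sub>F k in sequentially. norm (jprod (Fmat P (x k)) (V k) - mu' k *\<^sub>R mat 1) \<le> eps' k"
    and step_stat: "\<forall>\<^sub>F k in sequentially. gf (x k) + Hf (x k) *v dx k
      + (\<Sum>i<p. y k i *\<^sub>R (Hg i (x k) *v dx k))
      + (\<Sum>i<p. (y k i + dy k i) *\<^sub>R gg i (x k)) - Fadj P (V k + dV k) = 0"
    and step_sym: "\<forall>\<^sub>F k in sequentially. dV k \<in> sym_mat"
    and step_sdp: "\<forall>\<^sub>F k in sequentially. jprod (Fmat P (x k)) (V k + dV k)
      + scaled_op (Fmat P (x k)) (V k) (Flin P (dx k)) = mu k *\<^sub>R mat 1"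
    and step_active: "\<forall>\<^sub>F k in sequentially. \<forall>i\<in>I. gh i (x k) + gg i (x k) \<bullet> dx k = 0"
    and step_inactive: "\<forall>\<^sub>F k in sequentially. \<forall>i<p. i \<notin> I \<longrightarrow> y k i + dy k i = 0"
    and step_sign: "\<forall>\<^sub>F k in sequentially. \<forall>i<p. gh i (x k) + gg i (x k) \<bullet> dx k \<le> 0"
begin

text \<open>The letter \<open>h\<close> marks the error of the iterate and \<open>v\<close> the error after the full step; \<open>e\<close> and \<open>n\<close>
are their total sizes. The matrix \<open>scal_err\<close> is the contribution of the scaling to the linearized
complementarity equation.\<close>

definition "hx k = x k - xs"
definition "hy i k = y k i - ys i"
definition "hV k = V k - Vs"
definition "e k = norm (hx k) + (\<Sum>i<p. \<bar>hy i k\<bar>) + norm (hV k)"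
definition "vx k = x k + dx k - xs"
definition "vy i k = y k i + dy k i - ys i"
definition "vV k = V k + dV k - Vs"
definition "n k = norm (vx k) + (\<Sum>i<p. \<bar>vy i k\<bar>) + norm (vV k)"
definition "scal_err k = scaled_op (Fmat P (x k)) (V k) (Flin P (dx k)) - jprod (V k) (Flin P (dx k))"
abbreviation "a k \<equiv> mu' k powr al"
abbreviation "M k \<equiv> mu' k powr (1 + c * al)"
abbreviation "B k \<equiv> mu' k powr (1 + al)"

lemma sum_I: "(\<And>i. i < p \<Longrightarrow> i \<notin> I \<Longrightarrow> f i = 0) \<Longrightarrow> (\<Sum>i<p. f i) = (\<Sum>i\<in>I. f i)"
  by (rule sum.mono_neutral_right) (auto simp: I_lt)

lemma sum_split_I: "(\<Sum>i<p. f i) = (\<Sum>i\<in>I. f i) + (\<Sum>i\<in>{..<p} - I. f i)"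
  using sum.subset_diff[of I "{..<p}" f] by (simp add: subset_eq I_lt add.commute)

lemma a_mu': "a k * mu' k = B k" and mu'_a: "mu' k * a k = B k"
  using mu'_pos[of k] by (simp_all add: powr_add mult.commute)

lemma mu'_powr_one: "(\<lambda>k. mu' k powr 1) = mu'"
  using mu'_pos by (simp add: fun_eq_iff less_imp_le)

lemma B_M: "B \<preceq> M"
proof (rule powr_dominated[OF mu'_tendsto mu'_pos])
  have "c * al \<le> 1 * al" using c al by (intro mult_right_mono) auto
  then show "1 + c * al \<le> 1 + al" by simp
qed

lemma M_mu': "M \<preceq> mu'"
proof -
  have "M \<preceq> (\<lambda>k. mu' k powr 1)" using c al by (intro powr_dominated[OF mu'_tendsto mu'_pos]) simp
  then show ?thesis unfolding mu'_powr_one .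
qed

lemma mu'_a_dom: "mu' \<preceq> a"
proof -
  have "(\<lambda>k. mu' k powr 1) \<preceq> a" using al by (intro powr_dominated[OF mu'_tendsto mu'_pos]) simp
  then show ?thesis unfolding mu'_powr_one .
qed

lemma B_mu': "B \<preceq> mu'" by (rule dominated_trans[OF B_M M_mu'])

lemma a_tendsto: "a \<longlonglongrightarrow> 0"
proof -
  have "((\<lambda>k. mu' k powr al) \<longlongrightarrow> 0) sequentially"
    using tendsto_powr'[OF mu'_tendsto tendsto_const[of al]] al mu'_pos
    by (simp add: less_imp_le)
  then show ?thesis .
qed

lemma eps'_B: "eps' \<preceq> B"
  unfolding eps'_eq[abs_def] by (rule dominatedI[of _ g1]) (use g1 in simp)

lemma eps'_nonneg: "0 \<le> eps' k"
  using g1 by (simp add: eps'_eq)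

lemma eps'_mu': "eps' \<preceq> mu'" by (rule dominated_trans[OF eps'_B B_mu'])

lemma eps'_tendsto: "eps' \<longlonglongrightarrow> 0"
  by (rule dominated_tendsto_zero[OF eps'_mu' mu'_tendsto])

lemma mu_M: "mu \<preceq> M"
  by (rule dominated_cong[OF mu_eq]) (rule dominatedI[of _ g2], use g2 in simp)

lemma dominated_of_le_eps':
  assumes "\<forall>\<^sub>F k in sequentially. norm (f k) \<le> eps' k"
  shows "f \<preceq> eps'"
  by (rule dominated_eventually_le) (use assms in \<open>auto elim!: eventually_mono\<close>)

lemmas res_stat_dom = dominated_of_le_eps'[OF res_stat]
lemmas res_sdp_dom = dominated_of_le_eps'[OF res_sdp]

lemma gh_tendsto: "i < p \<Longrightarrow> (\<lambda>k. gh i (x k)) \<longlonglongrightarrow> gh i xs"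
  by (rule quad_rem_tendsto[OF ghat_quad_rem x_tendsto])

lemma gg_tendsto: "i < p \<Longrightarrow> (\<lambda>k. gg i (x k)) \<longlonglongrightarrow> gg i xs"
  by (rule quad_rem_tendsto[OF grad_ghat_quad_rem x_tendsto])

text \<open>The sum over all \<open>i\<close> is the limit of the complementarity residuals, and its terms are nonpositive.\<close>

lemma complementarity_xs:
  assumes i: "i < p"
  shows "ys i * gh i xs = 0"
proof -
  have "(\<lambda>k. \<Sum>i<p. y k i * gh i (x k)) \<longlonglongrightarrow> (\<Sum>i<p. ys i * gh i xs)"
    by (intro tendsto_intros y_tendsto gh_tendsto) auto
  moreover have "(\<lambda>k. \<Sum>i<p. y k i * gh i (x k)) \<longlonglongrightarrow> 0"
    by (rule dominated_tendsto_zero[OF dominated_of_le_eps' eps'_tendsto]) (use res_compl in simp)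
  ultimately have "(\<Sum>i<p. ys i * gh i xs) = 0" using LIMSEQ_unique by blast
  moreover have "ys i * gh i xs \<le> 0" if "i < p" for i
    using ys_nonneg g_nonpos[OF that] by (simp add: mult_nonneg_nonpos)
  ultimately have "(\<Sum>i<p. - (ys i * gh i xs)) = 0" "\<And>i. i < p \<Longrightarrow> 0 \<le> - (ys i * gh i xs)"
    by (simp_all add: sum_negf)
  then have "\<forall>i\<in>{..<p}. - (ys i * gh i xs) = 0"
    by (subst (asm) sum_nonneg_eq_0_iff) auto
  then show ?thesis using i by simp
qed

lemma active_xs: "i \<in> I \<Longrightarrow> gh i xs = 0" and ys_active: "i \<in> I \<Longrightarrow> 0 < ys i"
  using strict_g[of i] by (auto simp: Iact_def)

lemma inactive_xs: "i < p \<Longrightarrow> i \<notin> I \<Longrightarrow> gh i xs \<noteq> 0" and ys_inactive: "i < p \<Longrightarrow> i \<notin> I \<Longrightarrow> ys i = 0"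
  using complementarity_xs[of i] by (auto simp: Iact_def)

lemma stationarity_xs: "Fadj P Vs = gf xs + (\<Sum>i\<in>I. ys i *\<^sub>R gg i xs)"
proof -
  have "(\<lambda>k. gf (x k) + (\<Sum>i<p. y k i *\<^sub>R gg i (x k)) - Fadj P (V k))
     \<longlonglongrightarrow> gf xs + (\<Sum>i<p. ys i *\<^sub>R gg i xs) - Fadj P Vs"
    by (intro tendsto_intros y_tendsto gg_tendsto quad_rem_tendsto[OF grad_obj_quad_rem[OF obj_C3] x_tendsto]
        bounded_linear.tendsto[OF bounded_linear_Fadj V_tendsto]) auto
  moreover have "(\<lambda>k. gf (x k) + (\<Sum>i<p. y k i *\<^sub>R gg i (x k)) - Fadj P (V k)) \<longlonglongrightarrow> 0"
    by (rule dominated_tendsto_zero[OF res_stat_dom eps'_tendsto])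
  ultimately have "gf xs + (\<Sum>i<p. ys i *\<^sub>R gg i xs) - Fadj P Vs = 0"
    using LIMSEQ_unique by blast
  moreover have "(\<Sum>i<p. ys i *\<^sub>R gg i xs) = (\<Sum>i\<in>I. ys i *\<^sub>R gg i xs)"
    by (rule sum_I) (simp add: ys_inactive)
  ultimately show ?thesis by simp
qed

text \<open>Approximate feasibility bounds every product from above, approximate complementarity bounds their
sum; together they bound each product from below.\<close>

lemma multiplier_times_constraint_dom:
  assumes i: "i < p"
  shows "(\<lambda>k. y k i * gh i (x k)) \<preceq> eps'"
proof -
  define K where "K = (\<Sum>j<p. ys j + 1)"
  have "\<forall>\<^sub>F k in sequentially. \<forall>j\<in>{..<p}. y k j < ys j + 1"
    using order_tendstoD(2)[OF y_tendsto] by (intro eventually_ball_finite) auto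
  then have "\<forall>\<^sub>F k in sequentially. norm (y k i * gh i (x k)) \<le> (1 + K) * norm (eps' k)"
    using res_compl res_feas
  proof eventually_elim
    case (elim k)
    have up: "y k j * gh j (x k) \<le> (ys j + 1) * eps' k" if "j < p" for j
    proof -
      have yj: "y k j \<le> ys j + 1" using bspec[OF elim(1), of j] that by simp
      have "y k j * gh j (x k) \<le> y k j * eps' k" using elim(3) that y_nonneg by (intro mult_left_mono) auto
      also have "\<dots> \<le> (ys j + 1) * eps' k" using yj eps'_nonneg by (rule mult_right_mono)
      finally show ?thesis .
    qed
    have Kge: "(\<Sum>j\<in>{..<p} - {i}. ys j + 1) + (ys i + 1) = K"
      unfolding K_def using i by (subst sum.remove[of _ i]) auto
    have sp: "(\<Sum>j<p. y k j * gh j (x k)) = y k i * gh i (x k) + (\<Sum>j\<in>{..<p} - {i}. y k j * gh j (x k))"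
      using i by (subst sum.remove[of _ i]) auto
    have "(\<Sum>j\<in>{..<p} - {i}. y k j * gh j (x k)) \<le> (\<Sum>j\<in>{..<p} - {i}. (ys j + 1) * eps' k)"
      by (intro sum_mono up) auto
    also have "\<dots> = (K - (ys i + 1)) * eps' k" using Kge by (simp add: sum_distrib_right[symmetric])
    also have "\<dots> \<le> K * eps' k" using ys_nonneg[of i] eps'_nonneg by (intro mult_right_mono) auto
    finally have lo: "- (1 + K) * eps' k \<le> y k i * gh i (x k)"
      using elim(2) sp by (simp add: algebra_simps abs_le_iff)
    have "0 \<le> (\<Sum>j\<in>{..<p} - {i}. ys j + 1)" using ys_nonneg by (intro sum_nonneg) (simp add: add_nonneg_nonneg)
    then have "ys i + 1 \<le> 1 + K" using Kge by simp
    then have "(ys i + 1) * eps' k \<le> (1 + K) * eps' k" using eps'_nonneg by (rule mult_right_mono)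
    with up[OF i] have "y k i * gh i (x k) \<le> (1 + K) * eps' k" by linarith
    with lo show ?case using eps'_nonneg[of k] by (simp add: abs_le_iff algebra_simps)
  qed
  then show ?thesis by (rule dominatedI)
qed

lemma active_constraint_dom: "i \<in> I \<Longrightarrow> (\<lambda>k. gh i (x k)) \<preceq> eps'"
  using ys_active[of i]
  by (intro dominated_cancel_factor[OF multiplier_times_constraint_dom y_tendsto]) (auto simp: I_lt)

lemma inactive_multiplier_dom: "i < p \<Longrightarrow> i \<notin> I \<Longrightarrow> (\<lambda>k. y k i) \<preceq> eps'"
  by (rule dominated_cancel_factor[OF _ gh_tendsto inactive_xs])
    (simp_all add: multiplier_times_constraint_dom mult.commute[of "gh i _"])

lemma dominated_abs_left: "(\<lambda>k. \<bar>f k :: real\<bar>) \<preceq> g \<longleftrightarrow> f \<preceq> g"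
  by (simp add: dominated_def)

lemma sequence_error_bound:
  assumes sym: "\<forall>\<^sub>F k in sequentially. uV k \<in> sym_mat"
    and stat: "(\<lambda>k. lin_stat (ux k) (\<lambda>i. uy i k) (uV k)) \<preceq> t"
    and act: "\<And>i. i \<in> I \<Longrightarrow> (\<lambda>k. gg i xs \<bullet> ux k) \<preceq> t"
    and compl: "(\<lambda>k. lin_compl (ux k) (uV k)) \<preceq> t"
  shows "ux \<preceq> t" "uV \<preceq> t" "i \<in> I \<Longrightarrow> uy i \<preceq> t"
proof -
  obtain C where C: "0 < C" "\<And>dx dy dV. dV \<in> sym_mat \<Longrightarrow>
    norm dx + (\<Sum>i\<in>I. \<bar>dy i\<bar>) + norm dV \<le>
      C * (norm (lin_stat dx dy dV) + (\<Sum>i\<in>I. \<bar>gg i xs \<bullet> dx\<bar>) + norm (lin_compl dx dV))"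
    using error_bound[OF nonsing] by metis
  let ?D = "\<lambda>k. norm (lin_stat (ux k) (\<lambda>i. uy i k) (uV k)) + (\<Sum>i\<in>I. \<bar>gg i xs \<bullet> ux k\<bar>)
    + norm (lin_compl (ux k) (uV k))"
  let ?u = "\<lambda>k. norm (ux k) + (\<Sum>i\<in>I. \<bar>uy i k\<bar>) + norm (uV k)"
  have nn: "0 \<le> (\<Sum>i\<in>I. \<bar>uy i k\<bar>)" for k by (intro sum_nonneg) simp
  have "(\<lambda>k. \<bar>gg i xs \<bullet> ux k\<bar>) \<preceq> t" if "i \<in> I" for i
    using act[OF that] dominated_norm_left[of "\<lambda>k. gg i xs \<bullet> ux k" t] by simp
  then have D: "?D \<preceq> t"
    by (intro dominated_add dominated_sum) (auto simp: dominated_norm_left stat compl)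
  have "?u \<preceq> ?D"
  proof (rule dominatedI[of _ C], use sym in eventually_elim)
    case (elim k)
    have "?D k \<le> norm (?D k)" by simp
    then have "C * ?D k \<le> C * norm (?D k)" using C(1) by (intro mult_left_mono) auto
    with C(2)[OF elim, of "ux k" "\<lambda>i. uy i k"] nn[of k] show ?case by simp
  qed
  then have u: "?u \<preceq> t" using D by (rule dominated_trans)
  have "ux \<preceq> ?u" "uV \<preceq> ?u" using nn by (auto intro!: dominated_eventually_le always_eventually simp: add_nonneg_nonneg)
  then show "ux \<preceq> t" "uV \<preceq> t" using u by (auto intro: dominated_trans)
  assume i: "i \<in> I"
  have "\<bar>uy i k\<bar> \<le> (\<Sum>i\<in>I. \<bar>uy i k\<bar>)" for k using i finite_I by (intro member_le_sum) auto
  have "\<bar>uy i k\<bar> \<le> ?u k" for k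
    using norm_ge_zero[of "ux k"] norm_ge_zero[of "uV k"] \<open>\<And>k. \<bar>uy i k\<bar> \<le> _\<close>[of k] by linarith
  then have "\<bar>uy i k\<bar> \<le> norm (?u k)" for k by (rule order_trans) simp
  then have "uy i \<preceq> ?u" by (auto intro!: dominated_eventually_le always_eventually)
  then show "uy i \<preceq> t" using u by (rule dominated_trans)
qed

lemma e_nonneg: "0 \<le> e k" unfolding e_def by (intro add_nonneg_nonneg sum_nonneg) auto

lemma n_nonneg: "0 \<le> n k" unfolding n_def by (intro add_nonneg_nonneg sum_nonneg) auto

lemma hx_e: "hx \<preceq> e" and hV_e: "hV \<preceq> e"
  by (auto intro!: dominated_eventually_le always_eventually simp: e_def sum_nonneg add_nonneg_nonneg)

lemma hy_e: "i < p \<Longrightarrow> hy i \<preceq> e"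
proof (intro dominated_eventually_le always_eventually allI)
  fix k assume i: "i < p"
  have "\<bar>hy i k\<bar> \<le> (\<Sum>i<p. \<bar>hy i k\<bar>)" using i by (intro member_le_sum) auto
  then have "\<bar>hy i k\<bar> \<le> e k" unfolding e_def using norm_ge_zero[of "hx k"] norm_ge_zero[of "hV k"] by linarith
  then show "norm (hy i k) \<le> norm (e k)" by simp
qed

lemma vx_n: "vx \<preceq> n" and vV_n: "vV \<preceq> n"
  by (auto intro!: dominated_eventually_le always_eventually simp: n_def sum_nonneg add_nonneg_nonneg)

lemma vy_n: "i < p \<Longrightarrow> vy i \<preceq> n"
proof (intro dominated_eventually_le always_eventually allI)
  fix k assume i: "i < p"
  have "\<bar>vy i k\<bar> \<le> (\<Sum>i<p. \<bar>vy i k\<bar>)" using i by (intro member_le_sum) auto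
  then have "\<bar>vy i k\<bar> \<le> n k" unfolding n_def using norm_ge_zero[of "vx k"] norm_ge_zero[of "vV k"] by linarith
  then show "norm (vy i k) \<le> norm (n k)" by simp
qed

lemma e_dominatedI: "hx \<preceq> t \<Longrightarrow> (\<And>i. i < p \<Longrightarrow> hy i \<preceq> t) \<Longrightarrow> hV \<preceq> t \<Longrightarrow> e \<preceq> t"
  unfolding e_def[abs_def]
  by (intro dominated_add dominated_sum) (auto simp: dominated_norm_left dominated_abs_left)

lemma n_dominatedI: "vx \<preceq> t \<Longrightarrow> (\<And>i. i < p \<Longrightarrow> vy i \<preceq> t) \<Longrightarrow> vV \<preceq> t \<Longrightarrow> n \<preceq> t"
  unfolding n_def[abs_def]
  by (intro dominated_add dominated_sum) (auto simp: dominated_norm_left dominated_abs_left)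

lemma e_tendsto: "e \<longlonglongrightarrow> 0"
proof -
  have "(\<lambda>k. hx k) \<longlonglongrightarrow> xs - xs" "\<And>i. i < p \<Longrightarrow> (\<lambda>k. hy i k) \<longlonglongrightarrow> ys i - ys i" "(\<lambda>k. hV k) \<longlonglongrightarrow> Vs - Vs"
    unfolding hx_def hy_def hV_def by (intro tendsto_intros x_tendsto y_tendsto V_tendsto; assumption)+
  then have "(\<lambda>k. norm (hx k) + (\<Sum>i<p. \<bar>hy i k\<bar>) + norm (hV k)) \<longlonglongrightarrow> norm (xs - xs) + (\<Sum>i<p. \<bar>ys i - ys i\<bar>) + norm (Vs - Vs)"
    by (intro tendsto_intros) auto
  then show ?thesis by (simp add: e_def[abs_def])
qed

lemma norm_hx_sq: "(\<lambda>k. (norm (hx k))\<^sup>2) \<preceq> (\<lambda>k. e k * e k)"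
  unfolding power2_eq_square by (intro dominated_mult) (simp_all add: dominated_norm_left hx_e)

lemma sym_hV: "\<forall>\<^sub>F k in sequentially. hV k \<in> sym_mat"
  using V_pd by eventually_elim (auto simp: hV_def intro: sym_mat_diff Vs_sym pd_sym)

lemma sym_vV: "\<forall>\<^sub>F k in sequentially. vV k \<in> sym_mat"
  using V_pd step_sym by eventually_elim (auto simp: vV_def intro: sym_mat_diff sym_mat_add Vs_sym pd_sym)

lemma Flin_hx: "Flin P (hx k) = Fmat P (x k) - Fmat P xs"
  using Fmat_add[of P xs "hx k"] by (simp add: hx_def)

lemma Fadj_diff: "Fadj P (X - Y) = Fadj P X - Fadj P Y"
  by (rule linear_diff[OF Fadj_linear])

lemma lin_stat_h:
  "lin_stat (hx k) (\<lambda>i. hy i k) (hV k) =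
     (gf (x k) + (\<Sum>i<p. y k i *\<^sub>R gg i (x k)) - Fadj P (V k))
     - (gf (x k) - gf xs - Hf xs *v (x k - xs))
     - (\<Sum>i\<in>I. ys i *\<^sub>R (gg i (x k) - gg i xs - Hg i xs *v (x k - xs)))
     - (\<Sum>i\<in>I. hy i k *\<^sub>R (gg i (x k) - gg i xs))
     - (\<Sum>i\<in>{..<p} - I. y k i *\<^sub>R gg i (x k))"
  unfolding lin_stat_def sum_split_I[of "\<lambda>i. y k i *\<^sub>R gg i (x k)"]
  by (simp add: hV_def Fadj_diff stationarity_xs hx_def hy_def scaleR_diff_left scaleR_diff_right
      sum_subtractf)

lemma lin_compl_h:
  "lin_compl (hx k) (hV k) = (jprod (Fmat P (x k)) (V k) - mu' k *\<^sub>R mat 1) + mu' k *\<^sub>R mat 1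
     - jprod (Flin P (hx k)) (hV k)"
  by (simp add: lin_compl_def Flin_hx hV_def jprod.diff_left jprod.diff_right compl_xs)

text \<open>The KKT map is of order \<open>mu'\<close> at the iterate and vanishes at the limit; its derivative at the limit,
applied to the error, differs from its value by a quadratic term, which is absorbed because the
error tends to zero.\<close>

lemma error_le_mu: "e \<preceq> mu'"
proof (rule dominated_absorb[OF _ e_tendsto])
  let ?t = "\<lambda>k. norm (mu' k) + e k * norm (e k)"
  have mt: "mu' \<preceq> ?t" and ee: "(\<lambda>k. e k * e k) \<preceq> ?t"
    using e_nonneg by (auto intro!: dominated_eventually_le always_eventually)
  have ept: "eps' \<preceq> ?t" by (rule dominated_trans[OF eps'_mu' mt])
  have q2: "(\<lambda>k. F (x k) - F xs - F' xs (x k - xs)) \<preceq> ?t"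
    if "quad_rem_at F F' xs" for F :: "real^'n \<Rightarrow> 'c::real_normed_vector" and F'
    by (rule dominated_trans[OF quad_rem_sequence[OF that tendsto_const x_tendsto]
          dominated_trans[OF norm_hx_sq ee, unfolded hx_def]])
  have ggd: "(\<lambda>k. gg i (x k) - gg i xs) \<preceq> e" if "i < p" for i
    using quad_rem_diff_sequence[OF grad_ghat_quad_rem[OF that] x_tendsto] hx_e
    unfolding hx_def[abs_def] by (rule dominated_trans)
  have stat: "(\<lambda>k. lin_stat (hx k) (\<lambda>i. hy i k) (hV k)) \<preceq> ?t"
    unfolding lin_stat_h
  proof (rule dominated_diff[OF dominated_diff[OF dominated_diff[OF dominated_diff]]];
      (rule dominated_sum)?; (rule dominated_const_scaleR)?)
    show "(\<lambda>k. gf (x k) + (\<Sum>i<p. y k i *\<^sub>R gg i (x k)) - Fadj P (V k)) \<preceq> ?t"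
      by (rule dominated_trans[OF res_stat_dom ept])
    show "(\<lambda>k. gf (x k) - gf xs - Hf xs *v (x k - xs)) \<preceq> ?t"
      by (rule q2[OF grad_obj_quad_rem[OF obj_C3]])
    show "(\<lambda>k. gg i (x k) - gg i xs - Hg i xs *v (x k - xs)) \<preceq> ?t" if "i \<in> I" for i
      by (rule q2[OF grad_ghat_quad_rem[OF I_lt[OF that]]])
    show "(\<lambda>k. hy i k *\<^sub>R (gg i (x k) - gg i xs)) \<preceq> ?t" if "i \<in> I" for i
      by (rule dominated_bilinear_trans[OF bounded_bilinear_scaleR hy_e[OF I_lt[OF that]] ggd[OF I_lt[OF that]] ee])
    show "(\<lambda>k. y k i *\<^sub>R gg i (x k)) \<preceq> ?t" if "i \<in> {..<p} - I" for i
      by (rule dominated_bilinear_trans[OF bounded_bilinear_scaleR inactive_multiplier_dom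
            dominated_tendsto_one[OF gg_tendsto]]) (use that ept in auto)
  qed
  have act: "(\<lambda>k. gg i xs \<bullet> hx k) \<preceq> ?t" if i: "i \<in> I" for i
  proof -
    have "(\<lambda>k. gh i (x k) - (gh i (x k) - gh i xs - gg i xs \<bullet> (x k - xs))) \<preceq> ?t"
      by (rule dominated_diff[OF dominated_trans[OF active_constraint_dom[OF i] ept] q2[OF ghat_quad_rem[OF I_lt[OF i]]]])
    then show ?thesis using active_xs[OF i] by (simp add: hx_def)
  qed
  have cd: "(\<lambda>k. mu' k *\<^sub>R (mat 1 :: 'm sqmat)) \<preceq> ?t"
    by (rule dominated_trans[OF dominated_bounded_linear[OF bounded_linear_scaleR_left dominated_refl] mt])
  have compl: "(\<lambda>k. lin_compl (hx k) (hV k)) \<preceq> ?t"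
    unfolding lin_compl_h
    by (rule dominated_diff[OF dominated_add[OF dominated_trans[OF res_sdp_dom ept] cd]
        dominated_bilinear_trans[OF bounded_bilinear_jprod
          dominated_bounded_linear[OF bounded_linear_Flin hx_e] hV_e ee]])
  note b = sequence_error_bound[OF sym_hV stat act compl]
  show "e \<preceq> ?t"
  proof (rule e_dominatedI)
    show "hx \<preceq> ?t" by (rule b(1))
    show "hV \<preceq> ?t" by (rule b(2))
    show "hy i \<preceq> ?t" if "i < p" for i
    proof (cases "i \<in> I")
      case True
      show ?thesis by (rule b(3)[OF _ True])
    next
      case False
      then have "hy i = (\<lambda>k. y k i)" using that by (simp add: hy_def ys_inactive fun_eq_iff)
      then show ?thesis using dominated_trans[OF inactive_multiplier_dom[OF that False] ept] by simp
    qed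
  qed
qed

text \<open>At the iterate \<open>jprod F V\<close> is nearly \<open>mu'\<close> times the identity, at the limit it is zero, and it is
locally Lipschitz.\<close>

lemma mu_le_error: "mu' \<preceq> (\<lambda>k. norm (hx k) + norm (hV k))"
proof (rule dominated_absorb[OF _ a_tendsto])
  let ?h = "\<lambda>k. norm (hx k) + norm (hV k)"
  let ?t = "\<lambda>k. norm (?h k) + a k * norm (mu' k)"
  have ht: "hx \<preceq> ?t" "hV \<preceq> ?t"
    using mu'_pos by (auto intro!: dominated_eventually_le always_eventually simp: less_imp_le)
  have "eps' \<preceq> (\<lambda>k. a k * mu' k)" unfolding a_mu' by (rule eps'_B)
  also have "(\<lambda>k. a k * mu' k) \<preceq> ?t"
    using mu'_pos by (auto intro!: dominated_eventually_le always_eventually simp: less_imp_le)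
  finally (dominated_trans) have ept: "eps' \<preceq> ?t" .
  have eq: "mu' k *\<^sub>R mat 1 = jprod (Fmat P xs) (hV k) + jprod (Flin P (hx k)) (V k)
      - (jprod (Fmat P (x k)) (V k) - mu' k *\<^sub>R mat 1)" for k
    by (simp add: Flin_hx hV_def jprod.diff_left jprod.diff_right compl_xs)
  have "(\<lambda>k. mu' k *\<^sub>R (mat 1 :: 'm sqmat)) \<preceq> ?t"
  proof (rule dominated_cong[OF always_eventually[OF allI[OF eq]] dominated_diff[OF dominated_add]])
    show "(\<lambda>k. jprod (Fmat P xs) (hV k)) \<preceq> ?t"
      by (rule dominated_bounded_linear[OF jprod.bounded_linear_right ht(2)])
    have "(\<lambda>k. jprod (Flin P (hx k)) (V k)) \<preceq> (\<lambda>k. norm (hx k) * 1)"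
      by (rule dominated_bilinear[OF bounded_bilinear_jprod _ dominated_tendsto_one[OF V_tendsto]])
        (simp add: dominated_norm_right dominated_bounded_linear[OF bounded_linear_Flin dominated_refl])
    then show "(\<lambda>k. jprod (Flin P (hx k)) (V k)) \<preceq> ?t"
      using dominated_trans[OF _ ht(1)] by (simp add: dominated_norm_right)
    show "(\<lambda>k. jprod (Fmat P (x k)) (V k) - mu' k *\<^sub>R mat 1) \<preceq> ?t"
      by (rule dominated_trans[OF res_sdp_dom ept])
  qed
  moreover have "mu' \<preceq> (\<lambda>k. mu' k *\<^sub>R (mat 1 :: 'm sqmat))"
  proof (rule dominatedI[of _ "1 / norm (mat 1 :: 'm sqmat)"], rule always_eventually, rule allI)
    have "(mat 1 :: 'm sqmat) \<noteq> 0" by (auto simp: mat_def vec_eq_iff)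
    then show "norm (mu' k) \<le> 1 / norm (mat 1 :: 'm sqmat) * norm (mu' k *\<^sub>R (mat 1 :: 'm sqmat))" for k
      by simp
  qed
  ultimately show "mu' \<preceq> ?t" by (rule dominated_trans[rotated])
qed


text \<open>The commutator bound contributes \<open>eps'\<close>, of order \<open>mu'\<close> to the power \<open>1 + al\<close>, and the least
eigenvalue of \<open>F\<close> is at least of order \<open>mu'\<close>.\<close>

lemma scal_err_dom: "scal_err \<preceq> (\<lambda>k. a k * norm (dx k))"
proof -
  obtain C where C: "0 < C"
   "\<And>F V Z l mu. F \<in> pd \<Longrightarrow> V \<in> sym_mat \<Longrightarrow> Z \<in> sym_mat \<Longrightarrow>
     0 < l \<Longrightarrow> (\<And>v. l * (v \<bullet> v) \<le> v \<bullet> (F *v v)) \<Longrightarrow>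
     norm (scaled_op F V Z - jprod V (Z::'m sqmat))
      \<le> C * norm (jprod F V - mu *\<^sub>R mat 1) * norm Z / l"
    using scaled_op_error by metis
  obtain K where K: "0 < K" "\<And>h. norm (Flin P h) \<le> norm h * K"
    using bounded_linear.pos_bounded[OF bounded_linear_Flin] by metis
  define KV where "KV = norm Vs + 1"
  have KV: "0 < KV" by (simp add: KV_def add_nonneg_pos)
  have evV: "\<forall>\<^sub>F k in sequentially. norm (V k) < KV"
    by (rule order_tendstoD(2)[OF tendsto_norm[OF V_tendsto]]) (simp add: KV_def)
  have "\<forall>\<^sub>F k in sequentially. a k < 1 / (2 * g1)"
    by (rule order_tendstoD(2)[OF a_tendsto]) (use g1 in simp)
  with F_pd V_pd evV res_sdp
  have "\<forall>\<^sub>F k in sequentially. norm (scal_err k) \<le> (C * g1 * K * (2 * KV)) * norm (a k * norm (dx k))"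
  proof eventually_elim
    case (elim k)
    have eps: "eps' k = g1 * (mu' k * a k)" by (simp add: eps'_eq mu'_a)
    have "eps' k \<le> mu' k / 2"
    proof -
      have "g1 * a k \<le> 1 / 2" using elim(5) g1 by (simp add: field_simps)
      then have "mu' k * (g1 * a k) \<le> mu' k * (1 / 2)" using mu'_pos[of k] by (intro mult_left_mono) auto
      then show ?thesis by (simp add: eps mult_ac)
    qed
    then have small: "norm (jprod (Fmat P (x k)) (V k) - mu' k *\<^sub>R mat 1) \<le> mu' k / 2"
      using elim(4) by linarith
    have lb: "mu' k / (2 * KV) * (v \<bullet> v) \<le> v \<bullet> (Fmat P (x k) *v v)" for v
      by (rule pd_lower_bound_from_jprod[OF elim(1,2) less_imp_le[OF elim(3)] KV small])
    have lpos: "0 < mu' k / (2 * KV)" using mu'_pos[of k] KV by simp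
    have "norm (scal_err k) \<le> C * norm (jprod (Fmat P (x k)) (V k) - mu' k *\<^sub>R mat 1) * norm (Flin P (dx k)) / (mu' k / (2 * KV))"
      unfolding scal_err_def by (rule C(2)[OF elim(1) pd_sym[OF elim(2)] Flin_sym lpos lb])
    also have "\<dots> \<le> C * eps' k * (norm (dx k) * K) / (mu' k / (2 * KV))"
      using C(1) K elim(4) lpos by (intro divide_right_mono mult_mono mult_left_mono) (auto simp: eps'_nonneg)
    also have "\<dots> = (C * g1 * K * (2 * KV)) * (a k * norm (dx k))"
      using mu'_pos[of k] KV by (simp add: eps field_simps)
    finally show ?case by simp
  qed
  then show ?thesis by (rule dominatedI)
qed


lemma dx_eq: "dx k = vx k - hx k" by (simp add: vx_def hx_def)

lemma dx_dom: "dx \<preceq> (\<lambda>k. n k + e k)"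
proof -
  have "n \<preceq> (\<lambda>k. n k + e k)" "e \<preceq> (\<lambda>k. n k + e k)"
    using e_nonneg n_nonneg by (auto intro!: dominated_eventually_le always_eventually)
  then show ?thesis
    by (intro dominated_cong[OF always_eventually[OF allI[OF dx_eq]]] dominated_diff
        dominated_trans[OF vx_n] dominated_trans[OF hx_e])
qed

lemma step_stat_I: "\<forall>\<^sub>F k in sequentially. Fadj P (V k + dV k) = gf (x k)
   + Hf (x k) *v dx k + (\<Sum>i\<in>I. ys i *\<^sub>R (Hg i (x k) *v dx k))
   + (\<Sum>i<p. hy i k *\<^sub>R (Hg i (x k) *v dx k))
   + (\<Sum>i\<in>I. (ys i + vy i k) *\<^sub>R gg i (x k))"
  using step_stat step_inactive
proof eventually_elim
  case (elim k)
  have "(\<Sum>i<p. (y k i + dy k i) *\<^sub>R gg i (x k)) = (\<Sum>i\<in>I. (ys i + vy i k) *\<^sub>R gg i (x k))"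
    using elim(2) by (subst sum_I) (auto simp: vy_def)
  moreover have "(\<Sum>i<p. y k i *\<^sub>R (Hg i (x k) *v dx k)) =
      (\<Sum>i\<in>I. ys i *\<^sub>R (Hg i (x k) *v dx k)) + (\<Sum>i<p. hy i k *\<^sub>R (Hg i (x k) *v dx k))"
  proof -
    have "(\<Sum>i\<in>I. ys i *\<^sub>R (Hg i (x k) *v dx k)) = (\<Sum>i<p. ys i *\<^sub>R (Hg i (x k) *v dx k))"
      by (rule sum_I[symmetric]) (simp add: ys_inactive)
    then show ?thesis by (simp add: hy_def scaleR_diff_left sum_subtractf)
  qed
  ultimately show ?case using elim(1) by (simp add: algebra_simps)
qed

text \<open>The linearized equation is subtracted from the KKT condition at the limit. Since \<open>dx = vx - hx\<close>,
there remain differences of derivatives applied to \<open>vx\<close>, and remainders of expansions at the iterate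
that are evaluated at the limit.\<close>

lemma lin_stat_v: "\<forall>\<^sub>F k in sequentially. lin_stat (vx k) (\<lambda>i. vy i k) (vV k) =
     - (Hf (x k) *v vx k - Hf xs *v vx k)
     - (\<Sum>i\<in>I. ys i *\<^sub>R (Hg i (x k) *v vx k - Hg i xs *v vx k))
     - (\<Sum>i\<in>I. vy i k *\<^sub>R (gg i (x k) - gg i xs))
     + (gf xs - gf (x k) - Hf (x k) *v (xs - x k))
     + (\<Sum>i\<in>I. ys i *\<^sub>R (gg i xs - gg i (x k) - Hg i (x k) *v (xs - x k)))
     - (\<Sum>i<p. hy i k *\<^sub>R (Hg i (x k) *v dx k))"
  using step_stat_I
proof eventually_elim
  case (elim k)
  have d: "dx k = vx k + (xs - x k)" by (simp add: vx_def)
  have mv: "A *v dx k = A *v vx k + A *v (xs - x k)" for A :: "((real, 'n) vec, 'n) vec"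
    by (subst d) (rule matrix_vector_right_distrib)
  have "Fadj P (vV k) = Fadj P (V k + dV k) - Fadj P Vs" by (simp add: vV_def Fadj_diff)
  moreover have "(\<Sum>i\<in>I. ys i *\<^sub>R (Hg i (x k) *v dx k))
      = (\<Sum>i\<in>I. ys i *\<^sub>R (Hg i (x k) *v vx k)) + (\<Sum>i\<in>I. ys i *\<^sub>R (Hg i (x k) *v (xs - x k)))"
    unfolding mv scaleR_add_right sum.distrib ..
  moreover have "(\<Sum>i\<in>I. ys i *\<^sub>R (Hg i (x k) *v vx k - Hg i xs *v vx k))
      = (\<Sum>i\<in>I. ys i *\<^sub>R (Hg i (x k) *v vx k)) - (\<Sum>i\<in>I. ys i *\<^sub>R (Hg i xs *v vx k))"
    unfolding scaleR_diff_right sum_subtractf ..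
  moreover have "(\<Sum>i\<in>I. vy i k *\<^sub>R (gg i (x k) - gg i xs))
      = (\<Sum>i\<in>I. vy i k *\<^sub>R gg i (x k)) - (\<Sum>i\<in>I. vy i k *\<^sub>R gg i xs)"
    unfolding scaleR_diff_right sum_subtractf ..
  moreover have "(\<Sum>i\<in>I. ys i *\<^sub>R (gg i xs - gg i (x k) - Hg i (x k) *v (xs - x k)))
      = (\<Sum>i\<in>I. ys i *\<^sub>R gg i xs) - (\<Sum>i\<in>I. ys i *\<^sub>R gg i (x k))
        - (\<Sum>i\<in>I. ys i *\<^sub>R (Hg i (x k) *v (xs - x k)))"
    unfolding scaleR_diff_right sum_subtractf ..
  moreover have "(\<Sum>i\<in>I. (ys i + vy i k) *\<^sub>R gg i (x k))
      = (\<Sum>i\<in>I. ys i *\<^sub>R gg i (x k)) + (\<Sum>i\<in>I. vy i k *\<^sub>R gg i (x k))"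
    unfolding scaleR_add_left sum.distrib ..
  moreover note elim mv[of "Hf (x k)"] stationarity_xs
  ultimately show ?case unfolding lin_stat_def by simp
qed

lemma lin_compl_v: "\<forall>\<^sub>F k in sequentially. lin_compl (vx k) (vV k) =
   mu k *\<^sub>R mat 1 - scal_err k - jprod (Flin P (hx k)) (vV k) - jprod (Flin P (vx k)) (hV k)
     + jprod (Flin P (hx k)) (hV k)"
  using step_sdp
proof eventually_elim
  case (elim k)
  have Fd: "Flin P (dx k) = Flin P (vx k) - Flin P (hx k)"
    by (simp add: dx_eq linear_diff[OF Flin_linear])
  have Fx: "Fmat P (x k) = Fmat P xs + Flin P (hx k)" by (simp add: Flin_hx)
  have VdV: "V k + dV k = Vs + vV k" and Vk: "V k = Vs + hV k" by (simp_all add: vV_def hV_def)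
  have "mu k *\<^sub>R mat 1 - scal_err k = jprod (Fmat P (x k)) (V k + dV k) + jprod (V k) (Flin P (dx k))"
    unfolding scal_err_def using elim by (simp add: algebra_simps)
  then show ?case
    unfolding VdV Fx Fd lin_compl_def
    unfolding Vk by (simp add: jprod.add_left jprod.add_right jprod.diff_left jprod.diff_right compl_xs
        jprod_commute[of Vs] jprod_commute[of "hV k"] algebra_simps)
qed

text \<open>The linearization at the limit, applied to the new error, is of order
\<open>mu + e\<^sup>2 + (mu' powr al) * (e + n) + e * n\<close>. The part proportional to \<open>n\<close> is absorbed, and since \<open>e\<close> is of order
\<open>mu'\<close> the remaining part is of order \<open>mu\<close>, that is, of \<open>mu'\<close> to the power \<open>1 + c * al\<close>.\<close>

lemma new_error_le: "n \<preceq> M"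
proof (rule dominated_absorb)
  show q0: "(\<lambda>k. a k + e k) \<longlonglongrightarrow> 0" using tendsto_add[OF a_tendsto e_tendsto] by simp
  let ?t = "\<lambda>k. norm (M k) + (a k + e k) * norm (n k)"
  have le: "\<And>f. (\<And>k. \<bar>f k :: real\<bar> \<le> ?t k) \<Longrightarrow> f \<preceq> ?t"
    by (intro dominated_eventually_le always_eventually allI) (simp, meson abs_ge_self order_trans)
  have an0: "0 \<le> a k * n k" "0 \<le> e k * n k" for k using e_nonneg n_nonneg by auto
  have t_eq: "?t k = M k + a k * n k + e k * n k" for k using n_nonneg by (simp add: distrib_right)
  have Mt: "M \<preceq> ?t" and en: "(\<lambda>k. e k * n k) \<preceq> ?t" and an: "(\<lambda>k. a k * n k) \<preceq> ?t"
  proof -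
    have b: "\<bar>M k\<bar> \<le> ?t k" "\<bar>e k * n k\<bar> \<le> ?t k" "\<bar>a k * n k\<bar> \<le> ?t k" for k
      unfolding t_eq using an0[of k] powr_ge_zero[of "mu' k" "1 + c * al"] by linarith+
    show "M \<preceq> ?t" by (rule le[OF b(1)])
    show "(\<lambda>k. e k * n k) \<preceq> ?t" by (rule le[OF b(2)])
    show "(\<lambda>k. a k * n k) \<preceq> ?t" by (rule le[OF b(3)])
  qed
  have ea: "e \<preceq> a" by (rule dominated_trans[OF error_le_mu mu'_a_dom])
  have Bt: "B \<preceq> ?t" by (rule dominated_trans[OF B_M Mt])
  have ee: "(\<lambda>k. e k * e k) \<preceq> ?t"
    by (rule dominated_bilinear_trans[OF bounded_bilinear_mult ea error_le_mu]) (unfold a_mu', rule Bt)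
  have ae: "(\<lambda>k. a k * e k) \<preceq> ?t"
    by (rule dominated_bilinear_trans[OF bounded_bilinear_mult dominated_refl error_le_mu]) (unfold a_mu', rule Bt)
  have edx: "(\<lambda>k. e k * (n k + e k)) \<preceq> ?t" and adx: "(\<lambda>k. a k * (n k + e k)) \<preceq> ?t"
    unfolding distrib_left by (intro dominated_add en ee an ae)+
  have q2: "(\<lambda>k. F xs - F (x k) - F' (x k) (xs - x k)) \<preceq> ?t"
    if "quad_rem_at F F' xs" for F :: "real^'n \<Rightarrow> 'c::real_normed_vector" and F'
  proof -
    have "(\<lambda>k. (norm (xs - x k))\<^sup>2) \<preceq> ?t"
      using dominated_trans[OF norm_hx_sq ee] by (simp add: hx_def norm_minus_commute)
    then show ?thesis by (rule dominated_trans[OF quad_rem_sequence[OF that x_tendsto tendsto_const]])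
  qed
  have qd: "(\<lambda>k. F' (x k) (vx k) - F' xs (vx k)) \<preceq> ?t"
    if "quad_rem_at F F' xs" for F :: "real^'n \<Rightarrow> 'c::real_normed_vector" and F'
  proof -
    have "(\<lambda>k. norm (x k - xs) * norm (vx k)) \<preceq> ?t"
      using dominated_bilinear_trans[OF bounded_bilinear_mult _ _ en, of "\<lambda>k. norm (hx k)" "\<lambda>k. norm (vx k)"]
      by (simp add: dominated_norm_left hx_e vx_n) (simp add: hx_def)
    then show ?thesis by (rule dominated_trans[OF quad_rem_derivative_diff_sequence[OF that x_tendsto]])
  qed
  have ggd: "(\<lambda>k. gg i (x k) - gg i xs) \<preceq> e" if "i < p" for i
    using quad_rem_diff_sequence[OF grad_ghat_quad_rem[OF that] x_tendsto] hx_e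
    unfolding hx_def[abs_def] by (rule dominated_trans)
  note qo = grad_obj_quad_rem[OF obj_C3, of xs]
  note qg = grad_ghat_quad_rem[OF I_lt]
  have s1: "(\<lambda>k. - (Hf (x k) *v vx k - Hf xs *v vx k)) \<preceq> ?t"
    by (rule dominated_uminus[OF qd[OF qo]])
  have s2: "(\<lambda>k. \<Sum>i\<in>I. ys i *\<^sub>R (Hg i (x k) *v vx k - Hg i xs *v vx k)) \<preceq> ?t"
    by (rule dominated_sum, rule dominated_const_scaleR, rule qd[OF qg])
  have s3: "(\<lambda>k. \<Sum>i\<in>I. vy i k *\<^sub>R (gg i (x k) - gg i xs)) \<preceq> ?t"
    by (rule dominated_sum, rule dominated_bilinear_trans[OF bounded_bilinear_scaleR vy_n[OF I_lt] ggd[OF I_lt]])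
      (use en in \<open>simp_all add: mult.commute\<close>)
  have s4: "(\<lambda>k. gf xs - gf (x k) - Hf (x k) *v (xs - x k)) \<preceq> ?t"
    by (rule q2[OF qo])
  have s5: "(\<lambda>k. \<Sum>i\<in>I. ys i *\<^sub>R (gg i xs - gg i (x k) - Hg i (x k) *v (xs - x k))) \<preceq> ?t"
    by (rule dominated_sum, rule dominated_const_scaleR, rule q2[OF qg])
  have s6: "(\<lambda>k. \<Sum>i<p. hy i k *\<^sub>R (Hg i (x k) *v dx k)) \<preceq> ?t"
  proof (rule dominated_sum)
    fix i assume "i \<in> {..<p}"
    then have i: "i < p" by simp
    show "(\<lambda>k. hy i k *\<^sub>R (Hg i (x k) *v dx k)) \<preceq> ?t"
      by (rule dominated_bilinear_trans[OF bounded_bilinear_scaleR hy_e[OF i]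
            dominated_trans[OF quad_rem_derivative_sequence[OF grad_ghat_quad_rem[OF i] x_tendsto] dx_dom] edx])
  qed
  have stat: "(\<lambda>k. lin_stat (vx k) (\<lambda>i. vy i k) (vV k)) \<preceq> ?t"
    by (rule dominated_cong[OF lin_stat_v dominated_diff[OF dominated_add[OF dominated_add[OF
       dominated_diff[OF dominated_diff[OF s1 s2] s3] s4] s5] s6]])
  have act: "(\<lambda>k. gg i xs \<bullet> vx k) \<preceq> ?t" if i: "i \<in> I" for i
  proof -
    have "\<forall>\<^sub>F k in sequentially. gg i xs \<bullet> vx k =
      (gh i xs - gh i (x k) - gg i (x k) \<bullet> (xs - x k)) - (gg i (x k) - gg i xs) \<bullet> vx k"
      using step_active
    proof eventually_elim
      case (elim k)
      then have "gh i (x k) + gg i (x k) \<bullet> (vx k - hx k) = 0" using i by (simp add: dx_eq)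
      then show ?case using active_xs[OF i]
        by (simp add: hx_def inner_diff_left inner_diff_right)
    qed
    then show ?thesis
    proof (rule dominated_cong[OF _ dominated_diff])
      show "(\<lambda>k. gh i xs - gh i (x k) - gg i (x k) \<bullet> (xs - x k)) \<preceq> ?t"
        by (rule q2[OF ghat_quad_rem[OF I_lt[OF i]]])
      show "(\<lambda>k. (gg i (x k) - gg i xs) \<bullet> vx k) \<preceq> ?t"
        by (rule dominated_bilinear_trans[OF bounded_bilinear_inner ggd[OF I_lt[OF i]] vx_n en])
    qed
  qed
  have c1: "(\<lambda>k. mu k *\<^sub>R (mat 1 :: 'm sqmat)) \<preceq> ?t"
    by (rule dominated_trans[OF dominated_bounded_linear[OF bounded_linear_scaleR_left mu_M] Mt])
  have c2: "scal_err \<preceq> ?t"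
  proof (rule dominated_trans[OF scal_err_dom])
    show "(\<lambda>k. a k * norm (dx k)) \<preceq> ?t"
      by (rule dominated_bilinear_trans[OF bounded_bilinear_mult dominated_refl _ adx])
        (simp add: dominated_norm_left dx_dom)
  qed
  note FL = dominated_bounded_linear[OF bounded_linear_Flin]
  have c3: "(\<lambda>k. jprod (Flin P (hx k)) (vV k)) \<preceq> ?t"
    by (rule dominated_bilinear_trans[OF bounded_bilinear_jprod FL[OF hx_e] vV_n en])
  have c4: "(\<lambda>k. jprod (Flin P (vx k)) (hV k)) \<preceq> ?t"
    by (rule dominated_bilinear_trans[OF bounded_bilinear_jprod FL[OF vx_n] hV_e])
      (use en in \<open>simp add: mult.commute\<close>)
  have c5: "(\<lambda>k. jprod (Flin P (hx k)) (hV k)) \<preceq> ?t"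
    by (rule dominated_bilinear_trans[OF bounded_bilinear_jprod FL[OF hx_e] hV_e ee])
  have compl: "(\<lambda>k. lin_compl (vx k) (vV k)) \<preceq> ?t"
    by (rule dominated_cong[OF lin_compl_v dominated_add[OF dominated_diff[OF dominated_diff[OF
       dominated_diff[OF c1 c2] c3] c4] c5]])
  note b = sequence_error_bound[OF sym_vV stat act compl]
  show "n \<preceq> ?t"
  proof (rule n_dominatedI)
    show "vx \<preceq> ?t" by (rule b(1))
    show "vV \<preceq> ?t" by (rule b(2))
    show "vy i \<preceq> ?t" if i: "i < p" for i
    proof (cases "i \<in> I")
      case True
      show ?thesis by (rule b(3)[OF _ True])
    next
      case False
      have "\<forall>\<^sub>F k in sequentially. vy i k = 0"
        using step_inactive by eventually_elim (use i False in \<open>simp add: vy_def ys_inactive\<close>)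
      then show ?thesis by (rule dominated_cong) (rule dominated_zero)
    qed
  qed
qed


section \<open>The point reached by the full step\<close>

lemma n_mu': "n \<preceq> mu'" by (rule dominated_trans[OF new_error_le M_mu'])

lemma dx_mu': "dx \<preceq> mu'"
  by (rule dominated_trans[OF dx_dom dominated_add[OF n_mu' error_le_mu]])

lemma dV_mu': "dV \<preceq> mu'"
proof (rule dominated_cong[OF always_eventually dominated_diff])
  show "\<forall>k. dV k = vV k - hV k" by (simp add: vV_def hV_def)
  show "vV \<preceq> mu'" "hV \<preceq> mu'"
    using dominated_trans[OF vV_n n_mu'] dominated_trans[OF hV_e error_le_mu] .
qed

lemma dy_mu': "i < p \<Longrightarrow> (\<lambda>k. dy k i) \<preceq> mu'"
proof (rule dominated_cong[OF always_eventually dominated_diff])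
  assume i: "i < p"
  show "\<forall>k. dy k i = vy i k - hy i k" by (simp add: vy_def hy_def)
  show "vy i \<preceq> mu'" "hy i \<preceq> mu'"
    using dominated_trans[OF vy_n[OF i] n_mu'] dominated_trans[OF hy_e[OF i] error_le_mu] .
qed

lemma x_new_tendsto: "(\<lambda>k. x k + dx k) \<longlonglongrightarrow> xs"
  using tendsto_add[OF x_tendsto dominated_tendsto_zero[OF dx_mu' mu'_tendsto]] by simp

lemma y_new_tendsto: "i < p \<Longrightarrow> (\<lambda>k. y k i + dy k i) \<longlonglongrightarrow> ys i"
  using tendsto_add[OF y_tendsto dominated_tendsto_zero[OF dy_mu' mu'_tendsto]] by simp

lemma V_new_tendsto: "(\<lambda>k. V k + dV k) \<longlonglongrightarrow> Vs"
  using tendsto_add[OF V_tendsto dominated_tendsto_zero[OF dV_mu' mu'_tendsto]] by simp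

lemma mu'_sq: "(\<lambda>k. mu' k * mu' k) \<preceq> B"
  by (rule dominated_bilinear_trans[OF bounded_bilinear_mult mu'_a_dom dominated_refl])
    (unfold a_mu', rule dominated_refl)

lemma remainder_B:
  fixes F :: "real^'n \<Rightarrow> 'c::real_normed_vector"
  assumes "quad_rem_at F F' xs"
  shows "(\<lambda>k. F (x k + dx k) - F (x k) - F' (x k) (dx k)) \<preceq> B"
proof -
  have "(\<lambda>k. F (x k + dx k) - F (x k) - F' (x k) (dx k)) \<preceq> (\<lambda>k. (norm (dx k))\<^sup>2)"
    using quad_rem_sequence[OF assms x_tendsto x_new_tendsto] by simp
  also have "(\<lambda>k. (norm (dx k))\<^sup>2) \<preceq> B"
    unfolding power2_eq_square
    by (rule dominated_bilinear_trans[OF bounded_bilinear_mult _ _ mu'_sq]) (simp_all add: dominated_norm_left dx_mu')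
  finally (dominated_trans) show ?thesis .
qed

text \<open>The linear equation removes the first-order terms: the rest consists of Taylor remainders and a
product of two components of the step.\<close>

lemma new_stationarity:
  "(\<lambda>k. gf (x k + dx k) + (\<Sum>i<p. (y k i + dy k i) *\<^sub>R gg i (x k + dx k))
     - Fadj P (V k + dV k)) \<preceq> B"
proof (rule dominated_cong)
  let ?A = "\<lambda>k. gf (x k + dx k) - gf (x k) - Hf (x k) *v dx k"
  let ?D = "\<lambda>k. \<Sum>i<p. (y k i + dy k i) *\<^sub>R
     (gg i (x k + dx k) - gg i (x k) - Hg i (x k) *v dx k)"
  let ?E = "\<lambda>k. \<Sum>i<p. dy k i *\<^sub>R (Hg i (x k) *v dx k)"
  show "\<forall>\<^sub>F k in sequentially. gf (x k + dx k)
     + (\<Sum>i<p. (y k i + dy k i) *\<^sub>R gg i (x k + dx k)) - Fadj P (V k + dV k) = ?A k + ?D k + ?E k"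
    using step_stat
  proof eventually_elim
    case (elim k)
    have D: "?D k = (\<Sum>i<p. (y k i + dy k i) *\<^sub>R gg i (x k + dx k))
       - (\<Sum>i<p. (y k i + dy k i) *\<^sub>R gg i (x k))
       - (\<Sum>i<p. y k i *\<^sub>R (Hg i (x k) *v dx k)) - ?E k"
      unfolding scaleR_diff_right sum_subtractf
      by (simp add: scaleR_add_left sum.distrib)
    have "Fadj P (V k + dV k) = gf (x k) + Hf (x k) *v dx k
      + (\<Sum>i<p. y k i *\<^sub>R (Hg i (x k) *v dx k))
      + (\<Sum>i<p. (y k i + dy k i) *\<^sub>R gg i (x k))" using elim by simp
    then show ?case unfolding D by simp
  qed
  have "?A \<preceq> B" by (rule remainder_B[OF grad_obj_quad_rem[OF obj_C3]])
  moreover have "?D \<preceq> B"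
  proof (rule dominated_sum)
    fix i assume "i \<in> {..<p}"
    then have i: "i < p" by simp
    show "(\<lambda>k. (y k i + dy k i) *\<^sub>R (gg i (x k + dx k) - gg i (x k) - Hg i (x k) *v dx k)) \<preceq> B"
      by (rule dominated_bilinear_trans[OF bounded_bilinear_scaleR
           dominated_tendsto_one[OF y_new_tendsto[OF i]] remainder_B[OF grad_ghat_quad_rem[OF i]]])
        (simp add: dominated_refl)
  qed
  moreover have "?E \<preceq> B"
  proof (rule dominated_sum)
    fix i assume "i \<in> {..<p}"
    then have i: "i < p" by simp
    show "(\<lambda>k. dy k i *\<^sub>R (Hg i (x k) *v dx k)) \<preceq> B"
      by (rule dominated_bilinear_trans[OF bounded_bilinear_scaleR dy_mu'[OF i]
           dominated_trans[OF quad_rem_derivative_sequence[OF grad_ghat_quad_rem[OF i] x_tendsto] dx_mu'] mu'_sq])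
  qed
  ultimately show "(\<lambda>k. ?A k + ?D k + ?E k) \<preceq> B" by (intro dominated_add)
qed

text \<open>The linearized constraint is nonpositive, so only its remainder can be positive.\<close>

lemma new_feasibility: "i < p \<Longrightarrow> (\<lambda>k. max (gh i (x k + dx k)) 0) \<preceq> B"
proof -
  assume i: "i < p"
  have "\<forall>\<^sub>F k in sequentially. norm (max (gh i (x k + dx k)) 0)
    \<le> norm (gh i (x k + dx k) - gh i (x k) - gg i (x k) \<bullet> dx k)"
    using step_sign
  proof eventually_elim
    case (elim k)
    then have "gh i (x k) + gg i (x k) \<bullet> dx k \<le> 0" using i by blast
    then show ?case by (simp add: max_def)
  qed
  then show ?thesis using remainder_B[OF ghat_quad_rem[OF i]]
    by (rule dominated_trans[OF dominated_eventually_le])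
qed

lemma new_complementarity: "(\<lambda>k. \<Sum>i<p. (y k i + dy k i) * gh i (x k + dx k)) \<preceq> B"
proof (rule dominated_cong)
  let ?r = "\<lambda>i k. gh i (x k + dx k) - gh i (x k) - gg i (x k) \<bullet> dx k"
  show "\<forall>\<^sub>F k in sequentially. (\<Sum>i<p. (y k i + dy k i) * gh i (x k + dx k)) = (\<Sum>i<p. (y k i + dy k i) * ?r i k)"
    using step_active step_inactive
  proof eventually_elim
    case (elim k)
    show ?case
    proof (rule sum.cong[OF refl])
      fix i assume i: "i \<in> {..<p}"
      show "(y k i + dy k i) * gh i (x k + dx k) = (y k i + dy k i) * ?r i k"
      proof (cases "i \<in> I")
        case True
        then have "gh i (x k) + gg i (x k) \<bullet> dx k = 0" using elim(1) by blast
        then have "?r i k = gh i (x k + dx k)" by linarith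
        then show ?thesis by simp
      next
        case False
        then have "y k i + dy k i = 0" using elim(2) i by blast
        then show ?thesis by simp
      qed
    qed
  qed
  show "(\<lambda>k. \<Sum>i<p. (y k i + dy k i) * ?r i k) \<preceq> B"
  proof (rule dominated_sum)
    fix i assume "i \<in> {..<p}"
    then have i: "i < p" by simp
    show "(\<lambda>k. (y k i + dy k i) * ?r i k) \<preceq> B"
      by (rule dominated_bilinear_trans[OF bounded_bilinear_mult
           dominated_tendsto_one[OF y_new_tendsto[OF i]] remainder_B[OF ghat_quad_rem[OF i]]])
        (simp add: dominated_refl)
  qed
qed

text \<open>What the linear equation leaves is the product of the two matrix components of the step and the
scaling error.\<close>

lemma new_sdp: "(\<lambda>k. jprod (Fmat P (x k + dx k)) (V k + dV k) - mu k *\<^sub>R mat 1) \<preceq> B"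
proof (rule dominated_cong)
  show "\<forall>\<^sub>F k in sequentially. jprod (Fmat P (x k + dx k)) (V k + dV k) - mu k *\<^sub>R mat 1
      = jprod (Flin P (dx k)) (dV k) - scal_err k"
    using step_sdp
  proof eventually_elim
    case (elim k)
    have "mu k *\<^sub>R mat 1 - scal_err k = jprod (Fmat P (x k)) (V k + dV k) + jprod (Flin P (dx k)) (V k)"
      unfolding scal_err_def jprod_commute[of "Flin P (dx k)"] using elim by (simp add: algebra_simps)
    moreover have "jprod (Fmat P (x k + dx k)) (V k + dV k)
        = jprod (Fmat P (x k)) (V k + dV k) + jprod (Flin P (dx k)) (V k) + jprod (Flin P (dx k)) (dV k)"
      by (simp add: Fmat_add jprod.add_left jprod.add_right)
    ultimately show ?case by (simp add: algebra_simps)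
  qed
  have "(\<lambda>k. a k * norm (dx k)) \<preceq> B"
    by (rule dominated_bilinear_trans[OF bounded_bilinear_mult dominated_refl, where b=mu'])
      (unfold a_mu', simp_all add: dominated_norm_left dx_mu' dominated_refl)
  then have "scal_err \<preceq> B" by (rule dominated_trans[OF scal_err_dom])
  moreover have "(\<lambda>k. jprod (Flin P (dx k)) (dV k)) \<preceq> B"
    by (rule dominated_bilinear_trans[OF bounded_bilinear_jprod
         dominated_bounded_linear[OF bounded_linear_Flin dx_mu'] dV_mu' mu'_sq])
  ultimately show "(\<lambda>k. jprod (Flin P (dx k)) (dV k) - scal_err k) \<preceq> B" by (intro dominated_diff)
qed

lemma eventually_le_smaller_power:
  assumes f: "f \<preceq> B" and r: "r < 1 + al" and K: "0 < K"
  shows "\<forall>\<^sub>F k in sequentially. norm (f k) \<le> K * mu' k powr r"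
proof -
  obtain C where C: "0 < C" "\<forall>\<^sub>F k in sequentially. norm (f k) \<le> C * norm (B k)"
    by (rule dominatedE[OF f])
  have "(\<lambda>k. mu' k powr (1 + al - r)) \<longlonglongrightarrow> 0"
    using tendsto_powr'[OF mu'_tendsto tendsto_const[of "1 + al - r"]] r mu'_pos
    by (simp add: less_imp_le)
  then have "\<forall>\<^sub>F k in sequentially. mu' k powr (1 + al - r) < K / C"
    by (rule order_tendstoD) (use K C in simp)
  with C(2) show ?thesis
  proof eventually_elim
    case (elim k)
    have "C * mu' k powr (1 + al - r) \<le> K" using elim(2) C(1) by (simp add: field_simps)
    then have "C * mu' k powr (1 + al - r) * mu' k powr r \<le> K * mu' k powr r"
      by (intro mult_right_mono) auto
    moreover have "mu' k powr (1 + al - r) * mu' k powr r = B k"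
      by (simp add: powr_add[symmetric])
    ultimately show ?case using elim(1) by (simp add: mult.assoc)
  qed
qed

text \<open>The product \<open>jprod F V\<close> at the new point is \<open>mu\<close> times the identity up to an error that is small
compared with \<open>mu\<close>, since \<open>c < 1\<close>; the sum \<open>F + V\<close> is close to its positive definite limit.\<close>

lemma new_pd: "\<forall>\<^sub>F k in sequentially. Fmat P (x k + dx k) \<in> pd \<and> V k + dV k \<in> pd"
proof -
  have "1 + c * al < 1 + al" using c al by simp
  then have e1: "\<forall>\<^sub>F k in sequentially. norm (jprod (Fmat P (x k + dx k)) (V k + dV k) - mu k *\<^sub>R mat 1)
      \<le> g2 / 2 * mu' k powr (1 + c * al)"
    using g2 by (intro eventually_le_smaller_power[OF new_sdp]) auto
  obtain r where r: "0 < r" "\<And>Y. Y \<in> sym_mat \<Longrightarrow> norm (Y - (Fmat P xs + Vs)) < r \<Longrightarrow> Y \<in> pd"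
    using pd_perturbation[OF strict_xs] by metis
  have "(\<lambda>k. Fmat P (x k + dx k) + (V k + dV k)) \<longlonglongrightarrow> Fmat P xs + Vs"
    unfolding Fmat_def
    by (intro tendsto_intros bounded_linear.tendsto[OF bounded_linear_Flin x_new_tendsto] V_new_tendsto)
  from tendstoD[OF this r(1)]
  have e2: "\<forall>\<^sub>F k in sequentially. norm (Fmat P (x k + dx k) + (V k + dV k) - (Fmat P xs + Vs)) < r"
    by (simp add: dist_norm)
  show ?thesis using e1 e2 mu_eq V_pd step_sym
  proof eventually_elim
    case (elim k)
    have Fs: "Fmat P (x k + dx k) \<in> sym_mat" by (rule Fmat_sym)
    have Vss: "V k + dV k \<in> sym_mat" by (intro sym_mat_add pd_sym elim)
    have mp: "0 < mu k" using elim(3) g2 mu'_pos[of k] by simp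
    have J: "jprod (Fmat P (x k + dx k)) (V k + dV k) \<in> pd"
      by (rule pd_if_near_scaled_identity[OF jprod_sym[OF Fs Vss] mp]) (use elim(1,3) in simp)
    have S: "Fmat P (x k + dx k) + (V k + dV k) \<in> pd"
      by (rule r(2)[OF sym_mat_add[OF Fs Vss] elim(2)])
    show ?case
      using pd_if_jprod_and_sum_pd[OF Fs J S] pd_if_jprod_and_sum_pd[OF Vss, of "Fmat P (x k + dx k)"] J S
      by (simp add: jprod_commute add.commute)
  qed
qed

text \<open>Order \<open>mu\<close> is order \<open>1 + c * al\<close> in the error of the iterate, because that error is not smaller
than a multiple of \<open>mu'\<close>.\<close>

lemma new_distance: "n \<preceq> (\<lambda>k. (norm (hx k) + norm (hV k)) powr (1 + c * al))"
  using c al mu'_pos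
  by (intro dominated_trans[OF new_error_le dominated_powr[OF mu_le_error]]) (auto simp: less_imp_le)

end

section \<open>Barrier parameters and iterates\<close>

lemma mu_seq_pos: "valid_params A \<Longrightarrow> 0 < mu_seq A k"
  by (induction k) (auto simp: valid_params_def)

lemma mu_seq_le_geometric:
  assumes "valid_params A"
  shows "mu_seq A k \<le> mu_init A * beta A ^ k"
proof (induction k)
  case (Suc k)
  have "mu_seq A (Suc k) \<le> beta A * mu_seq A k" by simp
  also have "\<dots> \<le> beta A * (mu_init A * beta A ^ k)"
    using Suc assms by (intro mult_left_mono) (auto simp: valid_params_def)
  finally show ?case by (simp add: mult_ac)
qed simp

lemma mu_seq_tendsto:
  assumes "valid_params A"
  shows "mu_seq A \<longlonglongrightarrow> 0"
proof (rule tendsto_sandwich[OF _ _ tendsto_const])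
  show "\<forall>\<^sub>F k in sequentially. 0 \<le> mu_seq A k"
    using mu_seq_pos[OF assms] by (auto intro!: always_eventually less_imp_le)
  show "\<forall>\<^sub>F k in sequentially. mu_seq A k \<le> mu_init A * beta A ^ k"
    using mu_seq_le_geometric[OF assms] by (auto intro!: always_eventually)
  have "(\<lambda>k. beta A ^ k) \<longlonglongrightarrow> 0"
    using assms by (intro LIMSEQ_realpow_zero) (auto simp: valid_params_def)
  from tendsto_mult_left[OF this, of "mu_init A"]
  show "(\<lambda>k. mu_init A * beta A ^ k) \<longlonglongrightarrow> 0" by simp
qed

text \<open>The superlinear term wins as soon as \<open>mu\<close> is small.\<close>

lemma mu_seq_Suc_eventually:
  assumes A: "valid_params A"
  shows "\<forall>\<^sub>F k in sequentially. mu_seq A (Suc k) = gamma2 A * mu_seq A k powr (1 + cexp A * alpha A)"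
proof -
  have pos: "0 < cexp A * alpha A" "0 < gamma2 A" "0 < beta A" using A by (auto simp: valid_params_def)
  have "(\<lambda>k. mu_seq A k powr (cexp A * alpha A)) \<longlonglongrightarrow> 0"
    using tendsto_powr'[OF mu_seq_tendsto[OF A] tendsto_const[of "cexp A * alpha A"]] pos mu_seq_pos[OF A]
    by (simp add: less_imp_le)
  then have "\<forall>\<^sub>F k in sequentially. mu_seq A k powr (cexp A * alpha A) < beta A / gamma2 A"
    by (rule order_tendstoD) (use pos in simp)
  then show ?thesis
  proof eventually_elim
    case (elim k)
    have "gamma2 A * mu_seq A k powr (cexp A * alpha A) \<le> beta A"
      using elim pos by (simp add: field_simps)
    then have "mu_seq A k * (gamma2 A * mu_seq A k powr (cexp A * alpha A)) \<le> mu_seq A k * beta A"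
      using mu_seq_pos[OF A, of k] by (intro mult_left_mono) auto
    then have "gamma2 A * mu_seq A k powr (1 + cexp A * alpha A) \<le> beta A * mu_seq A k"
      using mu_seq_pos[OF A, of k] by (simp add: powr_add mult_ac)
    then show ?case by simp
  qed
qed

text \<open>Every way of leaving Step 2 ends in the neighbourhood for the current parameters.\<close>

lemma iterate_in_nbhd:
  assumes "algorithm2 P R A w d"
  shows "w (Suc k) \<in> nbhd P (mu_seq A k) (eps_seq A k)"
proof -
  have "steps_2_2_to_2_4 P R A w d k" using assms by (simp add: algorithm2_def)
  then show ?thesis
    by (auto simp: steps_2_2_to_2_4_def masses_in_nbhd_def split: if_splits prod.splits)
qed

lemma sqrt_sum_squares_ge:
  fixes a b c d :: real
  shows "\<bar>a\<bar> \<le> sqrt (a\<^sup>2 + b\<^sup>2 + c\<^sup>2 + d\<^sup>2)" "\<bar>b\<bar> \<le> sqrt (a\<^sup>2 + b\<^sup>2 + c\<^sup>2 + d\<^sup>2)"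
    "\<bar>c\<bar> \<le> sqrt (a\<^sup>2 + b\<^sup>2 + c\<^sup>2 + d\<^sup>2)" "\<bar>d\<bar> \<le> sqrt (a\<^sup>2 + b\<^sup>2 + c\<^sup>2 + d\<^sup>2)"
  by (rule real_le_rsqrt, simp)+

lemma residual_components:
  assumes "residual P mu (x, y, V) \<le> r"
  shows "theta P x \<le> r" "norm (phi1 P (x, y, V)) \<le> r" "\<bar>phi2 P (x, y, V)\<bar> \<le> r"
    "svec_norm (jprod (Fmat P x) V - mu *\<^sub>R mat 1) \<le> r"
proof -
  let ?a = "theta P x" and ?b = "norm (phi1 P (x, y, V))" and ?c = "phi2 P (x, y, V)"
    and ?d = "svec_norm (jprod (Fmat P x) V - mu *\<^sub>R mat 1)"
  have r: "sqrt (?a\<^sup>2 + ?b\<^sup>2 + ?c\<^sup>2 + ?d\<^sup>2) \<le> r" using assms by (simp add: residual_def)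
  note s = sqrt_sum_squares_ge[where a="?a" and b="?b" and c="?c" and d="?d"]
  show "?a \<le> r" using s(1) r by linarith
  show "?b \<le> r" using s(2) r by linarith
  show "\<bar>?c\<bar> \<le> r" using s(3) r by linarith
  show "?d \<le> r" using s(4) r by linarith
qed

lemma residual_leI:
  assumes "0 \<le> theta P x" "theta P x \<le> r / 4" "norm (phi1 P (x, y, V)) \<le> r / 4" "\<bar>phi2 P (x, y, V)\<bar> \<le> r / 4"
    "svec_norm (jprod (Fmat P x) V - mu *\<^sub>R mat 1) \<le> r / 4"
  shows "residual P mu (x, y, V) \<le> r"
proof -
  have r: "0 \<le> r" using assms(1,2) by simp
  have sq: "t\<^sup>2 \<le> (r / 4)\<^sup>2" if "\<bar>t\<bar> \<le> r / 4" for t :: real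
    using that by (metis abs_ge_zero power2_abs power_mono)
  have "residual P mu (x, y, V) \<le> sqrt ((r / 4)\<^sup>2 + (r / 4)\<^sup>2 + (r / 4)\<^sup>2 + (r / 4)\<^sup>2)"
    unfolding residual_def prod.case
    by (intro real_sqrt_le_mono add_mono sq)
      (use assms in \<open>auto simp: svec_norm_def L2_set_nonneg\<close>)
  also have "\<dots> = sqrt ((r / 2)\<^sup>2)" by (simp add: power2_eq_square)
  also have "\<dots> \<le> r" using r by (simp add: real_sqrt_abs)
  finally show ?thesis .
qed

section \<open>Change of enumeration\<close>

context reduced_setting
begin

lemma inj_restricted_branches:
  "inj_on (\<lambda>i. restrict (\<tau> i) (rdom R xs)) {..<p}"
proof (rule inj_onI)
  fix i j assume ij: "i \<in> {..<p}" "j \<in> {..<p}" "restrict (\<tau> i) (rdom R xs) = restrict (\<tau> j) (rdom R xs)"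
  then have "\<tau> i xs = \<tau> j xs" using xs_rdom by (metis restrict_apply')
  then show "i = j" using inj_tau_xs ij by (auto simp: inj_on_def)
qed

text \<open>The bijection \<open>\<pi>\<close> translates indices of branches at the limit into indices at the base point \<open>xb\<close>.\<close>

definition renumbers :: "real^'n \<Rightarrow> (nat \<Rightarrow> nat) \<Rightarrow> bool" where
  "renumbers xb \<pi> \<longleftrightarrow> bij_betw \<pi> {..<p} {..<np P R xb} \<and>
     (\<forall>i<p. \<forall>x\<in>rdom R xs. branch R xb (\<pi> i) x = \<tau> i x)"

text \<open>Branches with different indices differ as functions, because they do at their base point; so equal
sets of branches are indexed bijectively.\<close>

lemma renumbering_exists:
  assumes xb: "reduced_setting P R xb" and dom: "rdom R xb = rdom R xs"
    and br: "branches R xb {..<np P R xb} = branches R xs {..<p}"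
  shows "\<exists>\<pi>. renumbers xb \<pi>"
proof -
  let ?f = "\<lambda>i. restrict (\<tau> i) (rdom R xs)" and ?g = "\<lambda>i. restrict (branch R xb i) (rdom R xs)"
  let ?J = "{..<np P R xb}"
  have f: "bij_betw ?f {..<p} (branches R xs {..<p})"
    using inj_restricted_branches by (simp add: bij_betw_def branches_def)
  have "inj_on ?g ?J" using reduced_setting.inj_restricted_branches[OF xb] dom by simp
  then have g: "bij_betw ?g ?J (branches R xs {..<p})"
    using br dom by (simp add: bij_betw_def branches_def)
  define \<pi> where "\<pi> = inv_into ?J ?g \<circ> ?f"
  have "bij_betw \<pi> {..<p} ?J"
    unfolding \<pi>_def by (rule bij_betw_trans[OF f bij_betw_inv_into[OF g]])
  moreover have "branch R xb (\<pi> i) x = \<tau> i x" if "i < p" "x \<in> rdom R xs" for i x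
  proof -
    have "?f i \<in> ?g ` ?J" using f g that(1) by (auto simp: bij_betw_def)
    then have "?g (\<pi> i) = ?f i" unfolding \<pi>_def o_def by (rule f_inv_into_f)
    then show ?thesis using that(2) by (metis restrict_apply')
  qed
  ultimately show ?thesis unfolding renumbers_def by blast
qed

context
  fixes xb \<pi> assumes pi: "renumbers xb \<pi>"
begin

lemma pi_less: "i < p \<Longrightarrow> \<pi> i < np P R xb"
  using pi by (auto simp: renumbers_def bij_betw_def)

lemma branch_pi: "i < p \<Longrightarrow> x \<in> rdom R xs \<Longrightarrow> branch R xb (\<pi> i) x = \<tau> i x"
  using pi by (auto simp: renumbers_def)

lemma sum_pi: "(\<Sum>j<np P R xb. f j) = (\<Sum>i<p. f (\<pi> i))"
  using sum.reindex_bij_betw[of \<pi> "{..<p}" "{..<np P R xb}" f] pi by (simp add: renumbers_def)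

lemma ghat_pi: "i < p \<Longrightarrow> x \<in> rdom R xs \<Longrightarrow> ghat P R xb (\<pi> i) x = gh i x"
  by (simp add: ghat_def branch_pi)

lemma grad_ghat_pi: "i < p \<Longrightarrow> x \<in> rdom R xs \<Longrightarrow> grad (ghat P R xb (\<pi> i)) x = gg i x"
  by (rule grad_cong, rule eventually_mono[OF eventually_rdom]) (auto simp: ghat_pi)

lemma glin_pi: "i < p \<Longrightarrow> x \<in> rdom R xs \<Longrightarrow> glin P R xb x h (\<pi> i) = gh i x + gg i x \<bullet> h"
  by (simp add: glin_def ghat_pi grad_ghat_pi)

lemma lagr_pi: "x \<in> rdom R xs \<Longrightarrow> lagr P R xb y V x = lagr P R xs (y \<circ> \<pi>) V x"
  by (simp add: lagr_def sum_pi ghat_pi)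

lemma hess_lagr_pi: "x \<in> rdom R xs \<Longrightarrow> hess (lagr P R xb y V) x = hess (lagr P R xs (y \<circ> \<pi>) V) x"
  by (rule hess_cong, rule eventually_mono[OF eventually_rdom]) (auto simp: lagr_pi)

lemma from_masses_pi:
  assumes "x \<in> rdom R xs"
  shows "from_masses P R xb (x, y, V) = (x, point_masses (Tset P) p (y \<circ> \<pi>) (\<lambda>i. \<tau> i x), V)"
proof -
  have "(\<Sum>i<p. ennreal (y (\<pi> i)) * indicator B (branch R xb (\<pi> i) x))
      = (\<Sum>i<p. ennreal (y (\<pi> i)) * indicator B (\<tau> i x))" for B
    by (rule sum.cong) (auto simp: branch_pi assms)
  then show ?thesis unfolding from_masses_def point_masses_def prod.case sum_pi o_def by simp
qed

end

lemma tr_prod_has_derivative: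
  "((\<lambda>x. tr_prod (Fmat P x) V) has_derivative (\<lambda>h. Fadj P V \<bullet> h)) (at x)"
proof -
  have lin: "tr_prod (Flin P h) V = Fadj P V \<bullet> h" for h
  proof -
    have "tr_prod (\<Sum>i\<in>S. h $ i *\<^sub>R Fcoef P i) V = (\<Sum>i\<in>S. h $ i * tr_prod (Fcoef P i) V)" if "finite S" for S
      using that by (induction S) (auto simp: tr_prod_def mat_mul.add_left mat_mul.scaleR_left
          trace_add trace_scaleR mat_mul.zero_left trace_0[unfolded mat_0])
    then show ?thesis by (simp add: Flin_def Fadj_def inner_vec_def mult.commute)
  qed
  have "tr_prod (Fmat P x) V = tr_prod (Fconst P) V + Fadj P V \<bullet> x" for x
    by (simp add: Fmat_def tr_prod_def[of "_ + _"] mat_mul.add_left trace_add)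
      (simp flip: tr_prod_def add: lin)
  then show ?thesis by (auto intro!: derivative_eq_intros)
qed

lemma obj_has_derivative: "Ck_on 3 (obj P) UNIV \<Longrightarrow> (obj P has_derivative (\<lambda>h. gf x \<bullet> h)) (at x)"
proof -
  assume C: "Ck_on 3 (obj P) UNIV"
  then have "obj P differentiable (at x)" by (simp add: numeral_3_eq_3)
  then obtain D where D: "(obj P has_derivative D) (at x)" by (auto simp: differentiable_def)
  then have "D = (\<lambda>h. gf x \<bullet> h)" by (simp add: fun_eq_iff grad_inner)
  with D show ?thesis by simp
qed

lemma eventually_hess_lagr:
  assumes C: "Ck_on 3 (obj P) UNIV"
  shows "\<forall>\<^sub>F z in nhds xs. \<forall>y V h. hess (lagr P R xs y V) z *v h
     = Hf z *v h + (\<Sum>i<p. y i *\<^sub>R (Hg i z *v h))"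
proof -
  have "\<forall>\<^sub>F z in nhds xs. \<forall>i\<in>{..<p}. (gh i has_derivative (\<lambda>h. gg i z \<bullet> h)) (at z)"
    by (intro eventually_ball_finite ballI quad_rem_at_has_derivative[OF ghat_quad_rem]) auto
  then have "\<forall>\<^sub>F z in nhds xs. \<forall>\<^sub>F z' in nhds z. \<forall>i\<in>{..<p}. (gh i has_derivative (\<lambda>h. gg i z' \<bullet> h)) (at z')"
    by (simp add: eventually_eventually)
  moreover have "\<forall>\<^sub>F z in nhds xs. \<forall>i\<in>{..<p}. (gg i has_derivative (\<lambda>h. Hg i z *v h)) (at z)"
    by (intro eventually_ball_finite ballI quad_rem_at_has_derivative[OF grad_ghat_quad_rem]) auto
  ultimately show ?thesis
  proof eventually_elim
    case (elim z)
    show ?case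
    proof (intro allI)
      fix y V h
      have "\<forall>\<^sub>F z' in nhds z. gf z' + (\<Sum>i<p. y i *\<^sub>R gg i z') - Fadj P V
          = grad (lagr P R xs y V) z'"
        using elim(1)
      proof eventually_elim
        case (elim z')
        have "(lagr P R xs y V has_derivative
           (\<lambda>h. gf z' \<bullet> h + (\<Sum>i<p. y i * (gg i z' \<bullet> h)) - Fadj P V \<bullet> h)) (at z')"
          unfolding lagr_def[abs_def]
          by (intro has_derivative_diff has_derivative_add has_derivative_sum has_derivative_mult_right
              obj_has_derivative[OF C] tr_prod_has_derivative) (use elim in auto)
        then have "(lagr P R xs y V has_derivative
           (\<lambda>h. (gf z' + (\<Sum>i<p. y i *\<^sub>R gg i z') - Fadj P V) \<bullet> h)) (at z')"
          by (simp add: inner_add_left inner_diff_left inner_sum_left)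
        then show ?case by (rule grad_eqI[symmetric])
      qed
      note ev = has_derivative_eventually_iff[OF this]
      have go: "(gf has_derivative (\<lambda>h. Hf z *v h)) (at z)"
        using eventually_nhds_x_imp_x[OF quad_rem_at_has_derivative[OF grad_obj_quad_rem[OF C]]] .
      have "((\<lambda>z'. gf z' + (\<Sum>i<p. y i *\<^sub>R gg i z') - Fadj P V) has_derivative
         (\<lambda>h. Hf z *v h + (\<Sum>i<p. y i *\<^sub>R (Hg i z *v h)) - 0)) (at z)"
        by (intro has_derivative_diff has_derivative_add has_derivative_sum has_derivative_scaleR_right
            go has_derivative_const) (use elim in auto)
      then show "hess (lagr P R xs y V) z *v h = Hf z *v h + (\<Sum>i<p. y i *\<^sub>R (Hg i z *v h))"
        unfolding ev by (subst hess_mul) auto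
    qed
  qed
qed

lemma grad_ghat_eq_con: "x \<in> inj_dom \<Longrightarrow> i < p \<Longrightarrow> gg i x = grad (\<lambda>x'. con P x' (\<tau> i x)) x"
  using tau_in_smooth by (simp add: grad_ghat grad_con inj_dom_def)

lemma inj_domD: "x \<in> inj_dom \<Longrightarrow> x \<in> rdom R xs" "x \<in> inj_dom \<Longrightarrow> inj_on (\<lambda>i. \<tau> i x) {..<p}"
  by (auto simp: inj_dom_def)

lemma phi_discrete:
  assumes x: "x \<in> inj_dom" and y: "y \<in> Mplus (Tset P)" "discrete_measure y" "msupp y \<subseteq> (\<lambda>i. \<tau> i x) ` {..<p}"
  shows "phi1 P (x, y, V) = gf x + (\<Sum>i<p. measure y {\<tau> i x} *\<^sub>R gg i x) - Fadj P V"
    and "phi2 P (x, y, V) = (\<Sum>i<p. measure y {\<tau> i x} * gh i x)"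
proof -
  note int = discrete_integral[OF y T_borel tau_in_T[OF inj_domD(1)[OF x]] inj_domD(2)[OF x]]
  show "phi1 P (x, y, V) = gf x + (\<Sum>i<p. measure y {\<tau> i x} *\<^sub>R gg i x) - Fadj P V"
    by (simp add: phi1_def int[OF _ grad_con_continuous_t] grad_ghat_eq_con[OF x])
  show "phi2 P (x, y, V) = (\<Sum>i<p. measure y {\<tau> i x} * gh i x)"
    by (simp add: phi2_def int[OF _ con_continuous_t] ghat_def)
qed

lemma phi_point_masses:
  assumes x: "x \<in> inj_dom" and c: "\<And>i. i < p \<Longrightarrow> 0 \<le> c i"
  shows "phi1 P (x, point_masses (Tset P) p c (\<lambda>i. \<tau> i x), V)
      = gf x + (\<Sum>i<p. c i *\<^sub>R gg i x) - Fadj P V"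
    and "phi2 P (x, point_masses (Tset P) p c (\<lambda>i. \<tau> i x), V) = (\<Sum>i<p. c i * gh i x)"
proof -
  note int = integral_point_masses[where n=p and c=c and p="\<lambda>i. \<tau> i x",
      OF T_borel tau_in_T[OF inj_domD(1)[OF x]] inj_domD(2)[OF x] c]
  show "phi1 P (x, point_masses (Tset P) p c (\<lambda>i. \<tau> i x), V)
      = gf x + (\<Sum>i<p. c i *\<^sub>R gg i x) - Fadj P V"
    by (simp add: phi1_def int[OF _ _ grad_con_continuous_t] grad_ghat_eq_con[OF x])
  show "phi2 P (x, point_masses (Tset P) p c (\<lambda>i. \<tau> i x), V) = (\<Sum>i<p. c i * gh i x)"
    by (simp add: phi2_def int[OF _ _ con_continuous_t] ghat_def)
qed

end

section \<open>The algorithm near its limit\<close>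

lemma to_masses_eq:
  "to_masses R xb u = (fst u, \<lambda>i. measure (fst (snd u)) {branch R xb i (fst u)}, snd (snd u))"
  by (cases u) (simp add: to_masses_def)

text \<open>The hypotheses of the theorem. The limit provides the data of \<^locale>\<open>kkt_jacobian\<close>, and the iterates
and directions, renumbered along the limit, those of \<^locale>\<open>newton_iterates\<close>.\<close>

locale algorithm_limit =
  fixes P :: "('n::finite, 'm::{finite,linorder}, 'q::finite) sisdp"
    and R :: "('n, 'q) reduction" and A :: alg_params
    and w :: "nat \<Rightarrow> ('n, 'm, 'q) point" and d :: "nat \<Rightarrow> ('n, 'm) vpoint" and ws :: "('n, 'm, 'q) point"
  assumes prob: "sisdp_problem P" and thr: "thresh R > 0"
    and red: "\<And>x. x \<in> insert (fst ws) (range (\<lambda>k. fst (w k))) \<Longrightarrow>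
           nondegenerate P (thresh R) x \<Longrightarrow> local_reduction P R x"
    and params: "valid_params A" and alg: "algorithm2 P R A w d"
    and asmB: "assumption_B P R w ws" and asmC: "assumption_C P R w d ws"
begin

definition "ys i = measure (fst (snd ws)) {branch R (fst ws) i (fst ws)}"
abbreviation "xs \<equiv> fst ws"
abbreviation "Vs \<equiv> snd (snd ws)"

lemma nondeg_xs: "nondegenerate P (thresh R) xs"
  using asmB by (simp add: assumption_B_def Let_def)

lemma kkt_ws: "jprod (Fmat P xs) Vs = 0" "Fmat P xs \<in> psd" "Vs \<in> psd"
    "t \<in> Tset P \<Longrightarrow> con P xs t \<le> 0"
  using asmB by (auto simp: assumption_B_def Let_def kkt_point_def split: prod.splits)

lemma limit_regular: "Ck_on 3 (obj P) UNIV"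
  "\<forall>\<^sub>F k in sequentially. branches R (fst (w k)) (Jact P R w d k) = branches R xs (Iact P R xs)"
  "Fmat P xs + Vs \<in> pd" "i < np P R xs \<Longrightarrow> 0 < - ghat P R xs i xs + ys i"
  "nonsingular_on (coords (Iact P R xs)) (jacobian_entry (Phi0 P R xs) (encode (xs, ys, Vs)))"
  using asmC by (auto simp: assumption_C_def to_masses_eq ys_def[abs_def])

sublocale kkt_jacobian P R xs ys Vs
proof
  show "sisdp_problem P" by (rule prob)
  show "0 < thresh R" by (rule thr)
  show "local_reduction P R xs" using red nondeg_xs by blast
  show "Ck_on 3 (obj P) UNIV" by (rule limit_regular)
  show "Vs \<in> sym_mat" using kkt_ws(3) by (rule psd_sym)
qed

definition "x k = fst (w k)"
definition "y k i = measure (fst (snd (w k))) {branch R xs i (fst (w k))}"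
definition "V k = snd (snd (w k))"
definition "num k = (SOME \<pi>. renumbers (x k) \<pi>)"
definition "dx k = fst (d k)"
definition "dy k i = fst (snd (d k)) (num k i)"
definition "dV k = snd (snd (d k))"
text \<open>Iterate \<open>k\<close> was accepted with the barrier parameter of iteration \<open>k - 1\<close>; this makes sense for
\<open>k > 0\<close> only.\<close>

definition "mu' k = mu_seq A (k - 1)"
definition "eps' k = gamma1 A * mu' k powr (1 + alpha A)"

lemma w_eq: "w k = (x k, fst (snd (w k)), V k)" by (simp add: x_def V_def)

lemma d_eq: "d k = (dx k, fst (snd (d k)), dV k)" by (simp add: dx_def dV_def)

lemma iterate_setting: "reduced_setting P R (x k)"
proof
  have "step_2_1 P R A w d k" using alg by (simp add: algorithm2_def)
  then have nd: "nondegenerate P (thresh R) (x k)" by (simp add: step_2_1_def Let_def x_def)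
  show "local_reduction P R (x k)" using red nd by (auto simp: x_def)
qed (rule thr)

lemma ev_discrete: "\<forall>\<^sub>F k in sequentially. rdom R (x k) = rdom R xs \<and>
    branches R (x k) {..<np P R (x k)} = branches R xs {..<p} \<and>
    msupp (fst (snd (w k))) \<subseteq> (\<lambda>i. \<tau> i (x k)) ` {..<p} \<and> discrete_measure (fst (snd (w k)))"
  using asmB unfolding assumption_B_def Let_def by (auto simp: x_def case_prod_unfold)

lemma ev_renumbers: "\<forall>\<^sub>F k in sequentially. renumbers (x k) (num k)"
  using ev_discrete
proof eventually_elim
  case (elim k)
  then have "\<exists>\<pi>. renumbers (x k) \<pi>" using renumbering_exists[OF iterate_setting] by blast
  then show ?case unfolding num_def by (rule someI_ex)
qed

lemma ev_nbhd: "\<forall>\<^sub>F k in sequentially. (x k, fst (snd (w k)), V k) \<in> nbhd P (mu' k) (eps' k)"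
  using eventually_gt_at_top[of 0]
proof eventually_elim
  case (elim k)
  then obtain j where "k = Suc j" using gr0_implies_Suc by blast
  then show ?case using iterate_in_nbhd[OF alg, of j] w_eq[of k]
    by (simp add: mu'_def eps'_def eps_seq_def)
qed

lemma ev_pd: "\<forall>\<^sub>F k in sequentially. Fmat P (x k) \<in> pd" "\<forall>\<^sub>F k in sequentially. V k \<in> pd"
  using ev_nbhd by (auto simp: nbhd_def elim!: eventually_mono)

lemma wdist_eq: "wdist P R ws u = sqrt ((norm (fst u - xs))\<^sup>2
   + (\<Sum>i<p. (measure (fst (snd u)) {\<tau> i (fst u)} - ys i)\<^sup>2) + (svec_norm (snd (snd u) - Vs))\<^sup>2)"
  by (simp add: wdist_def to_masses_eq ys_def)

lemma wdist_components:
  "norm (fst u - xs) \<le> wdist P R ws u" "svec_norm (snd (snd u) - Vs) \<le> wdist P R ws u"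
  "i < p \<Longrightarrow> \<bar>measure (fst (snd u)) {\<tau> i (fst u)} - ys i\<bar> \<le> wdist P R ws u"
proof -
  let ?S = "\<Sum>i<p. (measure (fst (snd u)) {\<tau> i (fst u)} - ys i)\<^sup>2"
  have S: "0 \<le> ?S" by (intro sum_nonneg) simp
  show "norm (fst u - xs) \<le> wdist P R ws u" "svec_norm (snd (snd u) - Vs) \<le> wdist P R ws u"
    unfolding wdist_eq using S by (auto intro!: real_le_rsqrt)
  assume i: "i < p"
  have "(measure (fst (snd u)) {\<tau> i (fst u)} - ys i)\<^sup>2 \<le> ?S"
    using i by (intro member_le_sum) auto
  then show "\<bar>measure (fst (snd u)) {\<tau> i (fst u)} - ys i\<bar> \<le> wdist P R ws u"
    unfolding wdist_eq by (intro real_le_rsqrt) (simp add: add_increasing add_increasing2)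
qed

lemma wdist_tendsto: "(\<lambda>k. wdist P R ws (w k)) \<longlonglongrightarrow> 0"
  using asmB by (simp add: assumption_B_def Let_def)

lemma x_lim: "x \<longlonglongrightarrow> xs"
proof (rule LIM_zero_cancel, rule Lim_null_comparison[OF _ wdist_tendsto])
  show "\<forall>\<^sub>F k in sequentially. norm (x k - xs) \<le> wdist P R ws (w k)"
    using wdist_components(1)[of "w _"] by (auto simp: x_def)
qed

lemma y_lim: "i < p \<Longrightarrow> (\<lambda>k. y k i) \<longlonglongrightarrow> ys i"
proof (rule LIM_zero_cancel, rule Lim_null_comparison[OF _ wdist_tendsto])
  assume "i < p"
  then show "\<forall>\<^sub>F k in sequentially. norm (y k i - ys i) \<le> wdist P R ws (w k)"
    using wdist_components(3)[of i "w _"] by (auto simp: y_def)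
qed

lemma ev_norm_V: "\<forall>\<^sub>F k in sequentially. svec_norm (V k - Vs) = norm (V k - Vs)"
  using ev_pd(2) by eventually_elim (intro svec_norm_sym sym_mat_diff pd_sym Vs_sym)

lemma V_lim: "V \<longlonglongrightarrow> Vs"
proof (rule LIM_zero_cancel, rule Lim_null_comparison[OF _ wdist_tendsto])
  show "\<forall>\<^sub>F k in sequentially. norm (V k - Vs) \<le> wdist P R ws (w k)"
    using ev_norm_V by eventually_elim (metis V_def wdist_components(2))
qed

lemma ev_inj_dom: "\<forall>\<^sub>F k in sequentially. x k \<in> inj_dom"
  using filterlim_iff[THEN iffD1, OF x_lim] eventually_inj_dom[OF xs_inj_dom] by blast

lemma residual_small: "\<forall>\<^sub>F k in sequentially. theta P (x k) \<le> eps' k \<and>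
   norm (gf (x k) + (\<Sum>i<p. y k i *\<^sub>R gg i (x k)) - Fadj P (V k)) \<le> eps' k \<and>
   \<bar>\<Sum>i<p. y k i * gh i (x k)\<bar> \<le> eps' k \<and> norm (jprod (Fmat P (x k)) (V k) - mu' k *\<^sub>R mat 1) \<le> eps' k"
  using ev_nbhd ev_discrete ev_inj_dom
proof eventually_elim
  case (elim k)
  let ?m = "fst (snd (w k))"
  have nb: "?m \<in> Mplus (Tset P)" "V k \<in> pd" "residual P (mu' k) (x k, ?m, V k) \<le> eps' k"
    using elim(1) by (auto simp: nbhd_def)
  note ph = phi_discrete[OF elim(3) nb(1) conjunct2[OF conjunct2[OF conjunct2[OF elim(2)]]]
      conjunct1[OF conjunct2[OF conjunct2[OF elim(2)]]], of "V k"]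
  have yk: "y k i = measure ?m {\<tau> i (x k)}" for i by (simp add: y_def x_def)
  have "jprod (Fmat P (x k)) (V k) - mu' k *\<^sub>R mat 1 \<in> sym_mat"
    by (intro sym_mat_diff jprod_sym Fmat_sym pd_sym nb sym_mat_scaleR sym_mat_one)
  then show ?case using residual_components[OF nb(3)] unfolding ph yk by (simp add: svec_norm_sym)
qed

lemma ev_rdom: "\<forall>\<^sub>F k in sequentially. x k \<in> rdom R xs"
  using ev_inj_dom by eventually_elim (rule inj_domD)

lemma to_masses_iterate:
  "to_masses R (x k) (w k) = (x k, \<lambda>i. measure (fst (snd (w k))) {branch R (x k) i (x k)}, V k)"
  by (simp add: to_masses_eq x_def V_def)

lemma step_equations:
  fixes k
  defines "z \<equiv> (x k, \<lambda>i. measure (fst (snd (w k))) {branch R (x k) i (x k)}, V k)"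
    and "h \<equiv> (dx k, fst (snd (d k)), dV k)"
  shows "eq_a P R (x k) z h" "eq_b P (mu_seq A k) z h" "eq_c P R (x k) z h"
proof -
  have "step_2_1 P R A w d k" using alg by (simp add: algorithm2_def)
  then show "eq_a P R (x k) z h" "eq_b P (mu_seq A k) z h" "eq_c P R (x k) z h"
    unfolding z_def h_def to_masses_iterate[symmetric] d_eq[symmetric]
    by (auto simp: step_2_1_def Let_def x_def)
qed

lemma masses_num:
  assumes "renumbers (x k) (num k)" "x k \<in> rdom R xs" "i < p"
  shows "measure (fst (snd (w k))) {branch R (x k) (num k i) (x k)} = y k i"
  using branch_pi[OF assms(1,3,2)] by (simp add: y_def x_def)

lemma newton_stat: "\<forall>\<^sub>F k in sequentially. gf (x k) + Hf (x k) *v dx k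
      + (\<Sum>i<p. y k i *\<^sub>R (Hg i (x k) *v dx k))
      + (\<Sum>i<p. (y k i + dy k i) *\<^sub>R gg i (x k)) - Fadj P (V k + dV k) = 0"
  using ev_renumbers ev_rdom filterlim_iff[THEN iffD1, OF x_lim, rule_format, OF eventually_hess_lagr[OF obj_C3]]
proof eventually_elim
  case (elim k)
  let ?y = "\<lambda>i. measure (fst (snd (w k))) {branch R (x k) i (x k)}"
  note num = elim(1) and xr = elim(2)
  have a: "gf (x k) + hess (lagr P R (x k) ?y (V k)) (x k) *v dx k
       + (\<Sum>i<np P R (x k). (?y i + fst (snd (d k)) i) *\<^sub>R grad (ghat P R (x k) i) (x k)) - Fadj P (V k + dV k) = 0"
    using step_equations(1)[of k] by (simp add: eq_a_def)
  have "hess (lagr P R (x k) ?y (V k)) (x k) *v dx k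
      = Hf (x k) *v dx k + (\<Sum>i<p. y k i *\<^sub>R (Hg i (x k) *v dx k))"
    unfolding hess_lagr_pi[OF num xr] using elim(3) masses_num[OF num xr] by simp
  moreover have "(\<Sum>i<np P R (x k). (?y i + fst (snd (d k)) i) *\<^sub>R grad (ghat P R (x k) i) (x k))
      = (\<Sum>i<p. (y k i + dy k i) *\<^sub>R gg i (x k))"
    unfolding sum_pi[OF num]
    by (rule sum.cong) (auto simp: masses_num[OF num xr] grad_ghat_pi[OF num _ xr] dy_def)
  ultimately show ?case using a by (simp add: add.assoc)
qed

lemma newton_sdp: "\<forall>\<^sub>F k in sequentially. jprod (Fmat P (x k)) (V k + dV k)
      + scaled_op (Fmat P (x k)) (V k) (Flin P (dx k)) = mu_seq A k *\<^sub>R mat 1"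
  and newton_sym: "dV k \<in> sym_mat"
proof -
  note b = step_equations(2)
  show "\<forall>\<^sub>F k in sequentially. jprod (Fmat P (x k)) (V k + dV k)
      + scaled_op (Fmat P (x k)) (V k) (Flin P (dx k)) = mu_seq A k *\<^sub>R mat 1"
    using b by (intro always_eventually allI) (simp add: eq_b_def scaled_op_def)
  show "dV k \<in> sym_mat" using b[of k] by (simp add: eq_b_def)
qed

lemma newton_signs: "\<forall>\<^sub>F k in sequentially. \<forall>i<p. 0 \<le> y k i + dy k i \<and>
     gh i (x k) + gg i (x k) \<bullet> dx k \<le> 0 \<and>
     (y k i + dy k i = 0 \<or> gh i (x k) + gg i (x k) \<bullet> dx k = 0)"
  using ev_renumbers ev_rdom
proof eventually_elim
  case (elim k)
  let ?y = "\<lambda>i. measure (fst (snd (w k))) {branch R (x k) i (x k)} + fst (snd (d k)) i"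
  let ?g = "glin P R (x k) (x k) (dx k)"
  note num = elim(1) and xr = elim(2)
  have c: "\<And>i. i < np P R (x k) \<Longrightarrow> 0 \<le> ?y i \<and> ?g i \<le> 0" "(\<Sum>i<np P R (x k). ?y i * ?g i) = 0"
    using step_equations(3)[of k] by (simp_all add: eq_c_def)
  have "(\<Sum>i<np P R (x k). - (?y i * ?g i)) = 0" using c(2) by (simp add: sum_negf)
  moreover have "0 \<le> - (?y i * ?g i)" if "i < np P R (x k)" for i
    using c(1)[OF that] by (simp add: mult_nonneg_nonpos)
  ultimately have "\<forall>i\<in>{..<np P R (x k)}. - (?y i * ?g i) = 0"
    by (subst (asm) sum_nonneg_eq_0_iff) auto
  then have z: "?y i = 0 \<or> ?g i = 0" if "i < np P R (x k)" for i using that by fastforce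
  show ?case
  proof (intro allI impI)
    fix i assume i: "i < p"
    note pl = pi_less[OF num i]
    have "?y (num k i) = y k i + dy k i" using masses_num[OF num xr i] by (simp add: dy_def)
    moreover have "?g (num k i) = gh i (x k) + gg i (x k) \<bullet> dx k" by (rule glin_pi[OF num i xr])
    ultimately show "0 \<le> y k i + dy k i \<and> gh i (x k) + gg i (x k) \<bullet> dx k \<le> 0 \<and>
     (y k i + dy k i = 0 \<or> gh i (x k) + gg i (x k) \<bullet> dx k = 0)"
      using c(1)[OF pl] z[OF pl] by simp
  qed
qed

text \<open>The index sets of Assumption C are compared as sets of functions; distinct indices give distinct
functions, so the comparison descends to indices.\<close>

lemma active_set: "\<forall>\<^sub>F k in sequentially. \<forall>i<p. i \<in> I \<longleftrightarrow> gh i (x k) + gg i (x k) \<bullet> dx k = 0"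
  using ev_renumbers ev_rdom ev_discrete limit_regular(2)
proof eventually_elim
  case (elim k)
  note num = elim(1) and xr = elim(2)
  let ?f = "\<lambda>i. restrict (\<tau> i) (rdom R xs)" and ?g = "\<lambda>i. restrict (branch R (x k) i) (rdom R xs)"
  have dom: "rdom R (x k) = rdom R xs" using elim(3) by blast
  have im: "?g ` Jact P R w d k = ?f ` I"
    using elim(4) unfolding branches_def x_def[symmetric] dom .
  have gf: "?g (num k i) = ?f i" if "i < p" for i
    using branch_pi[OF num that] by (auto simp: restrict_def fun_eq_iff)
  have ginj: "inj_on ?g {..<np P R (x k)}"
    using reduced_setting.inj_restricted_branches[OF iterate_setting, of k] dom by simp
  have J: "j \<in> Jact P R w d k \<longleftrightarrow> j < np P R (x k) \<and> glin P R (x k) (x k) (dx k) j = 0" for j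
    by (simp add: Jact_def x_def dx_def)
  show ?case
  proof (intro allI impI)
    fix i assume i: "i < p"
    note pl = pi_less[OF num i]
    have "i \<in> I \<longleftrightarrow> ?f i \<in> ?f ` I"
      using inj_restricted_branches i I_lt
      by (subst inj_on_image_mem_iff[where B="{..<p}"]) auto
    also have "\<dots> \<longleftrightarrow> ?g (num k i) \<in> ?g ` Jact P R w d k" by (simp add: im gf[OF i])
    also have "\<dots> \<longleftrightarrow> num k i \<in> Jact P R w d k"
      using pl J by (subst inj_on_image_mem_iff[OF ginj]) auto
    also have "\<dots> \<longleftrightarrow> gh i (x k) + gg i (x k) \<bullet> dx k = 0"
      using pl by (simp add: J glin_pi[OF num i xr])
    finally show "i \<in> I \<longleftrightarrow> gh i (x k) + gg i (x k) \<bullet> dx k = 0" .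
  qed
qed

lemma param_bounds: "0 < alpha A" "alpha A < 1" "0 < cexp A" "cexp A < 1" "0 < gamma1 A" "0 < gamma2 A"
proof -
  show "0 < alpha A" "alpha A < 1" "0 < cexp A" "0 < gamma1 A" "0 < gamma2 A"
    using params by (auto simp: valid_params_def)
  have "cexp A \<le> 1 / (alpha A + 2)" using params by (simp add: valid_params_def)
  also have "\<dots> < 1" using \<open>0 < alpha A\<close> by simp
  finally show "cexp A < 1" .
qed

sublocale newton: newton_iterates P R xs ys Vs x dx y dy V dV mu' "mu_seq A" eps'
  "alpha A" "cexp A" "gamma1 A" "gamma2 A"
proof
  show "0 < alpha A" "alpha A < 1" "0 < cexp A" "cexp A < 1" "0 < gamma1 A" "0 < gamma2 A"
    by (rule param_bounds)+
  show "0 < mu' k" for k unfolding mu'_def by (rule mu_seq_pos[OF params])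
  have shift: "mu' (Suc k) = mu_seq A k" for k by (simp add: mu'_def)
  show "mu' \<longlonglongrightarrow> 0"
    by (rule LIMSEQ_imp_Suc) (simp add: shift mu_seq_tendsto[OF params])
  show "\<forall>\<^sub>F k in sequentially. mu_seq A k = gamma2 A * mu' k powr (1 + cexp A * alpha A)"
    by (subst eventually_sequentially_Suc[symmetric]) (simp only: shift mu_seq_Suc_eventually[OF params])
  show "eps' k = gamma1 A * mu' k powr (1 + alpha A)" for k by (rule eps'_def)
  show "nonsingular_on (coords I) (jacobian_entry (Phi0 P R xs) (encode (xs, ys, Vs)))" by (rule limit_regular(5))
  show "jprod (Fmat P xs) Vs = 0" by (rule kkt_ws(1))
  show "Fmat P xs + Vs \<in> pd" by (rule limit_regular(3))
  show "gh i xs \<le> 0" if "i < p" for i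
    unfolding ghat_def by (rule kkt_ws(4)[OF tau_in_T[OF xs_rdom that]])
  show "0 \<le> ys i" for i by (simp add: ys_def)
  show "0 < - gh i xs + ys i" if "i < p" for i by (rule limit_regular(4)[OF that])
  show "x \<longlonglongrightarrow> xs" by (rule x_lim)
  show "(\<lambda>k. y k i) \<longlonglongrightarrow> ys i" if "i < p" for i by (rule y_lim[OF that])
  show "V \<longlonglongrightarrow> Vs" by (rule V_lim)
  show "\<forall>\<^sub>F k in sequentially. Fmat P (x k) \<in> pd" "\<forall>\<^sub>F k in sequentially. V k \<in> pd" by (rule ev_pd)+
  show "0 \<le> y k i" for k i by (simp add: y_def)
  show "\<forall>\<^sub>F k in sequentially. norm (gf (x k)
      + (\<Sum>i<p. y k i *\<^sub>R gg i (x k)) - Fadj P (V k)) \<le> eps' k"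
    "\<forall>\<^sub>F k in sequentially. \<bar>\<Sum>i<p. y k i * gh i (x k)\<bar> \<le> eps' k"
    "\<forall>\<^sub>F k in sequentially. norm (jprod (Fmat P (x k)) (V k) - mu' k *\<^sub>R mat 1) \<le> eps' k"
    using residual_small by (auto elim!: eventually_mono)
  show "\<forall>\<^sub>F k in sequentially. \<forall>i<p. gh i (x k) \<le> eps' k"
    using residual_small ev_rdom
    by eventually_elim (auto simp: ghat_def intro: order_trans[OF con_le_theta[OF tau_in_T]])
  show "\<forall>\<^sub>F k in sequentially. gf (x k) + Hf (x k) *v dx k
      + (\<Sum>i<p. y k i *\<^sub>R (Hg i (x k) *v dx k))
      + (\<Sum>i<p. (y k i + dy k i) *\<^sub>R gg i (x k)) - Fadj P (V k + dV k) = 0"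
    by (rule newton_stat)
  show "\<forall>\<^sub>F k in sequentially. dV k \<in> sym_mat" by (simp add: newton_sym)
  show "\<forall>\<^sub>F k in sequentially. jprod (Fmat P (x k)) (V k + dV k)
      + scaled_op (Fmat P (x k)) (V k) (Flin P (dx k)) = mu_seq A k *\<^sub>R mat 1"
    by (rule newton_sdp)
  show "\<forall>\<^sub>F k in sequentially. \<forall>i\<in>I. gh i (x k) + gg i (x k) \<bullet> dx k = 0"
    using active_set by eventually_elim (use I_lt in blast)
  show "\<forall>\<^sub>F k in sequentially. \<forall>i<p. i \<notin> I \<longrightarrow> y k i + dy k i = 0"
    using active_set newton_signs by eventually_elim blast
  show "\<forall>\<^sub>F k in sequentially. \<forall>i<p. gh i (x k) + gg i (x k) \<bullet> dx k \<le> 0"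
    using newton_signs by eventually_elim blast
qed

lemma half_size_one: "\<forall>\<^sub>F k in sequentially. half_size P R A w d k = 1"
  using ev_pd newton.new_pd
proof eventually_elim
  case (elim k)
  have "max_step (delta A) (Fmat P (x k)) (Flin P (dx k)) = 1"
    using elim by (intro max_step_eq_one Flin_sym) (auto simp: Fmat_add)
  moreover have "max_step (delta A) (V k) (dV k) = 1"
    using elim by (intro max_step_eq_one newton_sym) auto
  ultimately show ?case
    unfolding half_size_def x_def[symmetric] to_masses_iterate
    by (subst d_eq) (simp add: step_size_def)
qed

lemma half_point_eq: "\<forall>\<^sub>F k in sequentially. from_masses P R (fst (w k)) (half_point P R A w d k)
    = (x k + dx k, point_masses (Tset P) p (\<lambda>i. y k i + dy k i) (\<lambda>i. \<tau> i (x k + dx k)), V k + dV k)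
   \<and> (\<exists>y'. half_point P R A w d k = (x k + dx k, y', V k + dV k) \<and> (\<forall>i<np P R (x k). 0 \<le> y' i))"
  using half_size_one ev_renumbers ev_rdom filterlim_iff[THEN iffD1, OF newton.x_new_tendsto, rule_format,
      OF eventually_rdom[OF xs_rdom]]
proof eventually_elim
  case (elim k)
  let ?y = "\<lambda>i. measure (fst (snd (w k))) {branch R (x k) i (x k)} + fst (snd (d k)) i"
  have h: "half_point P R A w d k = (x k + dx k, ?y, V k + dV k)"
    unfolding half_point_def elim(1) x_def[symmetric] to_masses_iterate by (subst d_eq) (simp add: move_def)
  have "\<forall>i<np P R (x k). 0 \<le> ?y i"
    using step_equations(3)[of k] by (simp add: eq_c_def)
  moreover have "point_masses (Tset P) p (?y \<circ> num k) (\<lambda>i. \<tau> i (x k + dx k))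
     = point_masses (Tset P) p (\<lambda>i. y k i + dy k i) (\<lambda>i. \<tau> i (x k + dx k))"
  proof -
    have "(\<Sum>i<p. ennreal ((?y \<circ> num k) i) * f i) = (\<Sum>i<p. ennreal (y k i + dy k i) * f i)" for f
      by (rule sum.cong) (auto simp: masses_num[OF elim(2,3)] dy_def)
    then show ?thesis unfolding point_masses_def by simp
  qed
  ultimately show ?case unfolding h x_def[symmetric] from_masses_pi[OF elim(2,4)] by simp
qed

lemma ev_new_inj_dom: "\<forall>\<^sub>F k in sequentially. x k + dx k \<in> inj_dom"
  using filterlim_iff[THEN iffD1, OF newton.x_new_tendsto] eventually_inj_dom[OF xs_inj_dom] by blast

text \<open>The residual at the new point is of order \<open>mu'\<close> to the power \<open>1 + alpha A\<close>. The radius of the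
neighbourhood is of order \<open>mu\<close> to the power \<open>1 + ct * alpha A\<close>, hence of \<open>mu'\<close> to the power
\<open>(1 + cexp A * alpha A) * (1 + ct * alpha A)\<close>, and the upper bound on \<open>ct\<close> says that this
exponent is less than \<open>1 + alpha A\<close>.\<close>

lemma half_point_in_nbhd:
  assumes ct: "ct < (1 - cexp A) / (1 + cexp A * alpha A)"
  shows "\<forall>\<^sub>F k in sequentially. masses_in_nbhd P R (fst (w k)) (mu_seq A k)
         (gamma1 A * mu_seq A k powr (1 + ct * alpha A)) (half_point P R A w d k)"
proof -
  let ?r = "(1 + cexp A * alpha A) * (1 + ct * alpha A)"
  \<comment> \<open>A quarter of the radius for each of the four components of the residual.\<close>
  let ?K = "gamma1 A * gamma2 A powr (1 + ct * alpha A) / 4"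
  have ca: "0 < 1 + cexp A * alpha A" using param_bounds by (simp add: add_pos_nonneg)
  have "ct * (1 + cexp A * alpha A) < 1 - cexp A" using ct ca by (simp add: pos_less_divide_eq)
  then have "(ct * (1 + cexp A * alpha A)) * alpha A < (1 - cexp A) * alpha A"
    using param_bounds(1) by (rule mult_strict_right_mono)
  then have r: "?r < 1 + alpha A" by (simp add: algebra_simps)
  have K: "0 < ?K" using param_bounds by simp
  note small = newton.eventually_le_smaller_power[OF _ r K]
  have feas: "\<forall>\<^sub>F k in sequentially. \<forall>i\<in>{..<p}. norm (max (gh i (x k + dx k)) 0) \<le> ?K * mu' k powr ?r"
    by (intro eventually_ball_finite ballI small newton.new_feasibility) auto
  show ?thesis
    using feas small[OF newton.new_stationarity] small[OF newton.new_complementarity] small[OF newton.new_sdp]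
      newton.mu_eq half_point_eq ev_new_inj_dom newton.new_pd newton_signs ev_discrete
  proof eventually_elim
    case (elim k)
    let ?x = "x k + dx k" and ?V = "V k + dV k" and ?c = "\<lambda>i. y k i + dy k i"
    let ?m = "point_masses (Tset P) p ?c (\<lambda>i. \<tau> i ?x)"
    let ?e = "gamma1 A * mu_seq A k powr (1 + ct * alpha A)"
    have e4: "?K * mu' k powr ?r = ?e / 4"
      unfolding elim(5) using param_bounds newton.mu'_pos[of k]
      by (simp add: powr_mult powr_powr)
    have x: "?x \<in> inj_dom" by (rule elim(7))
    have xr: "?x \<in> rdom R xs" by (rule inj_domD(1)[OF x])
    have c0: "0 \<le> ?c i" if "i < p" for i using elim(9) that by blast
    have e0: "0 \<le> ?e / 4" using param_bounds by simp
    have pd: "Fmat P ?x \<in> pd" "?V \<in> pd" using elim(8) by auto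
    have "jprod (Fmat P ?x) ?V - mu_seq A k *\<^sub>R mat 1 \<in> sym_mat"
      by (intro sym_mat_diff jprod_sym pd_sym pd sym_mat_scaleR sym_mat_one)
    then have sdp: "svec_norm (jprod (Fmat P ?x) ?V - mu_seq A k *\<^sub>R mat 1) \<le> ?e / 4"
      using elim(4) unfolding e4 by (simp add: svec_norm_sym)
    have "theta P ?x \<le> ?e / 4"
    proof (rule theta_le[OF thresh Ssig_eq[OF xr] e0])
      fix i assume "i < p"
      then have "norm (max (gh i ?x) 0) \<le> ?e / 4" using elim(1) unfolding e4 by blast
      then show "con P ?x (\<tau> i ?x) \<le> ?e / 4" by (simp add: ghat_def)
    qed
    moreover have "norm (phi1 P (?x, ?m, ?V)) \<le> ?e / 4"
      using elim(2)[unfolded e4] phi_point_masses(1)[OF x c0, where V="?V"] by simp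
    moreover have "\<bar>phi2 P (?x, ?m, ?V)\<bar> \<le> ?e / 4"
      using elim(3)[unfolded e4] phi_point_masses(2)[OF x c0, where V="?V"] by simp
    ultimately have res: "residual P (mu_seq A k) (?x, ?m, ?V) \<le> ?e"
      by (intro residual_leI theta_nonneg sdp)
    have "?m \<in> Mplus (Tset P)" by (intro point_masses_Mplus T_borel tau_in_T xr)
    then have nb: "(?x, ?m, ?V) \<in> nbhd P (mu_seq A k) ?e" using res pd by (simp add: nbhd_def)
    obtain y' where y': "half_point P R A w d k = (?x, y', ?V)" "\<forall>i<np P R (x k). 0 \<le> y' i"
      using elim(6) by blast
    have "from_masses P R (x k) (?x, y', ?V) \<in> nbhd P (mu_seq A k) ?e"
      using elim(6) nb unfolding y'(1) x_def[symmetric] by simp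
    then show ?case
      unfolding y'(1) masses_in_nbhd_def x_def[symmetric] using y'(2) xr elim(10) by simp
  qed
qed

lemma half_point_distance:
  "(\<lambda>k. wdist P R ws (from_masses P R (fst (w k)) (half_point P R A w d k)))
      \<in> O(\<lambda>k. wdist P R ws (w k) powr (1 + cexp A * alpha A))"
proof -
  let ?h = "\<lambda>k. wdist P R ws (from_masses P R (fst (w k)) (half_point P R A w d k))"
  have wnn: "0 \<le> wdist P R ws u" for u using wdist_components(1)[of u] norm_ge_zero order_trans by blast
  have "?h \<preceq> newton.n"
  proof (rule dominated_eventually_le)
    show "\<forall>\<^sub>F k in sequentially. norm (?h k) \<le> norm (newton.n k)"
      using half_point_eq ev_new_inj_dom newton_signs newton.sym_vV
    proof eventually_elim
      case (elim k)
      let ?x = "x k + dx k" and ?c = "\<lambda>i. y k i + dy k i"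
      have c0: "0 \<le> ?c i" if "i < p" for i using elim(3) that by blast
      have m: "measure (point_masses (Tset P) p ?c (\<lambda>i. \<tau> i ?x)) {\<tau> i ?x} = ?c i" if "i < p" for i
        by (rule measure_point_masses[where p="\<lambda>i. \<tau> i ?x", OF T_borel tau_in_T[OF inj_domD(1)[OF elim(2)]]
              inj_domD(2)[OF elim(2)] c0 that])
      have "?h k = sqrt ((norm (newton.vx k))\<^sup>2 + (\<Sum>i<p. (newton.vy i k)\<^sup>2) + (norm (newton.vV k))\<^sup>2)"
        unfolding wdist_eq conjunct1[OF elim(1)] svec_norm_sym[OF elim(4), symmetric]
        by (simp add: m newton.vx_def newton.vy_def newton.vV_def)
      also have "\<dots> \<le> norm (newton.vx k) + sqrt (\<Sum>i<p. (newton.vy i k)\<^sup>2) + norm (newton.vV k)"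
        by (intro order_trans[OF sqrt_add_le_add_sqrt] add_mono) (auto intro!: add_nonneg_nonneg sum_nonneg sqrt_add_le_add_sqrt[THEN order_trans])
      also have "\<dots> \<le> newton.n k"
        unfolding newton.n_def using L2_set_le_sum_abs[of "\<lambda>i. newton.vy i k" "{..<p}"] by (simp add: L2_set_def)
      finally show ?case using wnn by simp
    qed
  qed
  also have "newton.n \<preceq> (\<lambda>k. (norm (newton.hx k) + norm (newton.hV k)) powr (1 + cexp A * alpha A))"
    by (rule newton.new_distance)
  also (dominated_trans) have "\<dots> \<preceq> (\<lambda>k. wdist P R ws (w k) powr (1 + cexp A * alpha A))"
  proof (rule dominated_powr)
    show "(\<lambda>k. norm (newton.hx k) + norm (newton.hV k)) \<preceq> (\<lambda>k. wdist P R ws (w k))"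
    proof (intro dominated_add dominated_eventually_le)
      show "\<forall>\<^sub>F k in sequentially. norm (norm (newton.hx k)) \<le> norm (wdist P R ws (w k))"
        using wdist_components(1)[of "w _"] wnn by (simp add: newton.hx_def x_def)
      show "\<forall>\<^sub>F k in sequentially. norm (norm (newton.hV k)) \<le> norm (wdist P R ws (w k))"
        using ev_norm_V
      proof eventually_elim
        case (elim k)
        then have "norm (V k - Vs) \<le> wdist P R ws (w k)" by (metis V_def wdist_components(2))
        then show ?case using wnn by (simp add: newton.hV_def)
      qed
    qed
    show "0 \<le> 1 + cexp A * alpha A" using param_bounds by (simp add: add_nonneg_nonneg)
  qed (use wnn in \<open>auto simp: add_nonneg_nonneg\<close>)
  finally (dominated_trans) have "?h \<preceq> (\<lambda>k. wdist P R ws (w k) powr (1 + cexp A * alpha A))" .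
  then show ?thesis by (auto simp: dominated_def intro: bigoI)
qed

end

theorem proposition6:
  fixes P :: "('n::finite, 'm::{finite,linorder}, 'q::finite) sisdp"
    and R :: "('n, 'q) reduction"
    and A :: alg_params
    and w :: "nat \<Rightarrow> ('n, 'm, 'q) point"
    and d :: "nat \<Rightarrow> ('n, 'm) vpoint"
    and ws :: "('n, 'm, 'q) point"
    and ct :: real
  assumes "sisdp_problem P"
    and "thresh R > 0"
    and "\<And>x. x \<in> insert (fst ws) (range (\<lambda>k. fst (w k))) \<Longrightarrow>
           nondegenerate P (thresh R) x \<Longrightarrow> local_reduction P R x"
    and "valid_params A"
    and "algorithm2 P R A w d"
    and "assumption_B P R w ws"
    and "assumption_C P R w d ws"
    and "1/2 < ct" and "ct < (1 - cexp A) / (1 + cexp A * alpha A)"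
    and "(1 - cexp A) / (1 + cexp A * alpha A) < 1"
  shows "(\<forall>\<^sub>F k in sequentially. half_size P R A w d k = 1) \<and>
    (\<forall>\<^sub>F k in sequentially.
       masses_in_nbhd P R (fst (w k)) (mu_seq A k)
         (gamma1 A * mu_seq A k powr (1 + ct * alpha A)) (half_point P R A w d k)) \<and>
    (\<lambda>k. wdist P R ws (from_masses P R (fst (w k)) (half_point P R A w d k)))
      \<in> O(\<lambda>k. wdist P R ws (w k) powr (1 + cexp A * alpha A))"
proof -
  interpret algorithm_limit P R A w d ws
    using assms by unfold_locales
  show ?thesis
    using half_size_one half_point_in_nbhd[OF assms(9)] half_point_distance by blast
qed

end
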